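(* Let $\lambda\in\mathbb{R}_+$, let $p\le\nu<n$ be nonnegative integers, and consider the Lure system $$\dot x = Ax+B_u u+B_w w,\quad y=C_y x,\quad z=C_z x,\quad w=-\varphi(z),\qquad (\mathrm{S})$$ with $x\in\mathbb{R}^n$ and $u,y,w,z\in\mathbb{R}$, where $A\in\mathbb{R}^{n\times n}$, $B_u,B_w\in\mathbb{R}^{n\times 1}$, $C_y,C_z\in\mathbb{R}^{1\times n}$, and $\varphi:\mathbb{R}\to\mathbb{R}$ is continuously differentiable with $\varphi(0)=0$. Let $$\dot{\hat x}=\hat A\hat x+\hat B_u\hat u+\hat B_w\hat w,\quad \hat y=\hat C_y\hat x,\quad \hat z=\hat C_z\hat x,\quad \hat w=-\varphi(\hat z),\qquad (\hat{\mathrm{S}})$$ with $\hat x\in\mathbb{R}^\nu$, be a reduced order model of (S) obtained by the dominant/non-dominant splitting construction with rate $\lambda$ and $p$ dominant eigenvalues described in the context. Let $G$, $\hat G$ be the $2\times 2$ transfer functions of the linear parts of (S) and $(\hat{\mathrm S})$, let $G_{zw}(s)=C_z(sI-A)^{-1}B_w$, and let $\tilde G=G-\hat G$. Assume: (A1)$^\star$ the linear dynamics $\dot{\hat x}=\hat A\hat x+\hat B_u\hat u+\hat B_w\hat w$, $\hat y=\hat C_y\hat x$, $\hat z=\hat C_z\hat x$ is strictly $p$-dominant with rate $\lambda$; (A2)$^\star$ $\partial\varphi\in[-\mu,\mu]$, with $\mu\in\mathbb{R}_+$, $\mu>0$; (A3)$^\star$ $\|\tilde G\|_{\infty,0}\le\epsilon$,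 with $0<\epsilon<\mu^{-1}$; (A4)$^\star$ $\|G_{zw}\|_{\infty,p}<\mu^{-1}-\epsilon$, where the norms are taken with respect to the rate $\lambda$. Then the reduced order model $(\hat{\mathrm S})$ is strictly $p$-dominant with rate $\lambda$.
   Context: $\mathbb{R}_+$ denotes the nonnegative reals. **Dominance.** Consider $\dot x=f(x)+Bu$ with $f:\mathbb{R}^N\to\mathbb{R}^N$ continuously differentiable and Jacobian $\partial f$. The system is $p$-dominant with rate $\lambda\in\mathbb{R}_+$ (for $u=0$) if there exist $\varepsilon\in\mathbb{R}_+$ and a symmetric matrix $P\in\mathbb{R}^{N\times N}$ with inertia $(p,0,N-p)$ (i.e. $p$ negative, no zero, and $N-p$ positive eigenvalues) such that, for all $(x,\delta x)\in\mathbb{R}^N\times\mathbb{R}^N$, with $\dot{\delta x}=\partial f(x)\delta x$, $$\begin{bmatrix}\dot{\delta x}\\ \delta x\end{bmatrix}^{\mathsf T}\begin{bmatrix}0 & P \\ P & 2\lambda P+\varepsilon I\end{bmatrix}\begin{bmatrix}\dot{\delta x}\\ \delta x\end{bmatrix}\le 0 .$$ It is strictly $p$-dominant if this holds with some $\varepsilon>0$. For the reduced linear dynamics, $N=\nu$ and $f(\hat x)=\hat A\hat x$ (inputs $\hat u,\hat w$ set to zero). For the reduced order model $(\hat{\mathrm S})$, $N=\nu$ and $f(\hat x)=\hat A\hat x-\hat B_w\varphi(\hat C_z\hat x)$ (with $\hat u=0$). **Sector condition.** $\partial\varphi\in[\alpha,\beta]$ means $(\partial\varphi(z)\,\delta z-\alpha\,\delta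 z)(\partial\varphi(z)\,\delta z-\beta\,\delta z)\le 0$ for all $z,\delta z\in\mathbb{R}$, where $\partial\varphi$ is the derivative of $\varphi$. **Transfer functions.** With $B=[\,B_u\ B_w\,]$ and $C=[\,C_y^{\mathsf T}\ C_z^{\mathsf T}\,]^{\mathsf T}$, set $G(s)=C(sI-A)^{-1}B$, with entries $G_{yu},G_{yw},G_{zu},G_{zw}$; similarly $\hat G(s)=\hat C(sI-\hat A)^{-1}\hat B$ with $\hat B=[\,\hat B_u\ \hat B_w\,]$, $\hat C=[\,\hat C_y^{\mathsf T}\ \hat C_z^{\mathsf T}\,]^{\mathsf T}$. **Norm.** For a rational transfer function $H$ with no poles on the line $\mathrm{Re}(s)=-\lambda$ and exactly $q$ poles in the open half-plane $\mathrm{Re}(s)>-\lambda$, $$\|H\|_{\infty,q}=\sup_{\omega\in\mathbb{R}}\sigma_{\max}\big(H(i\omega-\lambda)\big),$$ where $\sigma_{\max}$ is the largest singular value. (Writing $\|H\|_{\infty,q}$ presupposes that $H$ has these pole properties. The norm depends on $\lambda$.) **Construction of the reduced order model.** After a possible linear change of state coordinates in (S), write $$A=\begin{bmatrix}A^+ & 0 \\ 0 & A^-\end{bmatrix},\quad B=\begin{bmatrix}B^+ \\ B^-\end{bmatrix},\quad C=\begin{bmatrix}C^+ & C^-\end{bmatrix},$$ where $A^+\in\mathbb{R}^{p\times p}$ has only dominant eigenvalues ($\mathrm{Re}>-\lambda$) and $A^-\in\mathbb{R}^{(n-p)\times(n-p)}$ has only non-dominant eigenvalues ($\mathrm{Re}<-\lambda$).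 Replace the non-dominant linear dynamics $(A^-,B^-,C^-)$ by a reduced linear model $(\hat A^-,\hat B^-,\hat C^-)$ of order $\nu-p$, with the same numbers of inputs and outputs, produced by a stability-preserving reduction method, so that all eigenvalues of $\hat A^-$ satisfy $\mathrm{Re}<-\lambda$. The reduced order model is defined by $$\hat A=\begin{bmatrix}A^+ & 0 \\ 0 & \hat A^-\end{bmatrix},\quad \hat B=\begin{bmatrix}B^+ \\ \hat B^-\end{bmatrix},\quad \hat C=\begin{bmatrix}C^+ & \hat C^-\end{bmatrix},$$ with the nonlinearity $\varphi$ left unchanged. *)

theory Defs
  imports
    "HOL-Complex_Analysis.Complex_Analysis"
    "Jordan_Normal_Form.Char_Poly"
    "Jordan_Normal_Form.Schur_Decomposition"
    "Jordan_Normal_Form.Gauss_Jordan_Elimination"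
    "Jordan_Normal_Form.DL_Submatrix"
begin

unbundle no vec_syntax
hide_const (open) Finite_Cartesian_Product.vec Finite_Cartesian_Product.mat Determinants.det

section \<open>Dominance\<close>

definition jacobian :: "nat \<Rightarrow> (real vec \<Rightarrow> real vec) \<Rightarrow> real vec \<Rightarrow> real mat" where
  "jacobian N f x = mat N N (\<lambda>(i, j). deriv (\<lambda>t. f (x + t \<cdot>\<^sub>v unit_vec N j) $ i) 0)"

text \<open>
  The type of vectors carries no topology, so continuity of a function on \<open>carrier_vec N\<close> is
  expressed by precomposition with the (open, continuous, surjective) coordinate projection
  \<open>vec N\<close> from \<open>nat \<Rightarrow> real\<close> with the product topology.
\<close>

definition continuously_differentiable_vec :: "nat \<Rightarrow> (real vec \<Rightarrow> real vec) \<Rightarrow> bool" where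
  "continuously_differentiable_vec N f \<longleftrightarrow>
     f \<in> carrier_vec N \<rightarrow> carrier_vec N \<and>
     (\<forall>i<N. \<forall>j<N.
        (\<forall>x \<in> carrier_vec N.
           (\<lambda>t::real. f (x + t \<cdot>\<^sub>v unit_vec N j) $ i) field_differentiable (at 0)) \<and>
        continuous_on UNIV (\<lambda>v :: nat \<Rightarrow> real. jacobian N f (vec N v) $$ (i, j)))"

text \<open>Number of real eigenvalues in \<open>S\<close>, counted with algebraic multiplicity.\<close>

definition eigenvalue_count :: "real mat \<Rightarrow> real set \<Rightarrow> nat" where
  "eigenvalue_count P S = (\<Sum>k | eigenvalue P k \<and> k \<in> S. Polynomial.order k (char_poly P))"

definition inertia :: "real mat \<Rightarrow> nat \<times> nat \<times> nat" where
  "inertia P = (eigenvalue_count P {..<0}, eigenvalue_count P {0}, eigenvalue_count P {0<..})"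

definition dominant_with ::
    "real \<Rightarrow> nat \<Rightarrow> nat \<Rightarrow> real \<Rightarrow> (real vec \<Rightarrow> real vec) \<Rightarrow> bool" where
  "dominant_with \<epsilon> p N rate f \<longleftrightarrow>
     (\<exists>P \<in> carrier_mat N N. transpose_mat P = P \<and> inertia P = (p, 0, N - p) \<and>
        (\<forall>x \<in> carrier_vec N. \<forall>dx \<in> carrier_vec N.
           (let \<xi> = (jacobian N f x *\<^sub>v dx) @\<^sub>v dx;
                M = four_block_mat (0\<^sub>m N N) P P ((2 * rate) \<cdot>\<^sub>m P + \<epsilon> \<cdot>\<^sub>m 1\<^sub>m N)
            in scalar_prod \<xi> (M *\<^sub>v \<xi>) \<le> 0)))"

definition strictly_dominant ::
    "nat \<Rightarrow> nat \<Rightarrow> real \<Rightarrow> (real vec \<Rightarrow> real vec) \<Rightarrow> bool" where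
  "strictly_dominant p N rate f \<longleftrightarrow>
     continuously_differentiable_vec N f \<and> (\<exists>\<epsilon>>0. dominant_with \<epsilon> p N rate f)"

section \<open>Lure systems\<close>

definition deriv_in_sector :: "(real \<Rightarrow> real) \<Rightarrow> real \<Rightarrow> real \<Rightarrow> bool" where
  "deriv_in_sector \<phi> \<alpha> \<beta> \<longleftrightarrow>
     (\<forall>z dz. (deriv \<phi> z * dz - \<alpha> * dz) * (deriv \<phi> z * dz - \<beta> * dz) \<le> 0)"

text \<open>
  The closed-loop vector field for zero external input, where \<open>B\<^sub>w\<close> has a single column
  and \<open>C\<^sub>z\<close> a single row.
\<close>

definition lure_field ::
    "real mat \<Rightarrow> real mat \<Rightarrow> real mat \<Rightarrow> (real \<Rightarrow> real) \<Rightarrow> real vec \<Rightarrow> real vec" where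
  "lure_field A B\<^sub>w C\<^sub>z \<phi> x = A *\<^sub>v x - B\<^sub>w *\<^sub>v vec 1 (\<lambda>_. \<phi> ((C\<^sub>z *\<^sub>v x) $ 0))"

definition append_cols :: "'a :: zero mat \<Rightarrow> 'a mat \<Rightarrow> 'a mat" (infixr \<open>@\<^sub>c\<close> 65) where
  "A @\<^sub>c B = four_block_mat A B (0\<^sub>m 0 (dim_col A)) (0\<^sub>m 0 (dim_col B))"

section \<open>Transfer functions and their norms\<close>

abbreviation complex_mat :: "real mat \<Rightarrow> complex mat" where
  "complex_mat \<equiv> map_mat complex_of_real"

text \<open>
  The value is meaningful only where \<open>s\<close> is not an eigenvalue of \<open>A\<close>; the pole notions below
  depend on punctured neighbourhoods only.
\<close>

definition transfer_function :: "real mat \<Rightarrow> real mat \<Rightarrow> real mat \<Rightarrow> complex \<Rightarrow> complex mat" where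
  "transfer_function A B C s =
     complex_mat C * the (mat_inverse (s \<cdot>\<^sub>m 1\<^sub>m (dim_row A) - complex_mat A)) * complex_mat B"

definition pole_order :: "(complex \<Rightarrow> complex) \<Rightarrow> complex \<Rightarrow> nat" where
  "pole_order f z = (if is_pole f z then nat (- zorder f z) else 0)"

text \<open>
  Multiplicity of \<open>z\<close> as a pole of a rational matrix in the McMillan sense: the multiplicity of
  \<open>z\<close> as a root of the least common denominator of all minors. The empty minor contributes 0.
\<close>

definition pole_multiplicity :: "(complex \<Rightarrow> complex mat) \<Rightarrow> complex \<Rightarrow> nat" where
  "pole_multiplicity H z =
     Max {pole_order (\<lambda>s. det (submatrix (H s) I J)) z | I J.
            I \<subseteq> {..<dim_row (H z)} \<and> J \<subseteq> {..<dim_col (H z)} \<and> card I = card J}"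

text \<open>
  The condition, presupposed by \<open>\<parallel>H\<parallel>\<^sub>\<infinity>\<^sub>,\<^sub>q\<close>, that a rational \<open>H\<close> has no poles on the line
  \<open>Re s = - rate\<close> and exactly \<open>q\<close> poles, counted with multiplicity, to its right.
\<close>

definition pole_condition :: "real \<Rightarrow> nat \<Rightarrow> (complex \<Rightarrow> complex mat) \<Rightarrow> bool" where
  "pole_condition rate q H \<longleftrightarrow>
     (\<forall>z. Re z = - rate \<longrightarrow> pole_multiplicity H z = 0) \<and>
     finite {z. Re z > - rate \<and> pole_multiplicity H z > 0} \<and>
     (\<Sum>z | Re z > - rate \<and> pole_multiplicity H z > 0. pole_multiplicity H z) = q"

definition singular_values :: "complex mat \<Rightarrow> real set" where
  "singular_values M = {\<sigma>. 0 \<le> \<sigma> \<and> eigenvalue (mat_adjoint M * M) (complex_of_real (\<sigma>\<^sup>2))}"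

definition sigma_max :: "complex mat \<Rightarrow> real" where
  "sigma_max M = Max (singular_values M)"

definition line_norm :: "real \<Rightarrow> (complex \<Rightarrow> complex mat) \<Rightarrow> ereal" where
  "line_norm rate H =
     (SUP \<omega>::real. ereal (sigma_max (H (\<i> * complex_of_real \<omega> - complex_of_real rate))))"

section \<open>Reduction by dominant/non-dominant splitting\<close>

text \<open>
  \<open>A\<close>, \<open>B\<close>, \<open>C\<close> are brought to block form by the state coordinate change with matrix \<open>T\<close>. The
  reduction method enters only through the order and the spectrum of the reduced
  non-dominant part.
\<close>

definition splitting_reduction ::
    "real \<Rightarrow> nat \<Rightarrow> nat \<Rightarrow> nat \<Rightarrow> nat \<Rightarrow> nat \<Rightarrow>
     real mat \<Rightarrow> real mat \<Rightarrow> real mat \<Rightarrow> real mat \<Rightarrow> real mat \<Rightarrow> real mat \<Rightarrow> bool" where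
  "splitting_reduction rate p n \<nu> m k A B C A' B' C' \<longleftrightarrow>
     (\<exists>T T_inv A_dom A_non B_dom B_non C_dom C_non A_red B_red C_red.
        A_dom \<in> carrier_mat p p \<and> A_non \<in> carrier_mat (n - p) (n - p) \<and>
        B_dom \<in> carrier_mat p m \<and> B_non \<in> carrier_mat (n - p) m \<and>
        C_dom \<in> carrier_mat k p \<and> C_non \<in> carrier_mat k (n - p) \<and>
        A_red \<in> carrier_mat (\<nu> - p) (\<nu> - p) \<and>
        B_red \<in> carrier_mat (\<nu> - p) m \<and> C_red \<in> carrier_mat k (\<nu> - p) \<and>
        similar_mat_wit A
          (four_block_mat A_dom (0\<^sub>m p (n - p)) (0\<^sub>m (n - p) p) A_non) T T_inv \<and>
        B = T * (B_dom @\<^sub>r B_non) \<and>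
        C = (C_dom @\<^sub>c C_non) * T_inv \<and>
        (\<forall>s. eigenvalue (complex_mat A_dom) s \<longrightarrow> Re s > - rate) \<and>
        (\<forall>s. eigenvalue (complex_mat A_non) s \<longrightarrow> Re s < - rate) \<and>
        (\<forall>s. eigenvalue (complex_mat A_red) s \<longrightarrow> Re s < - rate) \<and>
        A' = four_block_mat A_dom (0\<^sub>m p (\<nu> - p)) (0\<^sub>m (\<nu> - p) p) A_red \<and>
        B' = B_dom @\<^sub>r B_red \<and>
        C' = C_dom @\<^sub>c C_red)"

end

theory Submission
  imports Defs
begin

text \<open>
  On the line \<open>Re s = - rate\<close> the reduced loop gain is at most \<open>\<parallel>G\<^sub>z\<^sub>w\<parallel> + \<epsilon> < 1 / \<mu>\<close>. The strict
  bounded real lemma for \<open>A' + rate I\<close>, which has no eigenvalue on the imaginary axis but need not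
  be stable, then provides a symmetric \<open>P\<close> for which the dominance inequality holds with every
  slope in \<open>[- \<mu>, \<mu>]\<close>. The inertia of \<open>P\<close> is the one of the matrix \<open>Q\<close> given by the dominance of the
  linear part: both satisfy the same strict Lyapunov inequality, so the segment from \<open>Q\<close> to \<open>P\<close>
  contains no singular matrix and the inertia cannot change along it.

  The bounded real lemma is proved by duality. If no \<open>P\<close> exists, separation yields a nonzero positive
  semidefinite \<open>W\<close>, and diagonalizing a skew-Hermitian matrix splits \<open>W\<close> into rank-one terms, each
  belonging to a sinusoidal response of the system; at least one of them would violate the gain bound.
\<close>

section \<open>Spectral theorem for Hermitian matrices\<close>

text \<open>Existence proofs by Riccati equations or by integrating trajectories lean on stability,
  but \<open>A' + rate I\<close> has \<open>p\<close> eigenvalues in the right half-plane. Duality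
  asks only for the gain on the axis and for the absence of eigenvalues there. The price is that
  \<open>P\<close> comes without any information on its signs, hence the separate inertia argument.
  Strictness comes from compactness: over matrices of trace one the violation of the dual
  constraints attains a positive minimum, and this minimum becomes the margin in the matrix
  inequality. The gain bound is phrased as an implication about all sinusoidal responses rather than
  by a resolvent; this form survives a unitary change of state coordinates and involves no inverse.
  Vectors and matrices are mostly functions on indices, because function types carry the product
  topology that compactness and continuity arguments use.\<close>

lemma compact_function_set:
  fixes S :: "('i \<Rightarrow> 'a :: heine_borel) set"
  assumes "closed S" and "\<And>x i. x \<in> S \<Longrightarrow> dist a (x i) \<le> B"
  shows "compact S"
proof -
  have "compactin (product_topology (\<lambda>_. euclidean) UNIV) (PiE UNIV (\<lambda>_::'i. cball a B))"
    by (subst compactin_PiE) auto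
  then have "compact (PiE (UNIV :: 'i set) (\<lambda>_. cball a B))"
    by (simp add: euclidean_product_topology)
  moreover have "S = S \<inter> PiE (UNIV :: 'i set) (\<lambda>_. cball a B)"
    using assms(2) by auto
  ultimately show ?thesis
    using closed_Int_compact[OF assms(1)] by metis
qed

text \<open>Padding with zero rows makes the system square. Its last row is zero because
  \<open>m < n\<close>, so the transpose kills a unit vector, the determinant vanishes and a kernel
  vector exists.\<close>

lemma underdetermined_system_has_solution:
  fixes M :: "nat \<Rightarrow> nat \<Rightarrow> 'a :: field"
  assumes "m < n"
  shows "\<exists>x. (\<exists>i<n. x i \<noteq> 0) \<and> (\<forall>j<m. (\<Sum>i<n. M j i * x i) = 0)"
proof -
  define A where "A = mat n n (\<lambda>(j, i). if j < m then M j i else 0)"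
  have A: "A \<in> carrier_mat n n" by (simp add: A_def)
  have "transpose_mat A *\<^sub>v unit_vec n (n - 1) = 0\<^sub>v n"
    using assms by (intro eq_vecI) (auto simp: A_def scalar_prod_def intro!: sum.neutral)
  moreover have "unit_vec n (n - 1) \<noteq> (0\<^sub>v n :: 'a vec)"
    using assms by (simp add: unit_vec_nonzero)
  ultimately have "Determinant.det (transpose_mat A) = 0"
    using A by (subst det_0_iff_vec_prod_zero_field) (auto intro!: exI[of _ "unit_vec n (n - 1)"])
  then have "Determinant.det A = 0"
    using det_transpose[OF A] by simp
  then obtain v where v: "v \<in> carrier_vec n" "v \<noteq> 0\<^sub>v n" "A *\<^sub>v v = 0\<^sub>v n"
    using det_0_iff_vec_prod_zero_field[OF A] by blast
  have "\<exists>i<n. v $ i \<noteq> 0"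
    using v(1,2) by (metis carrier_vecD eq_vecI index_zero_vec(1) index_zero_vec(2))
  moreover have "(\<Sum>i<n. M j i * v $ i) = 0" if "j < m" for j
  proof -
    have "(A *\<^sub>v v) $ j = 0" using v(3) that assms by simp
    then show ?thesis
      using that assms v(1) by (simp add: A_def scalar_prod_def atLeast0LessThan)
  qed
  ultimately show ?thesis by blast
qed

lemma row_orthonormal_if_column_orthonormal:
  fixes U :: "nat \<Rightarrow> nat \<Rightarrow> complex"
  assumes "\<And>i j. i < n \<Longrightarrow> j < n \<Longrightarrow> (\<Sum>k<n. cnj (U k i) * U k j) = (if i = j then 1 else 0)"
    and "i < n" "j < n"
  shows "(\<Sum>k<n. U i k * cnj (U j k)) = (if i = j then 1 else 0)"
proof -
  define M where "M = mat n n (\<lambda>(i, j). U i j)"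
  define N where "N = mat n n (\<lambda>(i, j). cnj (U j i))"
  have MN: "M \<in> carrier_mat n n" "N \<in> carrier_mat n n" by (auto simp: M_def N_def)
  have "N * M = 1\<^sub>m n"
    using assms(1) by (intro eq_matI) (auto simp: M_def N_def scalar_prod_def atLeast0LessThan)
  then have "M * N = 1\<^sub>m n"
    using mat_mult_left_right_inverse[OF MN(2,1)] by blast
  then have "(M * N) $$ (i, j) = (if i = j then 1 else 0)"
    using assms(2,3) by simp
  then show ?thesis
    using assms(2,3) by (simp add: M_def N_def scalar_prod_def atLeast0LessThan)
qed

text \<open>Stationarity without limits: the single test value \<open>t = a / c\<close> with
  \<open>c > b\<close> already contradicts \<open>a \<noteq> 0\<close>. It serves both for the
  maximum of a quadratic form and for kernel directions of a semidefinite one.\<close>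

lemma linear_bounded_by_quadratic_zero:
  fixes a b :: real
  assumes "\<And>t. t * a \<le> t\<^sup>2 * b"
  shows "a = 0"
proof (rule ccontr)
  assume "a \<noteq> 0"
  define c where "c = \<bar>b\<bar> + 1"
  have "c > 0" by (simp add: c_def)
  have "c\<^sup>2 * ((a / c) * a) \<le> c\<^sup>2 * ((a / c)\<^sup>2 * b)"
    by (rule mult_left_mono[OF assms]) simp
  then have "a\<^sup>2 * c \<le> a\<^sup>2 * b"
    using \<open>c > 0\<close> by (simp add: power2_eq_square field_simps)
  then show False
    using \<open>a \<noteq> 0\<close> by (simp add: c_def mult_le_cancel_left_pos)
qed

lemma closed_Collect_ball_eq:
  fixes f :: "'i \<Rightarrow> 'a :: topological_space \<Rightarrow> 'b :: t2_space"
  assumes "\<And>i. i \<in> I \<Longrightarrow> continuous_on UNIV (f i)"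
  shows "closed {x. \<forall>i\<in>I. f i x = c i}"
proof -
  have "{x. \<forall>i\<in>I. f i x = c i} = (\<Inter>i\<in>I. {x. f i x = c i})" by auto
  then show ?thesis
    using assms by (auto intro!: closed_INT closed_Collect_eq)
qed

lemma cmod_add_mult_power2:
  "(cmod (a + of_real t * b))\<^sup>2 = (cmod a)\<^sup>2 + t * (2 * Re (cnj b * a)) + t\<^sup>2 * (cmod b)\<^sup>2"
  unfolding cmod_power2 by (simp add: algebra_simps power2_eq_square)

lemma Re_of_real_mult: "Re (of_real r * z) = r * Re z"
  by simp

text \<open>The quadratic form of \<open>H\<close> is maximized over the unit vectors orthogonal to
  the eigenvectors \<open>u\<close> already found. That complement is invariant under
  \<open>H\<close>, so the maximizer solves the eigenvalue equation itself and not only up to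
  components along \<open>u\<close>.\<close>

lemma hermitian_eigenvector_step:
  fixes H u :: "nat \<Rightarrow> nat \<Rightarrow> complex" and d :: "nat \<Rightarrow> real"
  assumes herm: "\<And>i j. i < n \<Longrightarrow> j < n \<Longrightarrow> H j i = cnj (H i j)"
    and "m < n"
    and eig: "\<And>i k. i < n \<Longrightarrow> k < m \<Longrightarrow> (\<Sum>j<n. H i j * u j k) = d k * u i k"
  obtains x r where "(\<Sum>i<n. cnj (x i) * x i) = 1"
    and "\<And>k. k < m \<Longrightarrow> (\<Sum>i<n. cnj (u i k) * x i) = 0"
    and "\<And>i. i < n \<Longrightarrow> (\<Sum>j<n. H i j * x j) = complex_of_real r * x i"
proof -
  define C where "C = {x :: nat \<Rightarrow> complex. \<forall>k\<in>{..<m}. (\<Sum>i<n. cnj (u i k) * x i) = 0}"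
  define nq where "nq x = (\<Sum>i<n. (cmod (x i))\<^sup>2)" for x :: "nat \<Rightarrow> complex"
  \<comment> \<open>Coordinates from \<open>n\<close> on are pinned to zero; otherwise they would be
    unconstrained and \<open>S\<close> would not be compact.\<close>
  define S where "S = {x. \<forall>i\<in>{n..}. x i = 0} \<inter> {x. nq x = 1} \<inter> C"
  define q where "q x = (\<Sum>i<n. \<Sum>j<n. Re (cnj (x i) * H i j * x j))" for x
  have cont [continuous_intros]: "continuous_on A (\<lambda>x::nat\<Rightarrow>complex. x i)" for A i
    by (rule continuous_on_product_coordinates[THEN continuous_on_subset]) simp
  have "closed S"
    unfolding S_def nq_def C_def
    by (intro closed_Int closed_Collect_ball_eq closed_Collect_eq continuous_intros)
  moreover have "dist 0 (x i) \<le> 1" if "x \<in> S" for x i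
  proof (cases "i < n")
    case True
    then have "(cmod (x i))\<^sup>2 \<le> nq x"
      unfolding nq_def by (intro member_le_sum) auto
    then have "(cmod (x i))\<^sup>2 \<le> 1" using that by (simp add: S_def)
    then show ?thesis by (simp add: dist_norm abs_square_le_1)
  next
    case False
    then have "x i = 0" using that by (simp add: S_def)
    then show ?thesis by simp
  qed
  ultimately have "compact S" by (rule compact_function_set)
  obtain y where y: "\<exists>i<n. y i \<noteq> 0" "\<forall>k<m. (\<Sum>i<n. cnj (u i k) * y i) = 0"
    using underdetermined_system_has_solution[OF \<open>m < n\<close>, of "\<lambda>k i. cnj (u i k)"] by blast
  have scaled: "\<exists>x\<in>S. \<forall>i<n. y i = of_real (sqrt (nq y)) * x i"
    if ny: "nq y \<noteq> 0" and yC: "y \<in> C" for y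
  proof -
    have pos: "nq y > 0" using ny by (simp add: nq_def less_le sum_nonneg)
    define x where "x i = (if i < n then y i / of_real (sqrt (nq y)) else 0)" for i
    have "nq x = (\<Sum>i<n. (cmod (y i))\<^sup>2 / nq y)"
      using pos unfolding nq_def[of x]
      by (intro sum.cong) (auto simp: x_def norm_divide power_divide)
    also have "\<dots> = 1" using ny by (simp add: nq_def flip: sum_divide_distrib)
    finally have "nq x = 1" .
    moreover have "(\<Sum>i<n. cnj (u i k) * x i) = (\<Sum>i<n. cnj (u i k) * y i) / of_real (sqrt (nq y))" for k
      by (simp add: x_def sum_divide_distrib)
    ultimately have "x \<in> S" using yC by (auto simp: S_def C_def x_def)
    moreover have "\<forall>i<n. y i = of_real (sqrt (nq y)) * x i"
      using ny by (simp add: x_def)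
    ultimately show ?thesis by blast
  qed
  have "nq y \<noteq> 0" using y(1) by (auto simp: nq_def sum_nonneg_eq_0_iff)
  then have "S \<noteq> {}" using scaled[of y] y(2) by (auto simp: C_def)
  moreover have "continuous_on S q"
    unfolding q_def by (intro continuous_intros)
  ultimately obtain x where x: "x \<in> S" and max: "\<And>z. z \<in> S \<Longrightarrow> q z \<le> q x"
    using continuous_attains_sup[OF \<open>compact S\<close>] by blast
  define r where "r = q x"
  have bound: "q z \<le> r * nq z" if zC: "z \<in> C" for z
  proof (cases "nq z = 0")
    case True
    then have "\<forall>i<n. z i = 0" by (auto simp: nq_def sum_nonneg_eq_0_iff)
    then show ?thesis by (simp add: True q_def)
  next
    case False
    then obtain s where s: "s \<in> S" "\<forall>i<n. z i = of_real (sqrt (nq z)) * s i"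
      using scaled[OF False zC] by blast
    have "nq z \<ge> 0" by (simp add: nq_def sum_nonneg)
    have "q z = (\<Sum>i<n. \<Sum>j<n. nq z * Re (cnj (s i) * H i j * s j))"
      unfolding q_def
    proof (intro sum.cong refl)
      fix i j assume "i \<in> {..<n}" "j \<in> {..<n}"
      then have zs: "z i = of_real (sqrt (nq z)) * s i" "z j = of_real (sqrt (nq z)) * s j"
        using s(2) by auto
      have "cnj (z i) * H i j * z j = of_real (sqrt (nq z) * sqrt (nq z)) * (cnj (s i) * H i j * s j)"
        unfolding zs of_real_mult by (simp only: complex_cnj_mult complex_cnj_complex_of_real mult_ac)
      then have "Re (cnj (z i) * H i j * z j) = (sqrt (nq z) * sqrt (nq z)) * Re (cnj (s i) * H i j * s j)"
        by (simp only: Re_of_real_mult)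
      then show "Re (cnj (z i) * H i j * z j) = nq z * Re (cnj (s i) * H i j * s j)"
        using \<open>nq z \<ge> 0\<close> by simp
    qed
    also have "\<dots> = nq z * q s" by (simp add: q_def sum_distrib_left)
    finally show ?thesis
      using max[OF s(1)] \<open>nq z \<ge> 0\<close> by (simp add: r_def mult.commute mult_left_mono)
  qed
  \<comment> \<open>Residual of the eigenvalue equation. As a direction of variation it makes the
    linear coefficient exactly \<open>2 * nq g\<close>, so stationarity forces it to vanish.\<close>
  define g where "g i = (\<Sum>j<n. H i j * x j) - of_real r * x i" for i
  have xC: "\<And>k. k < m \<Longrightarrow> (\<Sum>i<n. cnj (u i k) * x i) = 0" and nx: "nq x = 1"
    using x by (auto simp: S_def C_def)
  have gC: "g \<in> C"
    unfolding C_def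
  proof (intro CollectI ballI)
    fix k assume "k \<in> {..<m}"
    then have k: "k < m" by simp
    have "(\<Sum>i<n. cnj (u i k) * (\<Sum>j<n. H i j * x j)) = (\<Sum>j<n. \<Sum>i<n. cnj (u i k) * H i j * x j)"
      unfolding sum_distrib_left mult.assoc by (rule sum.swap)
    also have "\<dots> = (\<Sum>j<n. cnj (\<Sum>i<n. H j i * u i k) * x j)"
      unfolding cnj_sum sum_distrib_right
    proof (intro sum.cong refl)
      fix i j assume "i \<in> {..<n}" "j \<in> {..<n}"
      then show "cnj (u i k) * H i j * x j = cnj (H j i * u i k) * x j"
        using herm[of i j] by simp
    qed
    also have "\<dots> = of_real (d k) * (\<Sum>j<n. cnj (u j k) * x j)"
      using eig k by (simp add: sum_distrib_left mult.assoc)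
    finally have "(\<Sum>i<n. cnj (u i k) * (\<Sum>j<n. H i j * x j)) = 0"
      using xC[OF k] by simp
    moreover have "(\<Sum>i<n. cnj (u i k) * g i) =
        (\<Sum>i<n. cnj (u i k) * (\<Sum>j<n. H i j * x j)) - of_real r * (\<Sum>i<n. cnj (u i k) * x i)"
      unfolding g_def right_diff_distrib sum_subtractf sum_distrib_left[of "of_real r"]
      by (simp only: mult.left_commute[of _ "of_real r"])
    ultimately show "(\<Sum>i<n. cnj (u i k) * g i) = 0"
      using xC[OF k] by simp
  qed
  \<comment> \<open>First variation of \<open>q - r * nq\<close> at its maximum \<open>x\<close> in the direction \<open>g\<close>, which is admissible by \<open>gC\<close>.\<close>
  have "t * (2 * nq g) \<le> t\<^sup>2 * (r * nq g - q g)" for t :: real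
  proof -
    let ?z = "\<lambda>i. x i + of_real t * g i"
    have "(\<Sum>i<n. cnj (u i k) * ?z i) =
        (\<Sum>i<n. cnj (u i k) * x i) + of_real t * (\<Sum>i<n. cnj (u i k) * g i)" for k
      unfolding distrib_left sum.distrib sum_distrib_left[of "of_real t"]
      by (simp only: mult.left_commute[of _ "of_real t"])
    then have "?z \<in> C"
      using xC gC by (simp add: C_def)
    then have bz: "q ?z \<le> r * nq ?z" by (rule bound)
    have qz: "q ?z = q x + t * (2 * (\<Sum>i<n. Re (cnj (g i) * (\<Sum>j<n. H i j * x j)))) + t\<^sup>2 * q g"
    proof -
      have 1: "(\<Sum>i<n. \<Sum>j<n. Re (cnj (x i) * H i j * g j)) = (\<Sum>i<n. \<Sum>j<n. Re (cnj (g i) * H i j * x j))"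
      proof (subst sum.swap, intro sum.cong refl)
        fix i j assume "i \<in> {..<n}" "j \<in> {..<n}"
        then have "cnj (x j) * H j i * g i = cnj (cnj (g i) * H i j * x j)"
          using herm[of i j] by simp
        then show "Re (cnj (x j) * H j i * g i) = Re (cnj (g i) * H i j * x j)"
          by (metis cnj.simps(1))
      qed
      have 2: "q ?z = q x + t * (\<Sum>i<n. \<Sum>j<n. Re (cnj (x i) * H i j * g j))
          + t * (\<Sum>i<n. \<Sum>j<n. Re (cnj (g i) * H i j * x j)) + t\<^sup>2 * q g"
        unfolding q_def sum_distrib_left sum.distrib[symmetric]
        by (intro sum.cong refl) (simp add: algebra_simps power2_eq_square)
      have 3: "(\<Sum>i<n. Re (cnj (g i) * (\<Sum>j<n. H i j * x j))) = (\<Sum>i<n. \<Sum>j<n. Re (cnj (g i) * H i j * x j))"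
        by (simp only: sum_distrib_left Re_sum mult.assoc)
      show ?thesis
        unfolding 2 3 1 mult_2 distrib_left by (simp only: add.assoc)
    qed
    have nz: "nq ?z = nq x + t * (2 * (\<Sum>i<n. Re (cnj (g i) * x i))) + t\<^sup>2 * nq g"
      unfolding nq_def sum_distrib_left sum.distrib[symmetric] cmod_add_mult_power2 by (rule refl)
    have gHx: "(\<Sum>i<n. Re (cnj (g i) * (\<Sum>j<n. H i j * x j))) = nq g + r * (\<Sum>i<n. Re (cnj (g i) * x i))"
      unfolding nq_def sum_distrib_left sum.distrib[symmetric]
    proof (intro sum.cong refl)
      fix i
      have "(\<Sum>j<n. H i j * x j) = g i + of_real r * x i" by (simp add: g_def)
      then have "Re (cnj (g i) * (\<Sum>j<n. H i j * x j)) = (cmod (g i))\<^sup>2 + r * Re (cnj (g i) * x i)"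
        unfolding cmod_power2 by (simp add: algebra_simps power2_eq_square)
      then show "Re (\<Sum>j<n. cnj (g i) * (H i j * x j)) = (cmod (g i))\<^sup>2 + r * Re (cnj (g i) * x i)"
        by (simp add: sum_distrib_left)
    qed
    have arith: "r + t * (2 * (a + r * b)) + t\<^sup>2 * c \<le> r * (1 + t * (2 * b) + t\<^sup>2 * a) \<Longrightarrow>
        t * (2 * a) \<le> t\<^sup>2 * (r * a - c)" for a b c
      by (simp add: algebra_simps)
    show ?thesis
      using bz unfolding qz nz gHx nx r_def[symmetric] by (rule arith)
  qed
  then have "2 * nq g = 0" by (rule linear_bounded_by_quadratic_zero)
  then have g0: "g i = 0" if "i < n" for i
    using that by (auto simp: nq_def sum_nonneg_eq_0_iff)
  show ?thesis
  proof (rule that)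
    have "(\<Sum>i<n. cnj (x i) * x i) = of_real (nq x)"
      by (simp only: nq_def of_real_sum complex_norm_square mult.commute)
    then show "(\<Sum>i<n. cnj (x i) * x i) = 1" using nx by simp
    show "(\<Sum>j<n. H i j * x j) = of_real r * x i" if "i < n" for i
      using g0[OF that] by (simp add: g_def)
  qed (use xC in auto)
qed

text \<open>One eigenvector is added at a time. The row relations, used for expanding vectors in the
  basis, follow because a left inverse of a square matrix is a right inverse.\<close>

theorem hermitian_diagonalization:
  fixes H :: "nat \<Rightarrow> nat \<Rightarrow> complex"
  assumes herm: "\<And>i j. i < n \<Longrightarrow> j < n \<Longrightarrow> H j i = cnj (H i j)"
  obtains U :: "nat \<Rightarrow> nat \<Rightarrow> complex" and d :: "nat \<Rightarrow> real"
  where "\<And>i j. i < n \<Longrightarrow> j < n \<Longrightarrow> (\<Sum>k<n. cnj (U k i) * U k j) = (if i = j then 1 else 0)"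
    and "\<And>i j. i < n \<Longrightarrow> j < n \<Longrightarrow> (\<Sum>k<n. U i k * cnj (U j k)) = (if i = j then 1 else 0)"
    and "\<And>i k. i < n \<Longrightarrow> k < n \<Longrightarrow> (\<Sum>j<n. H i j * U j k) = d k * U i k"
proof -
  have "\<exists>U (d :: nat \<Rightarrow> real).
      (\<forall>i<m. \<forall>j<m. (\<Sum>k<n. cnj (U k i) * U k j) = (if i = j then 1 else 0)) \<and>
      (\<forall>i<n. \<forall>k<m. (\<Sum>j<n. H i j * U j k) = d k * U i k)" if "m \<le> n" for m
    using that
  proof (induction m)
    case 0
    then show ?case by simp
  next
    case (Suc m)
    obtain U :: "nat \<Rightarrow> nat \<Rightarrow> complex" and d :: "nat \<Rightarrow> real"
      where Ud: "(\<forall>i<m. \<forall>j<m. (\<Sum>k<n. cnj (U k i) * U k j) = (if i = j then 1 else 0)) \<and>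
        (\<forall>i<n. \<forall>k<m. (\<Sum>j<n. H i j * U j k) = d k * U i k)"
      using Suc.IH[OF Suc_leD[OF Suc.prems]] by (elim exE) (rule that)
    then have U: "\<And>i j. i < m \<Longrightarrow> j < m \<Longrightarrow> (\<Sum>k<n. cnj (U k i) * U k j) = (if i = j then 1 else 0)"
      and eig: "\<And>i k. i < n \<Longrightarrow> k < m \<Longrightarrow> (\<Sum>j<n. H i j * U j k) = of_real (d k) * U i k"
      by auto
    have "m < n" using Suc.prems by simp
    obtain x r where x: "(\<Sum>i<n. cnj (x i) * x i) = 1"
      "\<And>k. k < m \<Longrightarrow> (\<Sum>i<n. cnj (U i k) * x i) = 0"
      "\<And>i. i < n \<Longrightarrow> (\<Sum>j<n. H i j * x j) = complex_of_real r * x i"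
      by (rule hermitian_eigenvector_step[where m = m and n = n and H = H and u = U and d = d, OF herm \<open>m < n\<close> eig])
        (assumption | rule that)+
    have x': "(\<Sum>i<n. cnj (x i) * U i k) = 0" if "k < m" for k
    proof -
      have "(\<Sum>i<n. cnj (x i) * U i k) = cnj (\<Sum>i<n. cnj (U i k) * x i)" by (simp add: mult.commute)
      then show ?thesis using x(2)[OF that] by simp
    qed
    let ?U = "\<lambda>i k. if k = m then x i else U i k" and ?d = "\<lambda>k. if k = m then r else d k"
    have "(\<Sum>k<n. cnj (?U k i) * ?U k j) = (if i = j then 1 else 0)" if "i < Suc m" "j < Suc m" for i j
      using that U[of i j] x(1) x(2)[of i] x'[of j] by (cases "i = m"; cases "j = m") simp_all
    moreover have "(\<Sum>j<n. H i j * ?U j k) = ?d k * ?U i k" if "i < n" "k < Suc m" for i k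
      using that eig[of i k] x(3)[of i] by (cases "k = m") simp_all
    ultimately show ?case
      by (intro exI[of _ ?U] exI[of _ ?d] conjI allI impI)
  qed
  from this[OF order_refl] obtain U :: "nat \<Rightarrow> nat \<Rightarrow> complex" and d :: "nat \<Rightarrow> real" where
      "(\<forall>i<n. \<forall>j<n. (\<Sum>k<n. cnj (U k i) * U k j) = (if i = j then 1 else 0)) \<and>
      (\<forall>i<n. \<forall>k<n. (\<Sum>j<n. H i j * U j k) = d k * U i k)"
    by (elim exE) (rule that)
  then have
    U: "\<And>i j. i < n \<Longrightarrow> j < n \<Longrightarrow> (\<Sum>k<n. cnj (U k i) * U k j) = (if i = j then 1 else 0)"
    and eig: "\<And>i k. i < n \<Longrightarrow> k < n \<Longrightarrow> (\<Sum>j<n. H i j * U j k) = of_real (d k) * U i k"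
    by auto
  show ?thesis
    using U row_orthonormal_if_column_orthonormal[where n = n and U = U, OF U] eig by (rule that)
qed

text \<open>A predicate on \<open>U\<close> and \<open>d\<close>, so that a diagonalization can be
  chosen for every parameter of a family of matrices; the eigenvalues are listed with repetition and
  in no particular order.\<close>

definition unitary_diagonalization ::
    "nat \<Rightarrow> (nat \<Rightarrow> nat \<Rightarrow> complex) \<Rightarrow> (nat \<Rightarrow> nat \<Rightarrow> complex) \<Rightarrow> (nat \<Rightarrow> real) \<Rightarrow> bool" where
  "unitary_diagonalization n H U d \<longleftrightarrow>
     (\<forall>i<n. \<forall>j<n. (\<Sum>k<n. cnj (U k i) * U k j) = (if i = j then 1 else 0)) \<and>
     (\<forall>i<n. \<forall>j<n. (\<Sum>k<n. U i k * cnj (U j k)) = (if i = j then 1 else 0)) \<and>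
     (\<forall>i<n. \<forall>k<n. (\<Sum>j<n. H i j * U j k) = of_real (d k) * U i k)"

lemma unitary_diagonalization_exists:
  assumes herm: "\<And>i j. i < n \<Longrightarrow> j < n \<Longrightarrow> H j i = cnj (H i j)"
  obtains U d where "unitary_diagonalization n H U d"
proof -
  obtain U :: "nat \<Rightarrow> nat \<Rightarrow> complex" and d :: "nat \<Rightarrow> real"
    where "\<And>i j. i < n \<Longrightarrow> j < n \<Longrightarrow> (\<Sum>k<n. cnj (U k i) * U k j) = (if i = j then 1 else 0)"
    and "\<And>i j. i < n \<Longrightarrow> j < n \<Longrightarrow> (\<Sum>k<n. U i k * cnj (U j k)) = (if i = j then 1 else 0)"
    and "\<And>i k. i < n \<Longrightarrow> k < n \<Longrightarrow> (\<Sum>j<n. H i j * U j k) = d k * U i k"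
    by (rule hermitian_diagonalization[where n = n and H = H, OF herm]) (assumption | rule that)+
  then have "unitary_diagonalization n H U d"
    unfolding unitary_diagonalization_def by (intro conjI allI impI)
  then show ?thesis by (rule that)
qed

section \<open>Coordinates with respect to an orthonormal eigenbasis\<close>

context
  fixes n H U d
  assumes ud: "unitary_diagonalization n H U d"
begin

lemma unitary_columns: "i < n \<Longrightarrow> j < n \<Longrightarrow> (\<Sum>k<n. cnj (U k i) * U k j) = (if i = j then 1 else 0)"
  and unitary_rows: "i < n \<Longrightarrow> j < n \<Longrightarrow> (\<Sum>k<n. U i k * cnj (U j k)) = (if i = j then 1 else 0)"
  and eigen_columns: "i < n \<Longrightarrow> k < n \<Longrightarrow> (\<Sum>j<n. H i j * U j k) = of_real (d k) * U i k"
  using ud unfolding unitary_diagonalization_def by auto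

lemma unitary_expansion:
  assumes "i < n"
  shows "(\<Sum>k<n. U i k * (\<Sum>m<n. cnj (U m k) * f m)) = f i"
proof -
  have "(\<Sum>k<n. U i k * (\<Sum>m<n. cnj (U m k) * f m)) = (\<Sum>m<n. (\<Sum>k<n. U i k * cnj (U m k)) * f m)"
    unfolding sum_distrib_left sum_distrib_right mult.assoc by (rule sum.swap)
  also have "\<dots> = (\<Sum>m<n. (if i = m then 1 else 0) * f m)"
    using assms by (intro sum.cong) (simp_all add: unitary_rows)
  also have "\<dots> = f i" using assms by (simp add: if_distrib[of "\<lambda>c. c * _"] cong: if_cong)
  finally show ?thesis .
qed

lemma unitary_inverse_expansion:
  assumes "i < n"
  shows "(\<Sum>k<n. cnj (U k i) * (\<Sum>m<n. U k m * f m)) = f i"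
proof -
  have "(\<Sum>k<n. cnj (U k i) * (\<Sum>m<n. U k m * f m)) = (\<Sum>m<n. (\<Sum>k<n. cnj (U k i) * U k m) * f m)"
    unfolding sum_distrib_left sum_distrib_right mult.assoc by (rule sum.swap)
  also have "\<dots> = (\<Sum>m<n. (if i = m then 1 else 0) * f m)"
    using assms by (intro sum.cong) (simp_all add: unitary_columns)
  also have "\<dots> = f i" using assms by (simp add: if_distrib[of "\<lambda>c. c * _"] cong: if_cong)
  finally show ?thesis .
qed

lemma unitary_parseval:
  "(\<Sum>k<n. (cmod (\<Sum>m<n. cnj (U m k) * x m))\<^sup>2) = (\<Sum>m<n. (cmod (x m))\<^sup>2)"
proof -
  let ?a = "\<lambda>k. \<Sum>m<n. cnj (U m k) * x m"
  have "of_real (\<Sum>k<n. (cmod (?a k))\<^sup>2) = (\<Sum>k<n. cnj (?a k) * ?a k)"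
    by (simp only: of_real_sum complex_norm_square mult.commute)
  also have "\<dots> = (\<Sum>k<n. \<Sum>m<n. cnj (x m) * (U m k * ?a k))"
    unfolding cnj_sum sum_distrib_right by (intro sum.cong refl) (simp only: complex_cnj_mult complex_cnj_cnj mult_ac)
  also have "\<dots> = (\<Sum>m<n. cnj (x m) * (\<Sum>k<n. U m k * ?a k))"
    unfolding sum_distrib_left[of "cnj (x _)"] by (rule sum.swap)
  also have "\<dots> = (\<Sum>m<n. cnj (x m) * x m)"
    by (intro sum.cong refl) (simp only: unitary_expansion lessThan_iff)
  also have "\<dots> = of_real (\<Sum>m<n. (cmod (x m))\<^sup>2)"
    by (simp only: of_real_sum complex_norm_square mult.commute)
  finally show ?thesis unfolding of_real_eq_iff .
qed

lemma diagonalization_action: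
  assumes "i < n"
  shows "(\<Sum>j<n. H i j * x j) = (\<Sum>k<n. of_real (d k) * U i k * (\<Sum>m<n. cnj (U m k) * x m))"
proof -
  let ?a = "\<lambda>k. \<Sum>m<n. cnj (U m k) * x m"
  have "(\<Sum>j<n. H i j * x j) = (\<Sum>j<n. H i j * (\<Sum>k<n. U j k * ?a k))"
    by (intro sum.cong refl) (simp only: unitary_expansion lessThan_iff)
  also have "\<dots> = (\<Sum>k<n. (\<Sum>j<n. H i j * U j k) * ?a k)"
    unfolding sum_distrib_left[of "H _ _"] sum_distrib_right[of "\<lambda>j. H _ j * U j _"] mult.assoc by (rule sum.swap)
  also have "\<dots> = (\<Sum>k<n. of_real (d k) * U i k * ?a k)"
    using assms by (intro sum.cong refl) (simp only: eigen_columns lessThan_iff)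
  finally show ?thesis .
qed

lemma diagonalization_form:
  "(\<Sum>i<n. cnj (x i) * (\<Sum>j<n. H i j * x j))
     = of_real (\<Sum>k<n. d k * (cmod (\<Sum>m<n. cnj (U m k) * x m))\<^sup>2)"
proof -
  let ?a = "\<lambda>k. \<Sum>m<n. cnj (U m k) * x m"
  have "(\<Sum>i<n. cnj (x i) * (\<Sum>j<n. H i j * x j)) =
      (\<Sum>i<n. cnj (x i) * (\<Sum>k<n. of_real (d k) * U i k * ?a k))"
    by (intro sum.cong refl) (simp only: diagonalization_action lessThan_iff)
  also have "\<dots> = (\<Sum>k<n. of_real (d k) * ?a k * (\<Sum>i<n. cnj (x i) * U i k))"
    unfolding sum_distrib_left[of "cnj (x _)"] sum_distrib_left[of "_ * ?a _"]
    by (subst sum.swap) (simp only: mult_ac)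
  also have "\<dots> = (\<Sum>k<n. of_real (d k) * (?a k * cnj (?a k)))"
    by (intro sum.cong refl) (simp only: cnj_sum complex_cnj_mult complex_cnj_cnj mult_ac)
  also have "\<dots> = of_real (\<Sum>k<n. d k * (cmod (?a k))\<^sup>2)"
    by (simp only: of_real_sum of_real_mult complex_norm_square)
  finally show ?thesis .
qed

end

section \<open>Characteristic polynomial and eigenvalue counts read off a diagonalization\<close>

lemma order_prod_linear_factors:
  fixes d :: "nat \<Rightarrow> 'a :: idom"
  shows "(\<Prod>i<n. [:- d i, 1:]) \<noteq> 0 \<and>
    Polynomial.order k (\<Prod>i<n. [:- d i, 1:]) = card {i. i < n \<and> d i = k}"
proof (induction n)
  case 0
  then show ?case by (simp add: order_0I)
next
  case (Suc n)
  have 1: "Polynomial.order k [:- d n, 1:] = (if d n = k then 1 else 0)"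
    using order_power_n_n[of k 1] by (auto simp: order_0I)
  have "{i. i < Suc n \<and> d i = k} = {i. i < n \<and> d i = k} \<union> (if d n = k then {n} else {})"
    by (auto simp: less_Suc_eq)
  then have "card {i. i < Suc n \<and> d i = k} = card {i. i < n \<and> d i = k} + (if d n = k then 1 else 0)"
    by (cases "d n = k") simp_all
  moreover have "(\<Prod>i<n. [:- d i, 1:]) * [:- d n, 1:] \<noteq> 0"
    using Suc.IH by (simp del: mult_pCons_right)
  ultimately show ?case
    using Suc.IH by (simp add: order_mult 1 del: mult_pCons_right)
qed

text \<open>The eigenvectors may be complex although \<open>P\<close> is real. Similarity is
  therefore used over the complex numbers, and the resulting identity, whose two sides have real
  coefficients, is pulled back by comparing coefficients.\<close>

lemma char_poly_unitary_diagonalization: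
  assumes P: "P \<in> carrier_mat n n"
    and ud: "unitary_diagonalization n (\<lambda>i j. of_real (P $$ (i, j))) U d"
  shows "char_poly P = (\<Prod>i<n. [:- d i, 1:])"
proof -
  let ?P = "map_mat complex_of_real P"
  define M where "M = mat n n (\<lambda>(i, j). U i j)"
  define N where "N = mat n n (\<lambda>(i, j). cnj (U j i))"
  define D where "D = mat n n (\<lambda>(i, j). if i = j then complex_of_real (d i) else 0)"
  have carr: "?P \<in> carrier_mat n n" "M \<in> carrier_mat n n" "N \<in> carrier_mat n n" "D \<in> carrier_mat n n"
    using P by (auto simp: M_def N_def D_def)
  have NM: "N * M = 1\<^sub>m n"
    using unitary_columns[OF ud] by (intro eq_matI) (auto simp: M_def N_def scalar_prod_def atLeast0LessThan)
  have MN: "M * N = 1\<^sub>m n"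
    using unitary_rows[OF ud] by (intro eq_matI) (auto simp: M_def N_def scalar_prod_def atLeast0LessThan)
  have "?P * M = M * D"
  proof (rule eq_matI)
    fix i j assume "i < dim_row (M * D)" "j < dim_col (M * D)"
    then have ij: "i < n" "j < n" by (auto simp: M_def D_def)
    have "(M * D) $$ (i, j) = (\<Sum>k<n. U i k * (if k = j then complex_of_real (d k) else 0))"
      using ij by (simp add: M_def D_def scalar_prod_def atLeast0LessThan)
    also have "\<dots> = of_real (d j) * U i j"
      using ij by (simp add: if_distrib[of "\<lambda>c. _ * c"] mult.commute cong: if_cong)
    also have "\<dots> = (?P * M) $$ (i, j)"
      using ij P eigen_columns[OF ud ij]
      by (simp add: M_def scalar_prod_def atLeast0LessThan)
    finally show "(?P * M) $$ (i, j) = (M * D) $$ (i, j)" ..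
  qed (use P in \<open>auto simp: M_def D_def\<close>)
  then have "M * D * N = ?P * M * N" by simp
  also have "\<dots> = ?P * (M * N)" using carr by (simp add: assoc_mult_mat[of _ n n _ n _ n])
  also have "\<dots> = ?P" using carr MN by simp
  finally have "similar_mat_wit ?P D M N"
    using carr MN NM P by (auto simp: similar_mat_wit_def Let_def)
  then have "char_poly ?P = char_poly D"
    by (intro char_poly_similar) (auto simp: similar_mat_def)
  also have "\<dots> = (\<Prod>a\<leftarrow>diag_mat D. [:- a, 1:])"
    using carr(4) by (rule char_poly_upper_triangular) (auto simp: D_def upper_triangular_def)
  also have "\<dots> = (\<Prod>i<n. [:- complex_of_real (d i), 1:])"
  proof -
    have "map (\<lambda>a. [:- a, 1:]) (diag_mat D) = map (\<lambda>i. [:- complex_of_real (d i), 1:]) [0..<n]"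
      by (simp add: diag_mat_def D_def)
    then show ?thesis
      using prod.distinct_set_conv_list[of "[0..<n]" "\<lambda>i. [:- complex_of_real (d i), 1:]"]
      by (simp add: atLeast0LessThan)
  qed
  also have "\<dots> = map_poly complex_of_real (\<Prod>i<n. [:- d i, 1:])"
  proof (induction n)
    case (Suc n)
    interpret map_poly_comm_ring_hom complex_of_real ..
    show ?case using Suc by (simp add: hom_distribs del: mult_pCons_right)
  qed simp
  finally have "map_poly complex_of_real (char_poly P) = map_poly complex_of_real (\<Prod>i<n. [:- d i, 1:])"
    by (simp add: of_real_hom.char_poly_hom[OF P])
  then show ?thesis
    by (simp add: poly_eq_iff coeff_map_poly)
qed

text \<open>The multiplicity of a root \<open>k\<close> is the size of the fibre of \<open>d\<close>
  over \<open>k\<close>, and fibres are disjoint. This turns \<open>inertia\<close> into sign counts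
  of \<open>d\<close>.\<close>

lemma eigenvalue_count_unitary_diagonalization:
  assumes P: "P \<in> carrier_mat n n"
    and ud: "unitary_diagonalization n (\<lambda>i j. of_real (P $$ (i, j))) U d"
  shows "eigenvalue_count P S = card {i. i < n \<and> d i \<in> S}"
proof -
  note cp = char_poly_unitary_diagonalization[OF P ud]
  have ord: "Polynomial.order k (char_poly P) = card {i. i < n \<and> d i = k}" for k
    unfolding cp using order_prod_linear_factors by blast
  have ev: "eigenvalue P k \<longleftrightarrow> (\<exists>i<n. d i = k)" for k
    unfolding eigenvalue_root_char_poly[OF P] cp by (auto simp: poly_prod)
  have "{k. eigenvalue P k \<and> k \<in> S} = d ` {i. i < n \<and> d i \<in> S}"
    by (auto simp: ev)
  then have "eigenvalue_count P S = (\<Sum>k\<in>d ` {i. i < n \<and> d i \<in> S}. card {i. i < n \<and> d i = k})"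
    by (simp add: eigenvalue_count_def ord)
  also have "\<dots> = card (\<Union>k\<in>d ` {i. i < n \<and> d i \<in> S}. {i. i < n \<and> d i = k})"
    by (rule card_UN_disjoint[symmetric]) auto
  also have "(\<Union>k\<in>d ` {i. i < n \<and> d i \<in> S}. {i. i < n \<and> d i = k}) = {i. i < n \<and> d i \<in> S}"
    by auto
  finally show ?thesis .
qed

lemma orthogonality_conditions_have_solution:
  fixes u v :: "nat \<Rightarrow> nat \<Rightarrow> complex"
  assumes "finite I" "finite J" "card I + card J < n"
  obtains x where "\<exists>i<n. x i \<noteq> 0"
    and "\<And>k. k \<in> I \<Longrightarrow> (\<Sum>m<n. cnj (u m k) * x m) = 0"
    and "\<And>k. k \<in> J \<Longrightarrow> (\<Sum>m<n. cnj (v m k) * x m) = 0"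
proof -
  obtain f where f: "bij_betw f {0..<card I} I"
    using ex_bij_betw_nat_finite[OF assms(1)] by blast
  obtain g where g: "bij_betw g {0..<card J} J"
    using ex_bij_betw_nat_finite[OF assms(2)] by blast
  define M where "M l m = (if l < card I then cnj (u m (f l)) else cnj (v m (g (l - card I))))" for l m
  obtain x where x: "\<exists>i<n. x i \<noteq> 0" "\<forall>l<card I + card J. (\<Sum>m<n. M l m * x m) = 0"
    using underdetermined_system_has_solution[OF assms(3), of M] by blast
  show ?thesis
  proof (rule that[OF x(1)])
    fix k assume "k \<in> I"
    then obtain l where "l < card I" "f l = k"
      using bij_betw_imp_surj_on[OF f] by force
    then show "(\<Sum>m<n. cnj (u m k) * x m) = 0"
      using x(2)[rule_format, of l] by (simp add: M_def)
  next
    fix k assume "k \<in> J"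
    then obtain l where "l < card J" "g l = k"
      using bij_betw_imp_surj_on[OF g] by force
    then show "(\<Sum>m<n. cnj (v m k) * x m) = 0"
      using x(2)[rule_format, of "card I + l"] by (simp add: M_def)
  qed
qed

section \<open>Inertia along segments of nonsingular matrices\<close>

text \<open>A Courant-Fischer argument by contradiction. If \<open>H'\<close> had fewer positive
  eigenvalues, a dimension count would give a nonzero \<open>x\<close> in the positive eigenspace of
  \<open>H\<close> and orthogonal to that of \<open>H'\<close>. There the first form exceeds
  \<open>e\<close> times the squared norm and the second is nonpositive, which \<open>close\<close>
  forbids.\<close>

lemma positive_eigenvalue_count_le:
  assumes ud: "unitary_diagonalization n H U d" "unitary_diagonalization n H' U' d'"
    and gap: "\<And>k. k < n \<Longrightarrow> 0 < d k \<Longrightarrow> e < d k"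
    and close: "\<And>x. Re (\<Sum>i<n. cnj (x i) * (\<Sum>j<n. H i j * x j))
      \<le> Re (\<Sum>i<n. cnj (x i) * (\<Sum>j<n. H' i j * x j)) + e * (\<Sum>i<n. (cmod (x i))\<^sup>2)"
  shows "card {k. k < n \<and> 0 < d k} \<le> card {k. k < n \<and> 0 < d' k}"
proof (rule ccontr)
  assume less: "\<not> ?thesis"
  let ?I = "{k. k < n \<and> \<not> 0 < d k}" and ?J = "{k. k < n \<and> 0 < d' k}"
  have "card ?I + card {k. k < n \<and> 0 < d k} = card (?I \<union> {k. k < n \<and> 0 < d k})"
    by (rule card_Un_disjoint[symmetric]) auto
  also have "?I \<union> {k. k < n \<and> 0 < d k} = {..<n}" by auto
  finally have "card ?I + card ?J < n" using less by simp
  then obtain x where x: "\<exists>i<n. x i \<noteq> 0"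
    and xI: "\<And>k. k \<in> ?I \<Longrightarrow> (\<Sum>m<n. cnj (U m k) * x m) = 0"
    and xJ: "\<And>k. k \<in> ?J \<Longrightarrow> (\<Sum>m<n. cnj (U' m k) * x m) = 0"
    by (rule orthogonality_conditions_have_solution[rotated 2, of ?I ?J n U U']) auto
  let ?a = "\<lambda>k. (cmod (\<Sum>m<n. cnj (U m k) * x m))\<^sup>2"
    and ?a' = "\<lambda>k. (cmod (\<Sum>m<n. cnj (U' m k) * x m))\<^sup>2"
  have "0 < (\<Sum>i<n. (cmod (x i))\<^sup>2)"
    using x by (auto intro!: sum_pos2)
  then have "0 < (\<Sum>k<n. ?a k)" unfolding unitary_parseval[OF ud(1)] .
  then obtain k where k: "k < n" "?a k \<noteq> 0"
    by (metis (no_types, lifting) lessThan_iff less_irrefl sum.neutral)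
  have nonneg: "0 \<le> (d k - e) * ?a k" if "k < n" for k
    using that xI[of k] gap[of k] by (cases "0 < d k") auto
  have "0 < (d k - e) * ?a k"
    using k xI[of k] gap[of k] by (cases "0 < d k") auto
  then have "0 < (\<Sum>k<n. (d k - e) * ?a k)"
    using nonneg k(1) by (intro sum_pos2[of _ k]) auto
  then have "e * (\<Sum>k<n. ?a k) < (\<Sum>k<n. d k * ?a k)"
    by (simp add: left_diff_distrib sum_subtractf sum_distrib_left)
  moreover have "(\<Sum>k<n. d' k * ?a' k) \<le> 0"
  proof (rule sum_nonpos)
    fix k assume "k \<in> {..<n}"
    then show "d' k * ?a' k \<le> 0"
      using xJ[of k] by (cases "0 < d' k") (auto simp: mult_nonpos_nonneg)
  qed
  moreover have "(\<Sum>k<n. d k * ?a k) \<le> (\<Sum>k<n. d' k * ?a' k) + e * (\<Sum>k<n. ?a k)"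
    using close[of x]
    unfolding diagonalization_form[OF ud(1)] diagonalization_form[OF ud(2)] unitary_parseval[OF ud(1)]
      Re_complex_of_real .
  ultimately show False by linarith
qed

lemma unitary_diagonalization_minus:
  assumes "unitary_diagonalization n H U d"
  shows "unitary_diagonalization n (\<lambda>i j. - H i j) U (\<lambda>k. - d k)"
  using assms unfolding unitary_diagonalization_def by (simp add: sum_negf)

text \<open>A crude substitute for the operator norm; it only has to make the form Lipschitz along a
  segment of matrices.\<close>

lemma form_bound:
  fixes D :: "nat \<Rightarrow> nat \<Rightarrow> real" and x :: "nat \<Rightarrow> complex"
  shows "\<bar>Re (\<Sum>i<n. cnj (x i) * (\<Sum>j<n. of_real (D i j) * x j))\<bar>
    \<le> (\<Sum>i<n. \<Sum>j<n. \<bar>D i j\<bar>) * (\<Sum>i<n. (cmod (x i))\<^sup>2)"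
proof -
  have le: "cmod (x i) * cmod (x j) \<le> (\<Sum>i<n. (cmod (x i))\<^sup>2)" if "i < n" "j < n" for i j
  proof -
    have "(cmod (x l))\<^sup>2 \<le> (\<Sum>i<n. (cmod (x i))\<^sup>2)" if "l < n" for l
      using that by (intro member_le_sum) auto
    from this[OF that(1)] this[OF that(2)] show ?thesis
      using sum_squares_bound[of "cmod (x i)" "cmod (x j)"] by linarith
  qed
  have "\<bar>Re (\<Sum>i<n. cnj (x i) * (\<Sum>j<n. of_real (D i j) * x j))\<bar>
      \<le> cmod (\<Sum>i<n. \<Sum>j<n. cnj (x i) * (of_real (D i j) * x j))"
    unfolding sum_distrib_left by (rule abs_Re_le_cmod)
  also have "\<dots> \<le> (\<Sum>i<n. \<Sum>j<n. cmod (cnj (x i) * (of_real (D i j) * x j)))"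
    by (intro order_trans[OF norm_sum] sum_mono norm_sum)
  also have "\<dots> = (\<Sum>i<n. \<Sum>j<n. \<bar>D i j\<bar> * (cmod (x i) * cmod (x j)))"
    by (intro sum.cong refl) (simp add: norm_mult)
  also have "\<dots> \<le> (\<Sum>i<n. \<Sum>j<n. \<bar>D i j\<bar> * (\<Sum>i<n. (cmod (x i))\<^sup>2))"
    by (intro sum_mono mult_left_mono le) auto
  finally show ?thesis by (simp only: sum_distrib_right)
qed

lemma symmetric_entry:
  assumes "transpose_mat P = P" "P \<in> carrier_mat n n" "i < n" "j < n"
  shows "P $$ (j, i) = P $$ (i, j)"
proof -
  have "transpose_mat P $$ (i, j) = P $$ (j, i)" using assms(2-4) by simp
  then show ?thesis unfolding assms(1) by simp
qed

text \<open>The inertia is locally constant, hence constant on the connected interval. For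
  \<open>s\<close> near \<open>t\<close> the form moves by less than every
  \<open>\<bar>d t k\<bar>\<close>, so neither the positive nor the negative count can drop; as both
  together always make \<open>n\<close>, neither can rise.\<close>

lemma inertia_segment:
  assumes carr: "P \<in> carrier_mat n n" "Q \<in> carrier_mat n n"
    and symm: "transpose_mat P = P" "transpose_mat Q = Q"
    and nonsing: "\<And>t. t \<in> {0..1} \<Longrightarrow> \<not> eigenvalue ((1 - t) \<cdot>\<^sub>m P + t \<cdot>\<^sub>m Q) 0"
  shows "inertia P = inertia Q"
proof -
  define R where "R t = (1 - t) \<cdot>\<^sub>m P + t \<cdot>\<^sub>m Q" for t :: real
  define H where "H t i j = complex_of_real (R t $$ (i, j))" for t i j
  have R: "R t \<in> carrier_mat n n" for t using carr by (simp add: R_def)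
  have sym: "P $$ (j, i) = P $$ (i, j)" "Q $$ (j, i) = Q $$ (i, j)" if "i < n" "j < n" for i j
    using symmetric_entry carr symm that by auto
  have "H t j i = cnj (H t i j)" if "i < n" "j < n" for t i j
    using that carr sym[OF that] by (simp add: H_def R_def)
  then have "\<exists>U d. unitary_diagonalization n (H t) U d" for t
    by (rule unitary_diagonalization_exists) (assumption | intro exI)+
  \<comment> \<open>Chosen independently for each \<open>t\<close>: only the forms, not the
    eigenvectors, are compared between parameters.\<close>
  then obtain U d where ud: "\<And>t. unitary_diagonalization n (H t) (U t) (d t)" by metis
  note cnt = eigenvalue_count_unitary_diagonalization[OF R ud[unfolded H_def[abs_def]]]
  have in_eq: "inertia (R t) = (card {k. k < n \<and> d t k < 0}, card {k. k < n \<and> d t k = 0}, card {k. k < n \<and> 0 < d t k})" for t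
    by (simp add: inertia_def cnt)
  have nz: "d t k \<noteq> 0" if "t \<in> {0..1}" "k < n" for t k
  proof
    assume "d t k = 0"
    then have "poly (char_poly (R t)) 0 = 0"
      using that(2) unfolding char_poly_unitary_diagonalization[OF R ud[unfolded H_def[abs_def]]]
      by (auto simp: poly_prod)
    then show False
      using nonsing[OF that(1)] eigenvalue_root_char_poly[OF R] by (simp add: R_def)
  qed
  have total: "card {k. k < n \<and> d t k < 0} + card {k. k < n \<and> 0 < d t k} = n" if "t \<in> {0..1}" for t
  proof -
    have "card {k. k < n \<and> d t k < 0} + card {k. k < n \<and> 0 < d t k}
        = card ({k. k < n \<and> d t k < 0} \<union> {k. k < n \<and> 0 < d t k})"
      by (rule card_Un_disjoint[symmetric]) auto
    also have "{k. k < n \<and> d t k < 0} \<union> {k. k < n \<and> 0 < d t k} = {..<n}"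
      using nz[OF that] by (auto simp: neq_iff)
    finally show ?thesis by simp
  qed
  define M where "M = (\<Sum>i<n. \<Sum>j<n. \<bar>Q $$ (i, j) - P $$ (i, j)\<bar>)"
  have close: "\<bar>Re (\<Sum>i<n. cnj (x i) * (\<Sum>j<n. H s i j * x j)) - Re (\<Sum>i<n. cnj (x i) * (\<Sum>j<n. H t i j * x j))\<bar>
      \<le> \<bar>s - t\<bar> * M * (\<Sum>i<n. (cmod (x i))\<^sup>2)" for x s t
  proof -
    have "(\<Sum>i<n. cnj (x i) * (\<Sum>j<n. H s i j * x j)) - (\<Sum>i<n. cnj (x i) * (\<Sum>j<n. H t i j * x j))
        = of_real (s - t) * (\<Sum>i<n. cnj (x i) * (\<Sum>j<n. of_real (Q $$ (i, j) - P $$ (i, j)) * x j))"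
      unfolding sum_subtractf[symmetric] right_diff_distrib[symmetric] sum_distrib_left
    proof (intro sum.cong refl)
      fix i j assume "i \<in> {..<n}" "j \<in> {..<n}"
      then have "H s i j - H t i j = of_real (s - t) * of_real (Q $$ (i, j) - P $$ (i, j))"
        using carr by (simp add: H_def R_def algebra_simps)
      then show "cnj (x i) * (H s i j * x j - H t i j * x j) =
          of_real (s - t) * (cnj (x i) * (of_real (Q $$ (i, j) - P $$ (i, j)) * x j))"
        unfolding left_diff_distrib[symmetric] by (simp only: mult_ac)
    qed
    from arg_cong[where f = "\<lambda>z. \<bar>Re z\<bar>", OF this] show ?thesis
      using mult_left_mono[OF form_bound[where n = n and x = x and D = "\<lambda>i j. Q $$ (i, j) - P $$ (i, j)"]
        abs_ge_zero[of "s - t"]]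
      unfolding M_def minus_complex.sel(1) Re_of_real_mult abs_mult mult.assoc by linarith
  qed
  have local: "\<forall>\<^sub>F s in at t within {0..1}. inertia (R t) = inertia (R s)" if t: "t \<in> {0..1}" for t
  proof -
    have "\<forall>\<^sub>F s in at t within {0..1}. \<bar>s - t\<bar> * M < \<bar>d t k\<bar>" if "k < n" for k
    proof -
      have "((\<lambda>s. \<bar>s - t\<bar> * M) \<longlongrightarrow> \<bar>t - t\<bar> * M) (at t within {0..1})"
        by (intro tendsto_intros)
      then show ?thesis
        by (rule order_tendstoD(2)) (use nz[OF t that] in simp)
    qed
    then have "\<forall>\<^sub>F s in at t within {0..1}. \<forall>k\<in>{..<n}. \<bar>s - t\<bar> * M < \<bar>d t k\<bar>"
      by (intro eventually_ball_finite) auto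
    moreover have "\<forall>\<^sub>F s in at t within {0..1}. s \<in> {0..1}"
      by (simp add: eventually_at_filter)
    ultimately show ?thesis
    proof eventually_elim
      case (elim s)
      have gap: "\<bar>s - t\<bar> * M < \<bar>d t k\<bar>" if "k < n" for k
        using elim(1) that by simp
      have pos: "card {k. k < n \<and> 0 < d t k} \<le> card {k. k < n \<and> 0 < d s k}"
      proof (rule positive_eigenvalue_count_le[OF ud ud])
        show "\<bar>s - t\<bar> * M < d t k" if "k < n" "0 < d t k" for k
          using gap[OF that(1)] that(2) by simp
        show "Re (\<Sum>i<n. cnj (x i) * (\<Sum>j<n. H t i j * x j))
          \<le> Re (\<Sum>i<n. cnj (x i) * (\<Sum>j<n. H s i j * x j)) + \<bar>s - t\<bar> * M * (\<Sum>i<n. (cmod (x i))\<^sup>2)" for x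
          using close[of x s t] by linarith
      qed
      \<comment> \<open>Negative eigenvalues are counted as the positive ones of the negated
        form.\<close>
      have "card {k. k < n \<and> 0 < - d t k} \<le> card {k. k < n \<and> 0 < - d s k}"
      proof (rule positive_eigenvalue_count_le[OF ud[THEN unitary_diagonalization_minus] ud[THEN unitary_diagonalization_minus]])
        show "\<bar>s - t\<bar> * M < - d t k" if "k < n" "0 < - d t k" for k
          using gap[OF that(1)] that(2) by simp
        show "Re (\<Sum>i<n. cnj (x i) * (\<Sum>j<n. - H t i j * x j))
          \<le> Re (\<Sum>i<n. cnj (x i) * (\<Sum>j<n. - H s i j * x j)) + \<bar>s - t\<bar> * M * (\<Sum>i<n. (cmod (x i))\<^sup>2)" for x
          using close[of x s t] by (simp only: mult_minus_left mult_minus_right sum_negf uminus_complex.sel(1))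
      qed
      then have neg: "card {k. k < n \<and> d t k < 0} \<le> card {k. k < n \<and> d s k < 0}" by simp
      have z: "card {k. k < n \<and> d t k = 0} = card {k. k < n \<and> d s k = 0}"
        using nz[OF t] nz[OF elim(2)] by (metis (mono_tags, lifting) Collect_cong)
      show ?case
        unfolding in_eq using pos neg z total[OF t] total[OF elim(2)] by simp
    qed
  qed
  have "inertia (R 0) = inertia (R 1)"
    by (rule connected_local_const[of "{0..1::real}" 0 1 "\<lambda>t. inertia (R t)"]) (use local in auto)
  moreover have "R 0 = P" "R 1 = Q"
    using carr by (auto simp: R_def)
  ultimately show ?thesis by simp
qed

section \<open>Strict bounded real lemma\<close>

text \<open>
  The matrix \<open>W\<close> has the blocks \<open>diag d\<close>, \<open>h\<close> and \<open>\<eta>\<close>, and \<open>eta\<close> says that its Schur complement is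
  nonnegative (with \<open>0 / 0 = 0\<close> on the kernel of \<open>diag d\<close>, where \<open>h0\<close> applies). The columns of a unitary
  matrix diagonalizing \<open>D\<^sup>-\<^sup>1\<^sup>/\<^sup>2 Z D\<^sup>-\<^sup>1\<^sup>/\<^sup>2\<close> for the skew-Hermitian \<open>Z = A D + b h\<^sup>*\<close> turn into responses
  \<open>\<xi> l\<close> to the inputs \<open>w l\<close> at frequencies \<open>- e l\<close>.
\<close>

lemma kyp_dual_diagonal:
  fixes A :: "nat \<Rightarrow> nat \<Rightarrow> complex" and b c h :: "nat \<Rightarrow> complex" and d :: "nat \<Rightarrow> real"
  assumes d: "\<And>i. i < n \<Longrightarrow> 0 \<le> d i"
    and skew: "\<And>i j. i < n \<Longrightarrow> j < n \<Longrightarrow>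
      A i j * of_real (d j) + b i * cnj (h j) + cnj (A j i * of_real (d i) + b j * cnj (h i)) = 0"
    and h0: "\<And>i. i < n \<Longrightarrow> d i = 0 \<Longrightarrow> h i = 0"
    and eta: "(\<Sum>j<n. (cmod (h j))\<^sup>2 / d j) \<le> \<eta>"
    and theta: "\<eta> \<le> \<mu>\<^sup>2 * (\<Sum>j<n. d j * (cmod (c j))\<^sup>2)"
    and freq: "\<And>(\<omega>::real) x w. (\<And>i. i < n \<Longrightarrow> (\<Sum>j<n. A i j * x j) + b i * w = \<i> * of_real \<omega> * x i)
      \<Longrightarrow> cmod (\<Sum>j<n. c j * x j) \<le> \<gamma> * cmod w"
    and hyp: "\<And>(\<omega>::real) x i. (\<And>i. i < n \<Longrightarrow> (\<Sum>j<n. A i j * x j) = \<i> * of_real \<omega> * x i) \<Longrightarrow> i < n \<Longrightarrow> x i = 0"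
    and "0 \<le> \<mu>" "0 \<le> \<gamma>" "\<mu> * \<gamma> < 1"
  shows "(\<forall>i<n. d i = 0) \<and> \<eta> \<le> 0"
proof -
  define Z where "Z i j = A i j * of_real (d j) + b i * cnj (h j)" for i j
  define s where "s i = complex_of_real (sqrt (d i))" for i
  \<comment> \<open>Since \<open>x / 0 = 0\<close>, the rows and columns of \<open>S\<close> on the
    kernel of the diagonal block are zero. \<open>Zs\<close> still holds there: \<open>h0\<close>
    kills the columns of \<open>Z\<close> on the kernel, and skewness then kills the rows.\<close>
  define S where "S i j = Z i j / (s i * s j)" for i j
  have Zskew: "Z i j = - cnj (Z j i)" if "i < n" "j < n" for i j
    using skew[OF that] unfolding Z_def by (rule eq_neg_iff_add_eq_0[THEN iffD2])
  have s0: "d i = 0" if "i < n" "s i = 0" for i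
    using that by (simp add: s_def)
  have s2: "s i * s i = of_real (d i)" if "i < n" for i
    using d[OF that] unfolding s_def of_real_mult[symmetric] by simp
  have cs: "cnj (s i) = s i" for i by (simp add: s_def)
  \<comment> \<open>\<open>S\<close> is skew-Hermitian, so \<open>\<i> * S\<close> is Hermitian. The
    eigenvalues of \<open>S\<close> are therefore imaginary, which is what makes the responses below
    sinusoidal.\<close>
  have "\<i> * S j i = cnj (\<i> * S i j)" if "i < n" "j < n" for i j
    using Zskew[OF that(2,1)] by (simp add: S_def cs mult.commute)
  then obtain V e where ud: "unitary_diagonalization n (\<lambda>i j. \<i> * S i j) V e"
    by (rule unitary_diagonalization_exists)
  have SV: "(\<Sum>k<n. S i k * V k l) = \<i> * of_real (- e l) * V i l" if "i < n" "l < n" for i l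
  proof -
    have "\<i> * (\<Sum>k<n. S i k * V k l) = of_real (e l) * V i l"
      using eigen_columns[OF ud that] by (simp only: sum_distrib_left mult.assoc)
    then have "\<i> * (\<i> * (\<Sum>k<n. S i k * V k l)) = \<i> * (of_real (e l) * V i l)" by (simp only:)
    then show ?thesis by (simp add: mult.assoc[symmetric] equation_minus_iff)
  qed
  \<comment> \<open>The pairs \<open>(\<xi> l, w l)\<close> are the rank-one terms of the dual
    matrix: their outer products sum to the blocks \<open>diag d\<close> and \<open>h\<close>, and
    in the input corner they leave the nonnegative rest \<open>\<eta> - N\<close>, with
    \<open>N\<close> as defined below.\<close>
  define \<xi> where "\<xi> l i = s i * V i l" for l i
  define w where "w l = (\<Sum>k<n. cnj (h k) / s k * V k l)" for l
  have Zs: "Z i k / s k = s i * S i k" if "i < n" "k < n" for i k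
  proof (cases "s i = 0")
    case True
    then have "Z k i = 0"
      using that s0 h0 by (simp add: Z_def)
    then have "Z i k = 0" using Zskew[OF that] by simp
    then show ?thesis by (simp add: S_def)
  qed (simp add: S_def)
  have As: "A i k * s k + b i * (cnj (h k) / s k) = Z i k / s k" if "k < n" for i k
  proof (cases "s k = 0")
    case False
    then show ?thesis
      unfolding Z_def s2[OF that, symmetric] by (simp add: add_divide_distrib)
  qed (use s0[OF that] h0[OF that] in simp)
  have eq: "(\<Sum>j<n. A i j * \<xi> l j) + b i * w l = \<i> * of_real (- e l) * \<xi> l i" if "i < n" "l < n" for i l
  proof -
    have "(\<Sum>j<n. A i j * \<xi> l j) + b i * w l = (\<Sum>k<n. (A i k * s k + b i * (cnj (h k) / s k)) * V k l)"
      unfolding \<xi>_def w_def sum_distrib_left[of "b i"] sum.distrib[symmetric]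
      by (simp only: distrib_right mult.assoc)
    also have "\<dots> = (\<Sum>k<n. s i * (S i k * V k l))"
      using that(1) by (intro sum.cong refl) (simp only: As Zs lessThan_iff mult.assoc)
    also have "\<dots> = s i * (\<i> * of_real (- e l) * V i l)"
      unfolding sum_distrib_left[symmetric] SV[OF that] ..
    finally show ?thesis by (simp only: \<xi>_def mult_ac)
  qed
  have parseval: "(\<Sum>l<n. (cmod (\<Sum>m<n. V m l * x m))\<^sup>2) = (\<Sum>m<n. (cmod (x m))\<^sup>2)" for x
  proof -
    have "cmod (\<Sum>m<n. V m l * x m) = cmod (\<Sum>m<n. cnj (V m l) * cnj (x m))" for l
      by (subst complex_mod_cnj[symmetric]) (simp only: cnj_sum complex_cnj_mult)
    then show ?thesis
      using unitary_parseval[OF ud, of "\<lambda>m. cnj (x m)"] by (simp only: complex_mod_cnj)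
  qed
  define N where "N = (\<Sum>j<n. (cmod (h j))\<^sup>2 / d j)"
  have sumw: "(\<Sum>l<n. (cmod (w l))\<^sup>2) = N"
  proof -
    have "(\<Sum>l<n. (cmod (w l))\<^sup>2) = (\<Sum>k<n. (cmod (cnj (h k) / s k))\<^sup>2)"
      using parseval[of "\<lambda>k. cnj (h k) / s k"] by (simp only: w_def mult.commute)
    also have "\<dots> = N"
      unfolding N_def using d by (intro sum.cong) (auto simp: norm_divide power_divide s_def)
    finally show ?thesis .
  qed
  have sumc: "(\<Sum>l<n. (cmod (\<Sum>j<n. c j * \<xi> l j))\<^sup>2) = (\<Sum>j<n. d j * (cmod (c j))\<^sup>2)"
  proof -
    have "(\<Sum>l<n. (cmod (\<Sum>j<n. c j * \<xi> l j))\<^sup>2) = (\<Sum>j<n. (cmod (c j * s j))\<^sup>2)"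
      using parseval[of "\<lambda>j. c j * s j"] by (simp only: \<xi>_def mult_ac)
    also have "\<dots> = (\<Sum>j<n. d j * (cmod (c j))\<^sup>2)"
      using d by (intro sum.cong) (auto simp: norm_mult power_mult_distrib s_def)
    finally show ?thesis .
  qed
  have "(\<Sum>l<n. (cmod (\<Sum>j<n. c j * \<xi> l j))\<^sup>2) \<le> (\<Sum>l<n. \<gamma>\<^sup>2 * (cmod (w l))\<^sup>2)"
  proof (rule sum_mono)
    fix l assume "l \<in> {..<n}"
    then have "cmod (\<Sum>j<n. c j * \<xi> l j) \<le> \<gamma> * cmod (w l)"
      using eq by (intro freq[of "\<xi> l" "w l" "- e l"]) simp
    then show "(cmod (\<Sum>j<n. c j * \<xi> l j))\<^sup>2 \<le> \<gamma>\<^sup>2 * (cmod (w l))\<^sup>2"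
      unfolding power_mult_distrib[symmetric] by (rule power_mono) simp
  qed
  then have "(\<Sum>j<n. d j * (cmod (c j))\<^sup>2) \<le> \<gamma>\<^sup>2 * N"
    unfolding sumc sum_distrib_left[symmetric] sumw .
  \<comment> \<open>Here the estimates close up: \<open>eta\<close> says
    \<open>N \<le> \<eta>\<close>, so a factor below one in front of \<open>N\<close> forces
    \<open>N = 0\<close>.\<close>
  then have "\<eta> \<le> (\<mu> * \<gamma>)\<^sup>2 * N"
    using order_trans[OF theta mult_left_mono[OF _ zero_le_power2[of \<mu>]]]
    by (simp only: power_mult_distrib mult.assoc)
  note eta_le = this
  have q: "(\<mu> * \<gamma>)\<^sup>2 < 1"
    using assms(8-10) by (simp add: power_less_one_iff)
  have N: "0 \<le> N" "N \<le> \<eta>"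
    using d eta by (auto simp: N_def intro!: sum_nonneg)
  have "\<not> 0 < N"
    using mult_strict_right_mono[OF q, of N] eta_le N(2) by linarith
  then have N0: "N = 0" using N by simp
  then have "\<eta> \<le> 0" using eta_le by simp
  \<comment> \<open>\<open>N = 0\<close> silences every input, so each \<open>\<xi> l\<close> is an
    undriven oscillation, which \<open>hyp\<close> excludes. As the rows of \<open>V\<close> have
    norm one, \<open>s i\<close> must vanish.\<close>
  have "d i = 0" if "i < n" for i
  proof -
    have "w l = 0" if "l < n" for l
      using sumw that unfolding N0 by (simp add: sum_nonneg_eq_0_iff)
    then have "\<xi> l i = 0" if "l < n" for l
      using hyp[of "\<xi> l" "- e l" i] eq that \<open>i < n\<close> by simp
    then have "(\<Sum>l<n. s i * (V i l * cnj (V i l))) = 0"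
      by (intro sum.neutral) (simp add: \<xi>_def mult.assoc[symmetric])
    then have "s i = 0"
      unfolding sum_distrib_left[symmetric] unitary_rows[OF ud that that] by simp
    then show ?thesis by (rule s0[OF that])
  qed
  then show ?thesis using \<open>\<eta> \<le> 0\<close> by blast
qed

text \<open>Real and imaginary parts contribute separately, so semidefiniteness, known for real
  vectors, extends to the complex vectors that the eigenbasis brings in.\<close>

lemma Re_hermitian_form_of_real:
  fixes W :: "nat \<Rightarrow> nat \<Rightarrow> real" and z :: "nat \<Rightarrow> complex"
  assumes sym: "\<And>i j. i < m \<Longrightarrow> j < m \<Longrightarrow> W i j = W j i"
  shows "Re (\<Sum>i<m. cnj (z i) * (\<Sum>j<m. of_real (W i j) * z j))
    = (\<Sum>i<m. \<Sum>j<m. Re (z i) * W i j * Re (z j)) + (\<Sum>i<m. \<Sum>j<m. Im (z i) * W i j * Im (z j))"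
proof -
  have "Re (cnj (z i) * (of_real (W i j) * z j)) = Re (z i) * W i j * Re (z j) + Im (z i) * W i j * Im (z j)" for i j
    by (simp add: algebra_simps)
  then show ?thesis
    unfolding sum_distrib_left Re_sum sum.distrib[symmetric] by (simp only:)
qed

text \<open>Index \<open>n\<close> of \<open>W\<close> is the input coordinate.\<close>

lemma kyp_dual:
  fixes A W :: "nat \<Rightarrow> nat \<Rightarrow> real" and b c :: "nat \<Rightarrow> real"
  assumes sym: "\<And>i j. i < Suc n \<Longrightarrow> j < Suc n \<Longrightarrow> W i j = W j i"
    and psd: "\<And>v. 0 \<le> (\<Sum>i<Suc n. \<Sum>j<Suc n. v i * W i j * v j)"
    and skew: "\<And>i j. i < n \<Longrightarrow> j < n \<Longrightarrow>
      (\<Sum>k<n. A i k * W k j) + b i * W n j + ((\<Sum>k<n. A j k * W k i) + b j * W n i) = 0"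
    and theta: "W n n \<le> \<mu>\<^sup>2 * (\<Sum>i<n. \<Sum>j<n. c i * W i j * c j)"
    and freq: "\<And>(\<omega>::real) (x :: nat \<Rightarrow> complex) w. (\<And>i. i < n \<Longrightarrow> (\<Sum>j<n. of_real (A i j) * x j) + of_real (b i) * w = \<i> * of_real \<omega> * x i)
      \<Longrightarrow> cmod (\<Sum>j<n. of_real (c j) * x j) \<le> \<gamma> * cmod w"
    and hyp: "\<And>(\<omega>::real) (x :: nat \<Rightarrow> complex) i. (\<And>i. i < n \<Longrightarrow> (\<Sum>j<n. of_real (A i j) * x j) = \<i> * of_real \<omega> * x i) \<Longrightarrow> i < n \<Longrightarrow> x i = 0"
    and "0 \<le> \<mu>" "0 \<le> \<gamma>" "\<mu> * \<gamma> < 1"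
    and "i < Suc n"
  shows "W i i = 0"
proof -
  define H where "H i j = complex_of_real (W i j)" for i j
  have "H j i = cnj (H i j)" if "i < n" "j < n" for i j
    using sym[of i j] that by (simp add: H_def)
  then obtain U d where ud: "unitary_diagonalization n H U d"
    by (rule unitary_diagonalization_exists)
  define g where "g k = (\<Sum>j<n. of_real (W n j) * U j k)" for k
  \<comment> \<open>Semidefiniteness of \<open>W\<close> in eigencoordinates \<open>y\<close> of its
    state block, with a real input \<open>s\<close>. Three choices of \<open>(y, s)\<close> exploit
    it: a unit vector for \<open>d\<close>, a kernel direction with \<open>s\<close> free for
    \<open>g0\<close>, and the minimizing \<open>y\<close> at \<open>s = 1\<close> for the Schur
    complement in \<open>eta\<close>.\<close>
  have form: "0 \<le> (\<Sum>k<n. d k * (cmod (y k))\<^sup>2) + 2 * s * Re (\<Sum>k<n. g k * y k) + W n n * s\<^sup>2"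
    for y :: "nat \<Rightarrow> complex" and s :: real
  proof -
    define x where "x i = (\<Sum>k<n. U i k * y k)" for i
    define z where "z i = (if i < n then x i else of_real s)" for i
    have hx: "(\<Sum>j<n. of_real (W n j) * x j) = (\<Sum>k<n. g k * y k)"
      unfolding x_def g_def sum_distrib_left sum_distrib_right mult.assoc by (rule sum.swap)
    have "(\<Sum>i<n. cnj (x i) * (\<Sum>j<n. H i j * x j)) = of_real (\<Sum>k<n. d k * (cmod (y k))\<^sup>2)"
      unfolding diagonalization_form[OF ud] x_def
      by (intro arg_cong[of _ _ of_real] sum.cong refl) (simp only: unitary_inverse_expansion[OF ud] lessThan_iff)
    moreover have "(\<Sum>i<n. cnj (x i) * of_real (W i n)) = cnj (\<Sum>k<n. g k * y k)"
      unfolding hx[symmetric] cnj_sum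
    proof (intro sum.cong refl)
      fix i assume "i \<in> {..<n}"
      then have "W i n = W n i" using sym[of i n] by simp
      then show "cnj (x i) * of_real (W i n) = cnj (of_real (W n i) * x i)" by (simp add: mult.commute)
    qed
    moreover have "(\<Sum>i<Suc n. cnj (z i) * (\<Sum>j<Suc n. of_real (W i j) * z j))
        = (\<Sum>i<n. cnj (x i) * (\<Sum>j<n. H i j * x j)) + (\<Sum>i<n. cnj (x i) * of_real (W i n)) * of_real s
          + of_real s * (\<Sum>j<n. of_real (W n j) * x j) + of_real (s * (W n n * s))"
    proof -
      have inner: "(\<Sum>j<Suc n. of_real (W i j) * z j) = (\<Sum>j<n. H i j * x j) + of_real (W i n) * of_real s" for i
        by (simp add: z_def H_def)
      have "(\<Sum>i<n. cnj (z i) * ((\<Sum>j<n. H i j * x j) + of_real (W i n) * of_real s))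
          = (\<Sum>i<n. cnj (x i) * (\<Sum>j<n. H i j * x j)) + (\<Sum>i<n. cnj (x i) * of_real (W i n)) * of_real s"
        unfolding sum_distrib_right[of "\<lambda>i. cnj (x i) * of_real (W i n)"] sum.distrib[symmetric]
        by (intro sum.cong refl) (simp add: z_def distrib_left mult.assoc)
      then show ?thesis
        unfolding inner sum.lessThan_Suc[of _ n] by (simp add: z_def H_def distrib_left)
    qed
    moreover have "0 \<le> Re (\<Sum>i<Suc n. cnj (z i) * (\<Sum>j<Suc n. of_real (W i j) * z j))"
      by (subst Re_hermitian_form_of_real) (assumption | rule sym psd add_nonneg_nonneg)+
    ultimately show ?thesis
      unfolding hx by (simp add: power2_eq_square mult_ac)
  qed
  have d: "0 \<le> d k" if "k < n" for k
  proof -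
    have "0 \<le> (\<Sum>l<n. d l * (cmod (if l = k then 1 else 0))\<^sup>2)"
      using form[of "\<lambda>l. if l = k then 1 else 0" 0] by simp
    also have "\<dots> = (\<Sum>l<n. if l = k then d l else 0)" by (intro sum.cong) auto
    finally show ?thesis using that by simp
  qed
  have g0: "g k = 0" if "k < n" "d k = 0" for k
  proof -
    have "s * (- 2 * (cmod (g k))\<^sup>2) \<le> s\<^sup>2 * W n n" for s
    proof -
      let ?y = "\<lambda>l. if l = k then cnj (g k) else 0"
      have "(\<Sum>l<n. d l * (cmod (?y l))\<^sup>2) = 0"
        using that(2) by (intro sum.neutral) auto
      moreover have "(\<Sum>l<n. g l * ?y l) = (\<Sum>l<n. if l = k then g k * cnj (g k) else 0)"
        by (intro sum.cong) auto
      moreover have "\<dots> = of_real ((cmod (g k))\<^sup>2)"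
        using that(1) by (simp add: complex_norm_square del: of_real_power)
      ultimately show ?thesis
        using form[of ?y s] by (simp only: Re_complex_of_real) (simp add: algebra_simps)
    qed
    then have "- 2 * (cmod (g k))\<^sup>2 = 0" by (rule linear_bounded_by_quadratic_zero)
    then show ?thesis by simp
  qed
  have eta: "(\<Sum>k<n. (cmod (cnj (g k)))\<^sup>2 / d k) \<le> W n n"
  proof -
    let ?y = "\<lambda>k. - cnj (g k) / of_real (d k)"
    have "(\<Sum>k<n. d k * (cmod (?y k))\<^sup>2) = (\<Sum>k<n. (cmod (cnj (g k)))\<^sup>2 / d k)"
      by (intro sum.cong refl) (simp add: norm_divide power_divide power2_eq_square)
    moreover have "(\<Sum>k<n. g k * ?y k) = of_real (- (\<Sum>k<n. (cmod (cnj (g k)))\<^sup>2 / d k))"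
      unfolding sum_negf[symmetric] of_real_sum
      by (intro sum.cong refl) (simp add: complex_norm_square[symmetric] del: of_real_power)
    ultimately show ?thesis
      using form[of ?y 1] by (simp only: Re_complex_of_real) simp
  qed
  define Z where "Z i j = (\<Sum>k<n. A i k * W k j) + b i * W n j" for i j
  \<comment> \<open>The system in the coordinates that diagonalize the state block of
    \<open>W\<close>; the \<open>h\<close> of the diagonal case is \<open>cnj (g j)\<close>.\<close>
  define A' where "A' i j = (\<Sum>k<n. cnj (U k i) * (\<Sum>l<n. of_real (A k l) * U l j))" for i j
  define b' where "b' i = (\<Sum>k<n. cnj (U k i) * of_real (b k))" for i
  define c' where "c' j = (\<Sum>k<n. of_real (c k) * U k j)" for j
  have Z': "A' i j * of_real (d j) + b' i * g j = (\<Sum>k<n. cnj (U k i) * (\<Sum>m<n. of_real (Z k m) * U m j))"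
    if "j < n" for i j
  proof -
    have "(\<Sum>m<n. of_real (Z k m) * U m j) = (\<Sum>l<n. of_real (A k l) * U l j) * of_real (d j) + of_real (b k) * g j" for k
    proof -
      have "(\<Sum>m<n. of_real (Z k m) * U m j) =
          (\<Sum>m<n. \<Sum>l<n. of_real (A k l) * (H l m * U m j)) + (\<Sum>m<n. of_real (b k) * (of_real (W n m) * U m j))"
        by (simp add: Z_def H_def distrib_right sum.distrib sum_distrib_right mult.assoc)
      also have "(\<Sum>m<n. \<Sum>l<n. of_real (A k l) * (H l m * U m j)) = (\<Sum>l<n. of_real (A k l) * (\<Sum>m<n. H l m * U m j))"
        unfolding sum_distrib_left by (rule sum.swap)
      also have "\<dots> = (\<Sum>l<n. of_real (A k l) * U l j) * of_real (d j)"
        unfolding sum_distrib_right using that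
        by (intro sum.cong refl) (simp only: eigen_columns[OF ud] lessThan_iff mult_ac)
      finally show ?thesis by (simp only: g_def sum_distrib_left)
    qed
    then show ?thesis
      by (simp only: A'_def b'_def sum_distrib_right distrib_left sum.distrib mult.assoc)
  qed
  have skew': "A' i j * of_real (d j) + b' i * cnj (cnj (g j)) + cnj (A' j i * of_real (d i) + b' j * cnj (cnj (g i))) = 0"
    if "i < n" "j < n" for i j
  proof -
    have "cnj (\<Sum>k<n. cnj (U k j) * (\<Sum>m<n. of_real (Z k m) * U m i)) = (\<Sum>k<n. cnj (U k i) * (\<Sum>m<n. of_real (Z m k) * U m j))"
      unfolding sum_distrib_left cnj_sum by (subst sum.swap) (simp add: mult_ac)
    moreover have "of_real (Z k m) * U m j + of_real (Z m k) * U m j = 0" if "k < n" "m < n" for k m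
      using skew[OF that] by (simp only: Z_def distrib_right[symmetric] of_real_add[symmetric]) simp
    then have "(\<Sum>k<n. cnj (U k i) * (\<Sum>m<n. of_real (Z k m) * U m j)) + (\<Sum>k<n. cnj (U k i) * (\<Sum>m<n. of_real (Z m k) * U m j)) = 0"
      unfolding sum.distrib[symmetric] distrib_left[symmetric] by (intro sum.neutral ballI) simp
    ultimately show ?thesis
      by (simp only: complex_cnj_cnj Z'[OF that(2)] Z'[OF that(1)])
  qed
  have theta': "W n n \<le> \<mu>\<^sup>2 * (\<Sum>j<n. d j * (cmod (c' j))\<^sup>2)"
  proof -
    have "cmod (c' k) = cmod (\<Sum>m<n. cnj (U m k) * of_real (c m))" for k
      by (subst complex_mod_cnj[symmetric]) (simp add: c'_def cnj_sum mult.commute)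
    then have "of_real (\<Sum>k<n. d k * (cmod (c' k))\<^sup>2) = (\<Sum>i<n. cnj (of_real (c i)) * (\<Sum>j<n. H i j * of_real (c j)))"
      unfolding diagonalization_form[OF ud] by (simp only:)
    also have "\<dots> = of_real (\<Sum>i<n. \<Sum>j<n. c i * W i j * c j)"
      by (simp add: H_def sum_distrib_left mult.assoc)
    finally have "(\<Sum>k<n. d k * (cmod (c' k))\<^sup>2) = (\<Sum>i<n. \<Sum>j<n. c i * W i j * c j)"
      unfolding of_real_eq_iff .
    then show ?thesis using theta by simp
  qed
  have rotate: "(\<Sum>j<n. A' i j * x j) + b' i * w
      = (\<Sum>k<n. cnj (U k i) * ((\<Sum>l<n. of_real (A k l) * (\<Sum>j<n. U l j * x j)) + of_real (b k) * w))" for i x w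
  proof -
    have "(\<Sum>j<n. A' i j * x j) = (\<Sum>k<n. \<Sum>j<n. cnj (U k i) * ((\<Sum>l<n. of_real (A k l) * U l j) * x j))"
      unfolding A'_def sum_distrib_right[of _ _ "x _"] mult.assoc by (rule sum.swap)
    also have "\<dots> = (\<Sum>k<n. cnj (U k i) * (\<Sum>j<n. (\<Sum>l<n. of_real (A k l) * U l j) * x j))"
      by (simp only: sum_distrib_left)
    also have "\<dots> = (\<Sum>k<n. cnj (U k i) * (\<Sum>l<n. of_real (A k l) * (\<Sum>j<n. U l j * x j)))"
    proof -
      have "(\<Sum>j<n. (\<Sum>l<n. of_real (A k l) * U l j) * x j) = (\<Sum>l<n. of_real (A k l) * (\<Sum>j<n. U l j * x j))" for k
        unfolding sum_distrib_right sum_distrib_left mult.assoc by (rule sum.swap)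
      then show ?thesis by (simp only:)
    qed
    finally show ?thesis
      by (simp only: b'_def sum_distrib_right distrib_left sum.distrib mult.assoc)
  qed
  \<comment> \<open>Every response of the rotated system comes from one of the original system with
    the same input and frequency, so \<open>freq\<close> and \<open>hyp\<close> transfer with the
    same \<open>\<gamma>\<close>.\<close>
  have unrotate: "(\<Sum>l<n. of_real (A i l) * (\<Sum>j<n. U l j * x j)) + of_real (b i) * w = \<i> * of_real \<omega> * (\<Sum>j<n. U i j * x j)"
    if e: "\<And>i. i < n \<Longrightarrow> (\<Sum>j<n. A' i j * x j) + b' i * w = \<i> * of_real \<omega> * x i" and i: "i < n" for x w \<omega> i
  proof -
    have "(\<Sum>l<n. of_real (A i l) * (\<Sum>j<n. U l j * x j)) + of_real (b i) * w
        = (\<Sum>k<n. U i k * ((\<Sum>j<n. A' k j * x j) + b' k * w))"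
      unfolding rotate by (rule unitary_expansion[OF ud i, symmetric])
    also have "\<dots> = (\<Sum>k<n. U i k * (\<i> * of_real \<omega> * x k))"
      by (intro sum.cong refl) (simp only: e lessThan_iff)
    also have "\<dots> = \<i> * of_real \<omega> * (\<Sum>j<n. U i j * x j)"
      by (simp only: sum_distrib_left mult_ac)
    finally show ?thesis .
  qed
  have "(\<forall>i<n. d i = 0) \<and> W n n \<le> 0"
  proof (rule kyp_dual_diagonal[OF d skew' _ eta theta' _ _ assms(7-9)])
    show "cnj (g i) = 0" if "i < n" "d i = 0" for i using g0[OF that] by simp
  next
    fix \<omega> x w assume e: "\<And>i. i < n \<Longrightarrow> (\<Sum>j<n. A' i j * x j) + b' i * w = \<i> * complex_of_real \<omega> * x i"
    have "(\<Sum>j<n. c' j * x j) = (\<Sum>j<n. of_real (c j) * (\<Sum>k<n. U j k * x k))"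
      unfolding c'_def sum_distrib_right sum_distrib_left mult.assoc by (rule sum.swap)
    then show "cmod (\<Sum>j<n. c' j * x j) \<le> \<gamma> * cmod w"
      using freq[OF unrotate[OF e]] by (simp only:)
  next
    fix \<omega> x i assume e: "\<And>i. i < n \<Longrightarrow> (\<Sum>j<n. A' i j * x j) = \<i> * complex_of_real \<omega> * x i" and "i < n"
    have "(\<Sum>j<n. U l j * x j) = 0" if "l < n" for l
      using that unrotate[of x 0 \<omega>] e by (intro hyp[of "\<lambda>l. \<Sum>j<n. U l j * x j" \<omega>]) simp_all
    then have "(\<Sum>k<n. cnj (U k i) * (\<Sum>m<n. U k m * x m)) = 0"
      by (intro sum.neutral) simp
    then show "x i = 0"
      unfolding unitary_inverse_expansion[OF ud \<open>i < n\<close>] .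
  qed
  then have d0: "\<And>k. k < n \<Longrightarrow> d k = 0" and "W n n \<le> 0" by auto
  show ?thesis
  proof (cases "i = n")
    case True
    have "0 \<le> W n n" using form[of "\<lambda>_. 0" 1] by simp
    then show ?thesis using True \<open>W n n \<le> 0\<close> by simp
  next
    case False
    then have i: "i < n" using \<open>i < Suc n\<close> by simp
    have "H i i = (\<Sum>j<n. H i j * (if j = i then 1 else 0))"
      using i by (simp add: if_distrib[of "\<lambda>c. _ * c"] cong: if_cong)
    also have "\<dots> = 0"
      unfolding diagonalization_action[OF ud i] using d0 by (intro sum.neutral) simp
    finally show ?thesis by (simp add: H_def)
  qed
qed

section \<open>Variational inequality and separation from the dual constraints\<close>

lemma nonpos_if_le_small_multiples:
  fixes x D :: real
  assumes "\<And>s. 0 < s \<Longrightarrow> s \<le> 1 \<Longrightarrow> x \<le> s * D"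
  shows "x \<le> 0"
proof (rule ccontr)
  assume "\<not> x \<le> 0"
  moreover from this have "0 < D" using assms[of 1] by simp
  moreover define s where "s = min 1 (x / (2 * D))"
  ultimately have "0 < s" "s \<le> 1" "s \<le> x / (2 * D)" "0 < D" by auto
  then have "s * D \<le> x / (2 * D) * D" by (intro mult_right_mono) auto
  with assms[of s] \<open>0 < s\<close> \<open>s \<le> 1\<close> \<open>0 < D\<close> \<open>\<not> x \<le> 0\<close> show False by simp
qed

text \<open>The right-hand side has the shape of a squared norm along a segment. Its derivative at
  \<open>s = 0\<close> is \<open>2 * (b - a)\<close>, which cannot be negative. This is the
  variational inequality of a projection onto a convex set.\<close>

lemma le_first_variation:
  fixes a b c :: real
  assumes "\<And>s. 0 < s \<Longrightarrow> s \<le> 1 \<Longrightarrow> a \<le> (1 - s)\<^sup>2 * a + 2 * s * (1 - s) * b + s\<^sup>2 * c"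
  shows "a \<le> b"
proof -
  have "2 * (a - b) \<le> s * (a - 2 * b + c)" if "0 < s" "s \<le> 1" for s
  proof -
    have "s * (2 * (a - b)) \<le> s * (s * (a - 2 * b + c))"
      using assms[OF that] by (simp add: algebra_simps power2_eq_square)
    then show ?thesis using that(1) by simp
  qed
  then have "2 * (a - b) \<le> 0" by (rule nonpos_if_le_small_multiples)
  then show ?thesis by simp
qed

lemma sum_two_point:
  fixes f :: "nat \<Rightarrow> real"
  assumes "i < m" "j < m"
  shows "(\<Sum>k<m. f k * (\<alpha> * of_bool (k = i) + \<beta> * of_bool (k = j))) = \<alpha> * f i + \<beta> * f j"
proof -
  have "(\<Sum>k<m. f k * (\<alpha> * of_bool (k = i) + \<beta> * of_bool (k = j)))
      = (\<Sum>k<m. if k = i then \<alpha> * f k else 0) + (\<Sum>k<m. if k = j then \<beta> * f k else 0)"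
    unfolding sum.distrib[symmetric] by (intro sum.cong) (auto simp: algebra_simps)
  then show ?thesis using assms by simp
qed

text \<open>Sums and differences of two unit vectors as test vectors bound
  \<open>2 * \<bar>W i j\<bar>\<close> by \<open>W i i + W j j\<close>. This makes the semidefinite
  matrices of fixed trace a bounded set.\<close>

lemma psd_entry_bound:
  fixes W :: "nat \<Rightarrow> nat \<Rightarrow> real"
  assumes sym: "\<And>i j. i < m \<Longrightarrow> j < m \<Longrightarrow> W i j = W j i"
    and psd: "\<And>v. 0 \<le> (\<Sum>i<m. \<Sum>j<m. v i * W i j * v j)"
    and ij: "i < m" "j < m"
  shows "\<bar>W i j\<bar> \<le> (\<Sum>k<m. W k k)"
proof -
  have two: "0 \<le> \<alpha> * (\<alpha> * W i i + \<beta> * W i j) + \<beta> * (\<alpha> * W j i + \<beta> * W j j)" if "i < m" "j < m" for \<alpha> \<beta> i j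
  proof -
    let ?v = "\<lambda>k. \<alpha> * of_bool (k = i) + \<beta> * of_bool (k = j)"
    have "(\<Sum>l<m. ?v k * W k l * ?v l) = (\<alpha> * W k i + \<beta> * W k j) * ?v k" for k
      using sum_two_point[OF that, of "\<lambda>l. ?v k * W k l" \<alpha> \<beta>] by (simp only: mult_ac distrib_left distrib_right)
    then have "(\<Sum>k<m. \<Sum>l<m. ?v k * W k l * ?v l) = (\<Sum>k<m. (\<alpha> * W k i + \<beta> * W k j) * ?v k)"
      by (simp only:)
    also have "\<dots> = \<alpha> * (\<alpha> * W i i + \<beta> * W i j) + \<beta> * (\<alpha> * W j i + \<beta> * W j j)"
      by (rule sum_two_point[OF that])
    finally show ?thesis using psd[of ?v] by simp
  qed
  have diag: "0 \<le> W k k" if "k < m" for k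
    using two[OF that that, of 1 0] by simp
  have le: "W k k \<le> (\<Sum>k<m. W k k)" if "k < m" for k
    using that diag by (intro member_le_sum) auto
  show ?thesis
    using two[OF ij, of 1 1] two[OF ij, of 1 "-1"] sym[OF ij] le[OF ij(1)] le[OF ij(2)] by (simp add: abs_le_iff)
qed

text \<open>
  Again \<open>v n\<close> is the input. The minimizer \<open>W0\<close> of \<open>g\<close>, the squared violation of the dual constraints over the
  positive semidefinite matrices of trace one, gives the separating \<open>P\<close>: the first-order condition at \<open>W0\<close>,
  tested with the rank-one matrices \<open>R v\<close>, is the linear matrix inequality.
\<close>

theorem strict_bounded_real_lemma:
  fixes A :: "nat \<Rightarrow> nat \<Rightarrow> real" and b c :: "nat \<Rightarrow> real"
  assumes freq: "\<And>(\<omega>::real) (x :: nat \<Rightarrow> complex) w. (\<And>i. i < n \<Longrightarrow> (\<Sum>j<n. of_real (A i j) * x j) + of_real (b i) * w = \<i> * of_real \<omega> * x i)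
      \<Longrightarrow> cmod (\<Sum>j<n. of_real (c j) * x j) \<le> \<gamma> * cmod w"
    and hyp: "\<And>(\<omega>::real) (x :: nat \<Rightarrow> complex) i. (\<And>i. i < n \<Longrightarrow> (\<Sum>j<n. of_real (A i j) * x j) = \<i> * of_real \<omega> * x i) \<Longrightarrow> i < n \<Longrightarrow> x i = 0"
    and gain: "0 \<le> \<mu>" "0 \<le> \<gamma>" "\<mu> * \<gamma> < 1"
  obtains P :: "nat \<Rightarrow> nat \<Rightarrow> real" and \<eta> :: real
  where "0 < \<eta>" and "\<And>i j. P i j = P j i"
    and "\<And>v. 2 * (\<Sum>i<n. \<Sum>j<n. v i * P i j * ((\<Sum>k<n. A j k * v k) + b j * v n))
        + \<mu>\<^sup>2 * (\<Sum>j<n. c j * v j)\<^sup>2 - (v n)\<^sup>2 \<le> - \<eta> * (\<Sum>i<Suc n. (v i)\<^sup>2)"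
proof -
  define Z where "Z W i j = (\<Sum>k<n. A i k * W (k, j)) + b i * W (n, j)" for W :: "nat \<times> nat \<Rightarrow> real" and i j
  \<comment> \<open>Adjoint of the Lyapunov part of the inequality: for \<open>W\<close> the outer
    square of \<open>v\<close>, pairing a symmetric \<open>P\<close> with \<open>L W\<close> gives
    twice the product of the state part of \<open>v\<close>, \<open>P\<close> and the velocity
    \<open>A v + b (v n)\<close>.\<close>
  define L where "L W i j = Z W i j + Z W j i" for W i j
  define \<Theta> where "\<Theta> W = \<mu>\<^sup>2 * (\<Sum>i<n. \<Sum>j<n. c i * W (i, j) * c j) - W (n, n)" for W :: "nat \<times> nat \<Rightarrow> real"
  define g where "g W = (\<Sum>i<n. \<Sum>j<n. (L W i j)\<^sup>2) + (min (\<Theta> W) 0)\<^sup>2" for W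
  \<comment> \<open>Entries outside the index square are fixed to zero for the sake of compactness;
    trace one excludes the trivial dual solution.\<close>
  define K :: "(nat \<times> nat \<Rightarrow> real) set" where
    "K = {W. \<forall>p\<in>- ({..<Suc n} \<times> {..<Suc n}). W p = 0} \<inter> {W. \<forall>p\<in>{..<Suc n} \<times> {..<Suc n}. W p - W (prod.swap p) = 0}
      \<inter> {W. \<forall>v. 0 \<le> (\<Sum>i<Suc n. \<Sum>j<Suc n. v i * W (i, j) * v j)} \<inter> {W. (\<Sum>i<Suc n. W (i, i)) = 1}"
  have cont: "continuous_on S (\<lambda>W :: nat \<times> nat \<Rightarrow> real. W p)" for S p
    by (rule continuous_on_product_coordinates[THEN continuous_on_subset]) simp
  have Ksym: "W (i, j) = W (j, i)" if "W \<in> K" "i < Suc n" "j < Suc n" for W i j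
    using that by (force simp: K_def)
  have Kpsd: "0 \<le> (\<Sum>i<Suc n. \<Sum>j<Suc n. v i * W (i, j) * v j)" if "W \<in> K" for W v
    using that unfolding K_def by blast
  have Ktr: "(\<Sum>i<Suc n. W (i, i)) = 1" if "W \<in> K" for W
    using that unfolding K_def by blast
  have "closed K"
    unfolding K_def
    by (intro closed_Int closed_Collect_ball_eq closed_Collect_all closed_Collect_le closed_Collect_eq continuous_intros cont)
  moreover have "dist 0 (W p) \<le> 1" if "W \<in> K" for W p
  proof (cases "p \<in> {..<Suc n} \<times> {..<Suc n}")
    case True
    then obtain i j where p: "p = (i, j)" "i < Suc n" "j < Suc n" by blast
    show ?thesis
      using psd_entry_bound[of "Suc n" "\<lambda>i j. W (i, j)", OF Ksym[OF that] Kpsd[OF that] p(2,3)] Ktr[OF that] p(1)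
      by simp
  next
    case False
    then have "W p = 0" using that unfolding K_def by blast
    then show ?thesis by simp
  qed
  ultimately have "compact K" by (rule compact_function_set)
  define R where "R v p = (if p \<in> {..<Suc n} \<times> {..<Suc n} then v (fst p) * v (snd p) / (\<Sum>i<Suc n. (v i)\<^sup>2) else 0)"
    for v :: "nat \<Rightarrow> real" and p
  have RK: "R v \<in> K" if v: "(\<Sum>i<Suc n. (v i)\<^sup>2) \<noteq> 0" for v
  proof -
    let ?s = "\<Sum>i<Suc n. (v i)\<^sup>2"
    have "0 \<le> (\<Sum>i<Suc n. \<Sum>j<Suc n. u i * R v (i, j) * u j)" for u
    proof -
      have "(\<Sum>i<Suc n. \<Sum>j<Suc n. u i * R v (i, j) * u j) = (\<Sum>i<Suc n. \<Sum>j<Suc n. (u i * v i) * (u j * v j)) / ?s"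
        unfolding sum_divide_distrib by (intro sum.cong refl) (simp add: R_def)
      also have "\<dots> = (\<Sum>i<Suc n. u i * v i) * (\<Sum>i<Suc n. u i * v i) / ?s"
        by (simp only: sum_product)
      finally show ?thesis
        by (simp only:) (intro divide_nonneg_nonneg sum_nonneg zero_le_square zero_le_power2)
    qed
    moreover have "(\<Sum>i<Suc n. R v (i, i)) = 1"
    proof -
      have "(\<Sum>i<Suc n. R v (i, i)) = (\<Sum>i<Suc n. (v i)\<^sup>2 / ?s)"
        by (intro sum.cong refl) (simp add: R_def power2_eq_square)
      also have "\<dots> = 1"
        unfolding sum_divide_distrib[symmetric] using v by (rule divide_self)
      finally show ?thesis .
    qed
    moreover have "\<forall>p\<in>- ({..<Suc n} \<times> {..<Suc n}). R v p = 0"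
      by (simp add: R_def)
    moreover have "\<forall>p\<in>{..<Suc n} \<times> {..<Suc n}. R v p - R v (prod.swap p) = 0"
      by (auto simp: R_def)
    ultimately show ?thesis unfolding K_def by blast
  qed
  \<comment> \<open>The input unit vector: it witnesses \<open>K \<noteq> {}\<close> and later fixes
    the sign of the multiplier \<open>t\<close>.\<close>
  define e where "e i = (of_bool (i = n) :: real)" for i
  have e_norm: "(\<Sum>i<Suc n. (e i)\<^sup>2) = 1" and e0: "i < n \<Longrightarrow> e i = 0" and e1: "e n = 1" for i
    by (auto simp: e_def)
  have "K \<noteq> {}" using RK[of e] e_norm by auto
  moreover have "continuous_on K g"
    unfolding g_def L_def Z_def \<Theta>_def by (intro continuous_intros cont)
  ultimately obtain W0 where W0: "W0 \<in> K" and g_min: "\<And>W. W \<in> K \<Longrightarrow> g W0 \<le> g W"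
    using continuous_attains_inf[OF \<open>compact K\<close>] by blast
  define t where "t = min (\<Theta> W0) 0"
  have g_nonneg: "0 \<le> g W" for W
    unfolding g_def by (intro add_nonneg_nonneg sum_nonneg zero_le_power2)
  \<comment> \<open>At a zero of \<open>g\<close> the dual constraints would hold exactly, and
    \<open>kyp_dual\<close> would make the trace vanish.\<close>
  have "g W0 \<noteq> 0"
  proof
    assume "g W0 = 0"
    moreover have "0 \<le> (\<Sum>i<n. \<Sum>j<n. (L W0 i j)\<^sup>2)" by (intro sum_nonneg zero_le_power2)
    ultimately have "(\<Sum>i<n. \<Sum>j<n. (L W0 i j)\<^sup>2) = 0" and "(min (\<Theta> W0) 0)\<^sup>2 = 0"
      unfolding g_def using zero_le_power2[of "min (\<Theta> W0) 0"] by linarith+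
    then have L0: "\<And>i j. i < n \<Longrightarrow> j < n \<Longrightarrow> L W0 i j = 0" and T0: "0 \<le> \<Theta> W0"
      by (auto simp: sum_nonneg_eq_0_iff sum_nonneg)
    have "W0 (i, i) = 0" if "i < Suc n" for i
    proof (rule kyp_dual[where W = "\<lambda>i j. W0 (i, j)" and A = A and b = b and c = c and n = n and \<mu> = \<mu> and \<gamma> = \<gamma>,
          OF _ _ _ _ _ _ gain that])
      show "W0 (i, j) = W0 (j, i)" if "i < Suc n" "j < Suc n" for i j
        using that by (rule Ksym[OF W0])
      show "0 \<le> (\<Sum>i<Suc n. \<Sum>j<Suc n. v i * W0 (i, j) * v j)" for v
        by (rule Kpsd[OF W0])
      show "(\<Sum>k<n. A i k * W0 (k, j)) + b i * W0 (n, j) + ((\<Sum>k<n. A j k * W0 (k, i)) + b j * W0 (n, i)) = 0"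
        if "i < n" "j < n" for i j
        using L0[OF that] unfolding L_def Z_def .
      show "W0 (n, n) \<le> \<mu>\<^sup>2 * (\<Sum>i<n. \<Sum>j<n. c i * W0 (i, j) * c j)"
        using T0 unfolding \<Theta>_def by simp
    next
      fix \<omega> :: real and x w
      assume "\<And>i. i < n \<Longrightarrow> (\<Sum>j<n. of_real (A i j) * x j) + of_real (b i) * w = \<i> * of_real \<omega> * x i"
      then show "cmod (\<Sum>j<n. of_real (c j) * x j) \<le> \<gamma> * cmod w" by (rule freq)
    next
      fix \<omega> :: real and x and i
      assume "\<And>i. i < n \<Longrightarrow> (\<Sum>j<n. of_real (A i j) * x j) = \<i> * of_real \<omega> * x i" "i < n"
      then show "x i = 0" by (rule hyp)
    qed
    then have "(\<Sum>i<Suc n. W0 (i, i)) = 0" by (intro sum.neutral) simp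
    then show False using Ktr[OF W0] by simp
  qed
  then have g_pos: "0 < g W0" using g_nonneg[of W0] by simp
  \<comment> \<open>The separating hyperplane: \<open>g W0\<close> is the squared norm of the pair
    \<open>(L W0, t)\<close>, and the right side is the inner product of this pair with
    \<open>(L W, \<Theta> W)\<close>.\<close>
  have variation: "g W0 \<le> (\<Sum>i<n. \<Sum>j<n. L W0 i j * L W i j) + t * \<Theta> W" if W: "W \<in> K" for W
  proof (rule le_first_variation)
    fix s :: real assume s: "0 < s" "s \<le> 1"
    define V where "V p = (1 - s) * W0 p + s * W p" for p
    have "V \<in> K"
    proof -
      have "0 \<le> (\<Sum>i<Suc n. \<Sum>j<Suc n. v i * V (i, j) * v j)" for v
      proof -
        have "(\<Sum>i<Suc n. \<Sum>j<Suc n. v i * V (i, j) * v j)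
            = (1 - s) * (\<Sum>i<Suc n. \<Sum>j<Suc n. v i * W0 (i, j) * v j) + s * (\<Sum>i<Suc n. \<Sum>j<Suc n. v i * W (i, j) * v j)"
          unfolding sum_distrib_left sum.distrib[symmetric]
          by (intro sum.cong refl) (simp add: V_def algebra_simps)
        then show ?thesis
          using s Kpsd[OF W0, of v] Kpsd[OF W, of v] by simp
      qed
      moreover have "(\<Sum>i<Suc n. V (i, i)) = (1 - s) * (\<Sum>i<Suc n. W0 (i, i)) + s * (\<Sum>i<Suc n. W (i, i))"
        unfolding V_def sum_distrib_left sum.distrib[symmetric] ..
      then have "(\<Sum>i<Suc n. V (i, i)) = 1"
        unfolding Ktr[OF W0] Ktr[OF W] by simp
      moreover have "\<forall>p\<in>- ({..<Suc n} \<times> {..<Suc n}). V p = 0"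
        using W0 W unfolding K_def V_def by auto
      moreover have "\<forall>p\<in>{..<Suc n} \<times> {..<Suc n}. V p - V (prod.swap p) = 0"
        using W0 W unfolding K_def V_def by auto
      ultimately show ?thesis unfolding K_def by blast
    qed
    have LV: "L V i j = (1 - s) * L W0 i j + s * L W i j" for i j
    proof -
      have ZV: "Z V i j = (1 - s) * Z W0 i j + s * Z W i j" for i j
      proof -
        have "(\<Sum>k<n. A i k * V (k, j)) = (1 - s) * (\<Sum>k<n. A i k * W0 (k, j)) + s * (\<Sum>k<n. A i k * W (k, j))"
          unfolding sum_distrib_left sum.distrib[symmetric]
          by (intro sum.cong refl) (simp add: V_def algebra_simps)
        then show ?thesis unfolding Z_def by (simp add: V_def algebra_simps)
      qed
      show ?thesis unfolding L_def ZV by (simp add: algebra_simps)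
    qed
    have \<Theta>V: "\<Theta> V = (1 - s) * \<Theta> W0 + s * \<Theta> W"
    proof -
      have "(\<Sum>i<n. \<Sum>j<n. c i * V (i, j) * c j)
          = (1 - s) * (\<Sum>i<n. \<Sum>j<n. c i * W0 (i, j) * c j) + s * (\<Sum>i<n. \<Sum>j<n. c i * W (i, j) * c j)"
        unfolding sum_distrib_left sum.distrib[symmetric]
        by (intro sum.cong refl) (simp add: V_def algebra_simps)
      note V_sum = this
      show ?thesis unfolding \<Theta>_def V_sum V_def[of "(n, n)"] by (simp add: algebra_simps)
    qed
    \<comment> \<open>The truncation at zero is not affine in \<open>s\<close>. The affine
      expression that replaces it is at most \<open>\<Theta> V\<close>, so its square dominates, and
      at \<open>s = 0\<close> the two agree, so the first-order condition loses nothing.\<close>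
    have "(min (\<Theta> V) 0)\<^sup>2 \<le> ((1 - s) * t + s * \<Theta> W)\<^sup>2"
    proof -
      have "(1 - s) * t \<le> (1 - s) * \<Theta> W0"
        using s by (intro mult_left_mono) (auto simp: t_def)
      then have "(1 - s) * t + s * \<Theta> W \<le> \<Theta> V" unfolding \<Theta>V by simp
      then have "\<bar>min (\<Theta> V) 0\<bar> \<le> \<bar>(1 - s) * t + s * \<Theta> W\<bar>" by linarith
      then show ?thesis by (simp only: abs_le_square_iff)
    qed
    then have "g V \<le> (\<Sum>i<n. \<Sum>j<n. ((1 - s) * L W0 i j + s * L W i j)\<^sup>2) + ((1 - s) * t + s * \<Theta> W)\<^sup>2"
      unfolding g_def LV by simp
    also have "(\<Sum>i<n. \<Sum>j<n. ((1 - s) * L W0 i j + s * L W i j)\<^sup>2)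
        = (1 - s)\<^sup>2 * (\<Sum>i<n. \<Sum>j<n. (L W0 i j)\<^sup>2) + 2 * s * (1 - s) * (\<Sum>i<n. \<Sum>j<n. L W0 i j * L W i j)
          + s\<^sup>2 * (\<Sum>i<n. \<Sum>j<n. (L W i j)\<^sup>2)"
      unfolding sum_distrib_left sum.distrib[symmetric]
      by (intro sum.cong refl) (simp add: power2_eq_square algebra_simps)
    also have "((1 - s) * t + s * \<Theta> W)\<^sup>2 = (1 - s)\<^sup>2 * t\<^sup>2 + 2 * s * (1 - s) * (t * \<Theta> W) + s\<^sup>2 * (\<Theta> W)\<^sup>2"
      by (simp add: power2_eq_square algebra_simps)
    finally have "g V \<le> (1 - s)\<^sup>2 * g W0 + 2 * s * (1 - s) * ((\<Sum>i<n. \<Sum>j<n. L W0 i j * L W i j) + t * \<Theta> W)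
        + s\<^sup>2 * ((\<Sum>i<n. \<Sum>j<n. (L W i j)\<^sup>2) + (\<Theta> W)\<^sup>2)"
      unfolding g_def t_def[symmetric] distrib_left by linarith
    then show "g W0 \<le> (1 - s)\<^sup>2 * g W0 + 2 * s * (1 - s) * ((\<Sum>i<n. \<Sum>j<n. L W0 i j * L W i j) + t * \<Theta> W)
        + s\<^sup>2 * ((\<Sum>i<n. \<Sum>j<n. (L W i j)\<^sup>2) + (\<Theta> W)\<^sup>2)"
      using g_min[OF \<open>V \<in> K\<close>] by linarith
  qed
  define a where "a v i = (\<Sum>k<n. A i k * v k) + b i * v n" for v :: "nat \<Rightarrow> real" and i
  have Lsym: "L W i j = L W j i" for W i j by (simp add: L_def add.commute)
  have rank_one: "g W0 * (\<Sum>i<Suc n. (v i)\<^sup>2)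
      \<le> 2 * (\<Sum>i<n. \<Sum>j<n. v i * L W0 i j * a v j) + t * (\<mu>\<^sup>2 * (\<Sum>j<n. c j * v j)\<^sup>2 - (v n)\<^sup>2)" for v
  proof (cases "(\<Sum>i<Suc n. (v i)\<^sup>2) = 0")
    case True
    then have v0: "v i = 0" if "i < Suc n" for i
      using that by (simp only: sum_nonneg_eq_0_iff finite_lessThan zero_le_power2) simp
    have "(\<Sum>i<n. \<Sum>j<n. v i * L W0 i j * a v j) = 0" "(\<Sum>j<n. c j * v j) = 0"
      by (auto intro!: sum.neutral simp: v0)
    then show ?thesis unfolding True by (simp add: v0)
  next
    case False
    define s where "s = (\<Sum>i<Suc n. (v i)\<^sup>2)"
    have "0 \<le> s" unfolding s_def by (intro sum_nonneg) simp
    then have "0 < s" using False by (simp add: s_def)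
    have Rij: "R v (i, j) = v i * v j / s" if "i < Suc n" "j < Suc n" for i j
      using that by (simp add: R_def s_def)
    have ZR: "Z (R v) i j = a v i * v j / s" if "j < n" for i j
    proof -
      have "(\<Sum>k<n. A i k * R v (k, j)) = (\<Sum>k<n. A i k * v k) * (v j / s)"
        unfolding sum_distrib_right using that by (intro sum.cong refl) (simp add: Rij)
      then show ?thesis
        using that by (simp add: Z_def a_def Rij distrib_right add_divide_distrib)
    qed
    have "(\<Sum>i<n. \<Sum>j<n. L W0 i j * L (R v) i j)
        = (\<Sum>i<n. \<Sum>j<n. v j * L W0 j i * a v i / s) + (\<Sum>i<n. \<Sum>j<n. v i * L W0 i j * a v j / s)"
      unfolding sum.distrib[symmetric]
    proof (intro sum.cong refl)
      fix i j assume "i \<in> {..<n}" "j \<in> {..<n}"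
      then show "L W0 i j * L (R v) i j = v j * L W0 j i * a v i / s + v i * L W0 i j * a v j / s"
        using Lsym[of W0 j i] by (simp add: L_def[of "R v"] ZR algebra_simps)
    qed
    also have "(\<Sum>i<n. \<Sum>j<n. v j * L W0 j i * a v i / s) = (\<Sum>i<n. \<Sum>j<n. v i * L W0 i j * a v j / s)"
      by (rule sum.swap)
    finally have 1: "(\<Sum>i<n. \<Sum>j<n. L W0 i j * L (R v) i j) = 2 * (\<Sum>i<n. \<Sum>j<n. v i * L W0 i j * a v j) / s"
      by (simp only: sum_divide_distrib[symmetric] mult_2 add_divide_distrib)
    have "(\<Sum>i<n. \<Sum>j<n. c i * R v (i, j) * c j) = (\<Sum>j<n. c j * v j)\<^sup>2 / s"
      unfolding power2_eq_square sum_product sum_divide_distrib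
      by (intro sum.cong refl) (simp add: Rij)
    then have 2: "\<Theta> (R v) = (\<mu>\<^sup>2 * (\<Sum>j<n. c j * v j)\<^sup>2 - (v n)\<^sup>2) / s"
      unfolding \<Theta>_def by (simp add: Rij diff_divide_distrib power2_eq_square)
    have "g W0 \<le> 2 * (\<Sum>i<n. \<Sum>j<n. v i * L W0 i j * a v j) / s + t * ((\<mu>\<^sup>2 * (\<Sum>j<n. c j * v j)\<^sup>2 - (v n)\<^sup>2) / s)"
      using variation[OF RK[OF False]] unfolding 1 2 .
    then show ?thesis
      using \<open>0 < s\<close> unfolding s_def[symmetric] by (simp add: add_divide_distrib[symmetric] pos_le_divide_eq)
  qed
  \<comment> \<open>Constraint qualification: the pure input direction shows that the multiplier
    \<open>t\<close> of \<open>\<Theta>\<close> is strictly negative, so that it can be normalized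
    away.\<close>
  have "g W0 \<le> - t"
  proof -
    have "(\<Sum>i<n. \<Sum>j<n. e i * L W0 i j * a e j) = 0" "(\<Sum>j<n. c j * e j) = 0"
      by (auto intro!: sum.neutral simp: e0)
    then show ?thesis using rank_one[of e] unfolding e_norm by (simp add: e1)
  qed
  then have t: "t < 0" using g_pos by simp
  \<comment> \<open>Dividing \<open>rank_one\<close> by \<open>t < 0\<close> reverses it, scales the
    coefficient of the \<open>\<Theta>\<close> part to one and turns the minimum \<open>g W0\<close>
    into the margin.\<close>
  show ?thesis
  proof (rule that[of "g W0 / (- t)" "\<lambda>i j. L W0 i j / t"])
    show "0 < g W0 / (- t)" using g_pos t by (intro divide_pos_pos) simp_all
    show "L W0 i j / t = L W0 j i / t" for i j using Lsym[of W0 i j] by simp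
    fix v
    have "(\<Sum>i<n. \<Sum>j<n. v i * (L W0 i j / t) * ((\<Sum>k<n. A j k * v k) + b j * v n)) = (\<Sum>i<n. \<Sum>j<n. v i * L W0 i j * a v j) / t"
      unfolding sum_divide_distrib a_def by simp
    then show "2 * (\<Sum>i<n. \<Sum>j<n. v i * (L W0 i j / t) * ((\<Sum>k<n. A j k * v k) + b j * v n))
        + \<mu>\<^sup>2 * (\<Sum>j<n. c j * v j)\<^sup>2 - (v n)\<^sup>2 \<le> - (g W0 / (- t)) * (\<Sum>i<Suc n. (v i)\<^sup>2)"
      using divide_right_mono_neg[OF rank_one[of v], of t] t by (simp only:) (simp add: add_divide_distrib)
  qed
qed

section \<open>Transfer functions and singular values\<close>

lemma finite_eigenvalues:
  fixes A :: "'a :: field mat"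
  assumes "A \<in> carrier_mat n n"
  shows "finite {k. eigenvalue A k}"
proof -
  have "char_poly A \<noteq> 0"
    using degree_monic_char_poly[OF assms] by auto
  then show ?thesis
    unfolding eigenvalue_root_char_poly[OF assms] by (rule poly_roots_finite)
qed

lemma mat_adjoint_carrier: "M \<in> carrier_mat r m \<Longrightarrow> mat_adjoint M \<in> carrier_mat m r"
  by (auto simp: mat_adjoint_def)

lemma finite_singular_values:
  assumes "M \<in> carrier_mat r m"
  shows "finite (singular_values M)"
proof (rule inj_on_finite[of "\<lambda>\<sigma>. complex_of_real (\<sigma>\<^sup>2)"])
  show "inj_on (\<lambda>\<sigma>. complex_of_real (\<sigma>\<^sup>2)) (singular_values M)"
    unfolding inj_on_def singular_values_def of_real_eq_iff by (simp add: power2_eq_iff_nonneg)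
  have "mat_adjoint M * M \<in> carrier_mat m m"
    using assms mat_adjoint_carrier by (intro mult_carrier_mat)
  then show "finite {k. eigenvalue (mat_adjoint M * M) k}" by (rule finite_eigenvalues)
qed (auto simp: singular_values_def)

text \<open>\<open>sigma_max\<close> is defined by eigenvalues and not as an operator norm. The
  squared norm of column \<open>j\<close> is a diagonal entry of the Gram matrix, hence a mean of
  its eigenvalues \<open>d k\<close> with weights \<open>(cmod (U j k))\<^sup>2\<close> summing to
  one; so some eigenvalue is at least the squared modulus of the entry.\<close>

lemma entry_le_sigma_max:
  assumes M: "M \<in> carrier_mat r m" and i: "i < r" and j: "j < m"
  shows "cmod (M $$ (i, j)) \<le> sigma_max M"
proof -
  define G where "G = mat_adjoint M * M"
  define H where "H a b = (\<Sum>l<r. cnj (M $$ (l, a)) * M $$ (l, b))" for a b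
  have carr: "G \<in> carrier_mat m m"
    unfolding G_def using M mat_adjoint_carrier by (intro mult_carrier_mat)
  have GH: "G $$ (a, b) = H a b" if "a < m" "b < m" for a b
    using that M by (simp add: G_def mat_adjoint_def mat_of_rows_index H_def scalar_prod_def atLeast0LessThan)
  have "H b a = cnj (H a b)" for a b
    by (simp add: H_def mult.commute)
  then obtain U d where ud: "unitary_diagonalization m H U d"
    by (rule unitary_diagonalization_exists)
  let ?x = "\<lambda>l. of_bool (l = j) :: complex"
  have delta: "(\<Sum>l<m. f l * ?x l) = f j" for f :: "nat \<Rightarrow> complex"
    using j by (simp add: of_bool_def if_distrib[of "\<lambda>c. _ * c"] cong: if_cong)
  have delta': "(\<Sum>l<m. cnj (?x l) * f l) = f j" for f :: "nat \<Rightarrow> complex"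
  proof -
    have "cnj (?x l) = ?x l" for l by (cases "l = j") simp_all
    then show ?thesis using delta[of f] by (simp only: mult.commute)
  qed
  have "H j j = of_real (\<Sum>k<m. d k * (cmod (U j k))\<^sup>2)"
  proof -
    have "(\<Sum>l<m. H a l * ?x l) = H a j" for a by (rule delta)
    moreover have "(\<Sum>l<m. cnj (?x l) * H l j) = H j j" by (rule delta')
    moreover have "(\<Sum>l<m. cnj (U l k) * ?x l) = cnj (U j k)" for k by (rule delta)
    ultimately show ?thesis
      using diagonalization_form[OF ud, of ?x] by (simp only: complex_mod_cnj)
  qed
  moreover have "H j j = of_real (\<Sum>l<r. (cmod (M $$ (l, j)))\<^sup>2)"
    by (simp only: H_def of_real_sum complex_norm_square mult.commute)
  ultimately have diag: "(\<Sum>k<m. d k * (cmod (U j k))\<^sup>2) = (\<Sum>l<r. (cmod (M $$ (l, j)))\<^sup>2)"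
    by (simp only: of_real_eq_iff)
  have entry: "(cmod (M $$ (i, j)))\<^sup>2 \<le> (\<Sum>l<r. (cmod (M $$ (l, j)))\<^sup>2)"
    using i by (intro member_le_sum) auto
  have row: "(\<Sum>k<m. (cmod (U j k))\<^sup>2) = 1"
  proof -
    have "of_real (\<Sum>k<m. (cmod (U j k))\<^sup>2) = (\<Sum>k<m. U j k * cnj (U j k))"
      by (simp only: of_real_sum complex_norm_square)
    then have "complex_of_real (\<Sum>k<m. (cmod (U j k))\<^sup>2) = of_real 1"
      using unitary_rows[OF ud j j] by simp
    then show ?thesis unfolding of_real_eq_iff .
  qed
  have "\<exists>k<m. (cmod (M $$ (i, j)))\<^sup>2 \<le> d k"
  proof (rule ccontr)
    let ?c = "(cmod (M $$ (i, j)))\<^sup>2"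
    assume "\<not> (\<exists>k<m. ?c \<le> d k)"
    then have less: "\<And>k. k < m \<Longrightarrow> 0 < ?c - d k" by auto
    have "(\<Sum>k<m. (?c - d k) * (cmod (U j k))\<^sup>2) = ?c * (\<Sum>k<m. (cmod (U j k))\<^sup>2) - (\<Sum>k<m. d k * (cmod (U j k))\<^sup>2)"
      by (simp only: left_diff_distrib sum_subtractf sum_distrib_left)
    then have le0: "(\<Sum>k<m. (?c - d k) * (cmod (U j k))\<^sup>2) \<le> 0" using diag entry row by simp
    have "(cmod (U j k))\<^sup>2 = 0" if "k < m" for k
    proof (rule ccontr)
      assume "(cmod (U j k))\<^sup>2 \<noteq> 0"
      then have "0 < (\<Sum>k<m. (?c - d k) * (cmod (U j k))\<^sup>2)"
        using less that by (intro sum_pos2[of _ k] mult_pos_pos mult_nonneg_nonneg) (auto simp: less_imp_le)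
      then show False using le0 by simp
    qed
    then show False using row by simp
  qed
  then obtain k where k: "k < m" "(cmod (M $$ (i, j)))\<^sup>2 \<le> d k" by blast
  have "eigenvector G (vec m (\<lambda>a. U a k)) (of_real (d k))"
    unfolding eigenvector_def
  proof (intro conjI)
    show "vec m (\<lambda>a. U a k) \<in> carrier_vec (dim_row G)" using carr by simp
    show "vec m (\<lambda>a. U a k) \<noteq> 0\<^sub>v (dim_row G)"
    proof
      assume z: "vec m (\<lambda>a. U a k) = 0\<^sub>v (dim_row G)"
      have "U a k = 0" if "a < m" for a
        using arg_cong[OF z, of "\<lambda>v. vec_index v a"] that carr by simp
      then have "(\<Sum>a<m. cnj (U a k) * U a k) = 0" by (intro sum.neutral) simp
      then show False using unitary_columns[OF ud k(1) k(1)] by simp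
    qed
    show "G *\<^sub>v vec m (\<lambda>a. U a k) = of_real (d k) \<cdot>\<^sub>v vec m (\<lambda>a. U a k)"
    proof (rule eq_vecI)
      fix a assume "a < dim_vec (of_real (d k) \<cdot>\<^sub>v vec m (\<lambda>a. U a k))"
      then have a: "a < m" by simp
      then have "(G *\<^sub>v vec m (\<lambda>a. U a k)) $ a = (\<Sum>b<m. G $$ (a, b) * U b k)"
        using carr by (simp add: scalar_prod_def atLeast0LessThan)
      also have "\<dots> = (\<Sum>b<m. H a b * U b k)"
        using a by (intro sum.cong refl) (simp only: GH lessThan_iff)
      finally show "(G *\<^sub>v vec m (\<lambda>a. U a k)) $ a = (of_real (d k) \<cdot>\<^sub>v vec m (\<lambda>a. U a k)) $ a"
        using eigen_columns[OF ud a k(1)] a by simp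
    qed (use carr in simp)
  qed
  moreover have d0: "0 \<le> d k" by (rule order_trans[OF zero_le_power2 k(2)])
  ultimately have "sqrt (d k) \<in> singular_values M"
    unfolding singular_values_def G_def[symmetric] eigenvalue_def by (auto simp del: of_real_power)
  then have "sqrt (d k) \<le> sigma_max M"
    unfolding sigma_max_def by (rule Max_ge[OF finite_singular_values[OF M]])
  moreover have "cmod (M $$ (i, j)) \<le> sqrt (d k)"
    using real_sqrt_le_mono[OF k(2)] by simp
  ultimately show ?thesis by simp
qed

lemma entry_le_line_norm:
  assumes "\<And>s. Re s = - rate \<Longrightarrow> H s \<in> carrier_mat r m" "i < r" "j < m"
    and "line_norm rate H \<le> ereal \<gamma>" "Re s = - rate"
  shows "cmod (H s $$ (i, j)) \<le> \<gamma>"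
proof -
  have s: "s = \<i> * of_real (Im s) - of_real rate"
    using assms(5) by (simp add: complex_eq_iff)
  have "ereal (sigma_max (H s)) \<le> line_norm rate H"
    unfolding line_norm_def by (subst s) (rule SUP_upper[OF UNIV_I])
  then have "sigma_max (H s) \<le> \<gamma>" using assms(4) order_trans ereal_less_eq(3) by metis
  then show ?thesis using entry_le_sigma_max[OF assms(1)[OF assms(5)] assms(2,3)] by simp
qed

section \<open>Resolvents and frequency responses\<close>

lemma resolvent_matrix_action:
  assumes A: "A \<in> carrier_mat n n" and v: "v \<in> carrier_vec n" and r: "r < n"
  shows "((s \<cdot>\<^sub>m 1\<^sub>m n - complex_mat A) *\<^sub>v v) $ r = s * v $ r - (\<Sum>q<n. of_real (A $$ (r, q)) * v $ q)"
proof -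
  have "((s \<cdot>\<^sub>m 1\<^sub>m n - complex_mat A) *\<^sub>v v) $ r = (\<Sum>q<n. (s * of_bool (r = q) - of_real (A $$ (r, q))) * v $ q)"
    using A v r by (auto simp: scalar_prod_def atLeast0LessThan intro!: sum.cong)
  also have "\<dots> = (\<Sum>q<n. if q = r then s * v $ q else 0) - (\<Sum>q<n. of_real (A $$ (r, q)) * v $ q)"
    unfolding sum_subtractf[symmetric] by (intro sum.cong refl) (simp add: left_diff_distrib)
  also have "\<dots> = s * v $ r - (\<Sum>q<n. of_real (A $$ (r, q)) * v $ q)"
    using r by simp
  finally show ?thesis .
qed

text \<open>Off the spectrum \<open>the (mat_inverse _)\<close> is a true inverse. \<open>X\<close>
  is obtained before \<open>B\<close> and \<open>C\<close>, so that transfer functions with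
  different inputs and outputs share it.\<close>

lemma resolvent_exists:
  assumes A: "A \<in> carrier_mat n n" and "\<not> eigenvalue (complex_mat A) s"
  obtains X where "X \<in> carrier_mat n n"
    and "X * (s \<cdot>\<^sub>m 1\<^sub>m n - complex_mat A) = 1\<^sub>m n"
    and "\<And>B C. transfer_function A B C s = complex_mat C * X * complex_mat B"
proof -
  let ?N = "s \<cdot>\<^sub>m 1\<^sub>m n - complex_mat A"
  have N: "?N \<in> carrier_mat n n" using A by (intro minus_carrier_mat) simp
  have "Determinant.det ?N \<noteq> 0"
  proof
    assume "Determinant.det ?N = 0"
    then obtain v where v: "v \<in> carrier_vec n" "v \<noteq> 0\<^sub>v n" "?N *\<^sub>v v = 0\<^sub>v n"
      using det_0_iff_vec_prod_zero_field[OF N] by blast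
    have "complex_mat A *\<^sub>v v = s \<cdot>\<^sub>v v"
    proof (rule eq_vecI)
      fix i assume "i < dim_vec (s \<cdot>\<^sub>v v)"
      then have i: "i < n" using v(1) by simp
      have "(?N *\<^sub>v v) $ i = 0" using v(3) i by simp
      then show "(complex_mat A *\<^sub>v v) $ i = (s \<cdot>\<^sub>v v) $ i"
        using i A v(1) unfolding resolvent_matrix_action[OF A v(1) i]
        by (simp add: scalar_prod_def atLeast0LessThan)
    qed (use A v(1) in simp)
    then have "eigenvector (complex_mat A) v s"
      using v(1,2) A by (simp add: eigenvector_def)
    then show False using assms(2) by (auto simp: eigenvalue_def)
  qed
  then have unit: "?N \<in> Units (ring_mat TYPE(complex) n ())"
    by (rule det_non_zero_imp_unit[OF N])
  have "mat_inverse ?N \<noteq> None"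
    using mat_inverse(1)[OF N, where b = "()"] unit by argo
  then obtain X where X: "mat_inverse ?N = Some X" by fastforce
  show ?thesis
  proof (rule that[of X])
    show "X \<in> carrier_mat n n" "X * ?N = 1\<^sub>m n" using mat_inverse(2)[OF N X] by auto
    show "transfer_function A B C s = complex_mat C * X * complex_mat B" for B C
      using A X by (simp add: transfer_function_def)
  qed
qed

lemma transfer_function_carrier:
  assumes "A \<in> carrier_mat n n" "\<not> eigenvalue (complex_mat A) s" "B \<in> carrier_mat n m" "C \<in> carrier_mat k n"
  shows "transfer_function A B C s \<in> carrier_mat k m"
proof -
  obtain X where "X \<in> carrier_mat n n" "\<And>B C. transfer_function A B C s = complex_mat C * X * complex_mat B"
    by (rule resolvent_exists[OF assms(1,2)]) (assumption | rule that)+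
  then show ?thesis using assms(3,4) by auto
qed

lemma transfer_function_entry:
  assumes "X \<in> carrier_mat n n" "B \<in> carrier_mat n m" "C \<in> carrier_mat k n" "i < k" "j < m"
  shows "(complex_mat C * X * complex_mat B) $$ (i, j)
    = (\<Sum>l<n. of_real (C $$ (i, l)) * (\<Sum>q<n. X $$ (l, q) * of_real (B $$ (q, j))))"
  using assms by (auto simp: scalar_prod_def atLeast0LessThan intro!: sum.cong)

text \<open>An entry sees only one column of \<open>B\<close> and one row of \<open>C\<close>; this
  extracts a single channel from a multivariable transfer function.\<close>

lemma transfer_function_entry_cong:
  assumes "A \<in> carrier_mat n n" "\<not> eigenvalue (complex_mat A) s"
    and "B \<in> carrier_mat n m" "C \<in> carrier_mat k n" "i < k" "j < m"
    and "B' \<in> carrier_mat n m'" "C' \<in> carrier_mat k' n" "i' < k'" "j' < m'"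
    and "\<And>q. q < n \<Longrightarrow> B $$ (q, j) = B' $$ (q, j')" "\<And>q. q < n \<Longrightarrow> C $$ (i, q) = C' $$ (i', q)"
  shows "transfer_function A B C s $$ (i, j) = transfer_function A B' C' s $$ (i', j')"
proof -
  obtain X where X: "X \<in> carrier_mat n n" and T: "\<And>B C. transfer_function A B C s = complex_mat C * X * complex_mat B"
    by (rule resolvent_exists[OF assms(1,2)]) (assumption | rule that)+
  show ?thesis
    unfolding T transfer_function_entry[OF X assms(3-6)] transfer_function_entry[OF X assms(7-10)]
    using assms(11,12) by (intro sum.cong arg_cong2[of _ _ _ _ "(*)"] refl) auto
qed

text \<open>The left inverse \<open>X\<close> is applied to \<open>(s I - A) x = b w\<close>. This
  links bounds on the line to the hypothesis \<open>freq\<close> of the bounded real lemma, which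
  speaks of responses.\<close>

lemma transfer_function_response:
  assumes A: "A \<in> carrier_mat n n" "\<not> eigenvalue (complex_mat A) s"
    and BC: "B \<in> carrier_mat n m" "C \<in> carrier_mat k n" "i < k" "j < m"
    and state: "\<And>r. r < n \<Longrightarrow> (\<Sum>q<n. of_real (A $$ (r, q)) * x q) + of_real (B $$ (r, j)) * w = s * x r"
  shows "(\<Sum>q<n. of_real (C $$ (i, q)) * x q) = transfer_function A B C s $$ (i, j) * w"
proof -
  let ?N = "s \<cdot>\<^sub>m 1\<^sub>m n - complex_mat A"
  obtain X where X: "X \<in> carrier_mat n n" "X * ?N = 1\<^sub>m n"
    and T: "\<And>B C. transfer_function A B C s = complex_mat C * X * complex_mat B"
    by (rule resolvent_exists[OF A]) (assumption | rule that)+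
  let ?x = "vec n x" and ?b = "vec n (\<lambda>r. of_real (B $$ (r, j)) * w)"
  have N: "?N \<in> carrier_mat n n" using A(1) by (intro minus_carrier_mat) simp
  have "?N *\<^sub>v ?x = ?b"
  proof (rule eq_vecI)
    fix r assume "r < dim_vec ?b"
    then have r: "r < n" by simp
    have "s * x r - (\<Sum>q<n. of_real (A $$ (r, q)) * x q) = of_real (B $$ (r, j)) * w"
      unfolding state[OF r, symmetric] by simp
    then show "(?N *\<^sub>v ?x) $ r = ?b $ r"
      unfolding resolvent_matrix_action[OF A(1) vec_carrier r] using r by simp
  qed (use A(1) in simp)
  then have "X *\<^sub>v ?b = (X * ?N) *\<^sub>v ?x"
    using assoc_mult_mat_vec[OF X(1) N, of ?x] by simp
  then have Xb: "X *\<^sub>v ?b = ?x" using X(2) by simp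
  have x: "x l = (\<Sum>q<n. X $$ (l, q) * (of_real (B $$ (q, j)) * w))" if "l < n" for l
    using arg_cong[OF Xb, of "\<lambda>v. vec_index v l"] that X(1) by (simp add: scalar_prod_def atLeast0LessThan)
  have "(\<Sum>l<n. of_real (C $$ (i, l)) * x l) = (\<Sum>l<n. of_real (C $$ (i, l)) * (\<Sum>q<n. X $$ (l, q) * (of_real (B $$ (q, j)) * w)))"
    using x by (intro sum.cong refl) (simp only: lessThan_iff)
  also have "\<dots> = (\<Sum>l<n. of_real (C $$ (i, l)) * (\<Sum>q<n. X $$ (l, q) * of_real (B $$ (q, j)))) * w"
    unfolding sum_distrib_left sum_distrib_right mult.assoc ..
  finally show ?thesis
    unfolding T transfer_function_entry[OF X(1) BC] .
qed

lemma eigenvalue_block_diagonal: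
  fixes A D :: "'a :: field mat"
  assumes A: "A \<in> carrier_mat p p" and D: "D \<in> carrier_mat q q"
    and ev: "eigenvalue (four_block_mat A (0\<^sub>m p q) (0\<^sub>m q p) D) s"
  shows "eigenvalue A s \<or> eigenvalue D s"
proof -
  let ?M = "four_block_mat A (0\<^sub>m p q) (0\<^sub>m q p) D"
  obtain v where v: "v \<in> carrier_vec (p + q)" "v \<noteq> 0\<^sub>v (p + q)" "?M *\<^sub>v v = s \<cdot>\<^sub>v v"
    using ev A D by (auto simp: eigenvalue_def eigenvector_def)
  define v1 v2 where "v1 = vec_first v p" and "v2 = vec_last v q"
  have v12: "v1 \<in> carrier_vec p" "v2 \<in> carrier_vec q" "v = v1 @\<^sub>v v2"
    using v(1) by (auto simp: v1_def v2_def)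
  have "?M *\<^sub>v v = (A *\<^sub>v v1 + 0\<^sub>m p q *\<^sub>v v2) @\<^sub>v (0\<^sub>m q p *\<^sub>v v1 + D *\<^sub>v v2)"
    unfolding v12(3) using A D v12 by (intro four_block_mat_mult_vec[of _ p p _ q _ q]) auto
  also have "\<dots> = (A *\<^sub>v v1) @\<^sub>v (D *\<^sub>v v2)"
  proof -
    have "0\<^sub>m p q *\<^sub>v v2 = 0\<^sub>v p" "0\<^sub>m q p *\<^sub>v v1 = 0\<^sub>v q"
      using v12 by (auto intro!: eq_vecI)
    then show ?thesis using A D v12 by simp
  qed
  finally have "?M *\<^sub>v v = (A *\<^sub>v v1) @\<^sub>v (D *\<^sub>v v2)" .
  moreover have "s \<cdot>\<^sub>v v = (s \<cdot>\<^sub>v v1) @\<^sub>v (s \<cdot>\<^sub>v v2)"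
    unfolding v12(3) by (intro eq_vecI) auto
  ultimately have "(A *\<^sub>v v1) @\<^sub>v (D *\<^sub>v v2) = (s \<cdot>\<^sub>v v1) @\<^sub>v (s \<cdot>\<^sub>v v2)"
    using v(3) by simp
  then have "A *\<^sub>v v1 = s \<cdot>\<^sub>v v1" "D *\<^sub>v v2 = s \<cdot>\<^sub>v v2"
    using A D v12 append_vec_eq[of "A *\<^sub>v v1" p "s \<cdot>\<^sub>v v1"] by auto
  moreover have "v1 \<noteq> 0\<^sub>v p \<or> v2 \<noteq> 0\<^sub>v q"
    using v(2) v12(3) by (auto simp: append_vec_def)
  ultimately show ?thesis
    using A D v12 by (auto simp: eigenvalue_def eigenvector_def)
qed

section \<open>Dominance of Lure systems\<close>

lemma mult_mat_vec_sum:
  assumes "A \<in> carrier_mat n m" "v \<in> carrier_vec m" "i < n"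
  shows "(A *\<^sub>v v) $ i = (\<Sum>j<m. A $$ (i, j) * v $ j)"
  using assms by (simp add: scalar_prod_def atLeast0LessThan)

text \<open>Symmetry of \<open>P\<close> merges the two cross terms. With \<open>y = A x\<close> the
  right side is the Lyapunov form of \<open>A + rate I\<close> plus the margin, which is why the
  shifted matrix appears from here on.\<close>

lemma dominance_form:
  fixes P :: "real mat"
  assumes P: "P \<in> carrier_mat N N" "transpose_mat P = P" and y: "y \<in> carrier_vec N" and x: "x \<in> carrier_vec N"
  shows "scalar_prod (y @\<^sub>v x)
      (four_block_mat (0\<^sub>m N N) P P ((2 * rate) \<cdot>\<^sub>m P + \<epsilon> \<cdot>\<^sub>m 1\<^sub>m N) *\<^sub>v (y @\<^sub>v x))
    = 2 * (\<Sum>i<N. \<Sum>j<N. x $ i * P $$ (i, j) * (y $ j + rate * x $ j)) + \<epsilon> * (\<Sum>i<N. (x $ i)\<^sup>2)"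
proof -
  let ?R = "(2 * rate) \<cdot>\<^sub>m P + \<epsilon> \<cdot>\<^sub>m 1\<^sub>m N"
  have R: "?R \<in> carrier_mat N N" using P by simp
  have "four_block_mat (0\<^sub>m N N) P P ?R *\<^sub>v (y @\<^sub>v x) = (0\<^sub>m N N *\<^sub>v y + P *\<^sub>v x) @\<^sub>v (P *\<^sub>v y + ?R *\<^sub>v x)"
    using P R x y by (intro four_block_mat_mult_vec[of _ N N _ N _ N]) auto
  moreover have "0\<^sub>m N N *\<^sub>v y + P *\<^sub>v x = P *\<^sub>v x"
    using P x y by (intro eq_vecI) auto
  ultimately have "scalar_prod (y @\<^sub>v x) (four_block_mat (0\<^sub>m N N) P P ?R *\<^sub>v (y @\<^sub>v x))
      = scalar_prod y (P *\<^sub>v x) + scalar_prod x (P *\<^sub>v y + ?R *\<^sub>v x)"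
    using scalar_prod_append[OF y x mult_mat_vec_carrier[OF P(1) x]
        add_carrier_vec[OF mult_mat_vec_carrier[OF P(1) y] mult_mat_vec_carrier[OF R x]]]
    by (simp only:)
  also have "scalar_prod y (P *\<^sub>v x) = (\<Sum>i<N. \<Sum>j<N. y $ i * P $$ (i, j) * x $ j)"
    using P x y by (simp add: scalar_prod_def atLeast0LessThan sum_distrib_left mult.assoc)
  also have "\<dots> = (\<Sum>i<N. \<Sum>j<N. x $ i * P $$ (i, j) * y $ j)"
  proof (subst sum.swap, intro sum.cong refl)
    fix i j assume "i \<in> {..<N}" "j \<in> {..<N}"
    then show "y $ j * P $$ (j, i) * x $ i = x $ i * P $$ (i, j) * y $ j"
      using symmetric_entry[OF P(2,1), of i j] by simp
  qed
  also have "scalar_prod x (P *\<^sub>v y + ?R *\<^sub>v x)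
      = (\<Sum>i<N. \<Sum>j<N. x $ i * P $$ (i, j) * y $ j) + 2 * rate * (\<Sum>i<N. \<Sum>j<N. x $ i * P $$ (i, j) * x $ j)
        + \<epsilon> * (\<Sum>i<N. (x $ i)\<^sup>2)"
  proof -
    have "(?R *\<^sub>v x) $ i = 2 * rate * (\<Sum>j<N. P $$ (i, j) * x $ j) + \<epsilon> * x $ i" if "i < N" for i
    proof -
      have "(?R *\<^sub>v x) $ i = (\<Sum>j<N. 2 * rate * (P $$ (i, j) * x $ j) + (if j = i then \<epsilon> * x $ j else 0))"
        unfolding mult_mat_vec_sum[OF R x that] using P that by (intro sum.cong) (auto simp: algebra_simps)
      then show ?thesis using that by (simp add: sum.distrib sum_distrib_left)
    qed
    then have "scalar_prod x (P *\<^sub>v y + ?R *\<^sub>v x)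
        = (\<Sum>i<N. x $ i * ((\<Sum>j<N. P $$ (i, j) * y $ j) + (2 * rate * (\<Sum>j<N. P $$ (i, j) * x $ j) + \<epsilon> * x $ i)))"
    proof -
      have dim: "dim_vec (P *\<^sub>v y + ?R *\<^sub>v x) = N" "dim_vec (?R *\<^sub>v x) = N" using P R by auto
      have "(P *\<^sub>v y + ?R *\<^sub>v x) $ i
          = (\<Sum>j<N. P $$ (i, j) * y $ j) + (2 * rate * (\<Sum>j<N. P $$ (i, j) * x $ j) + \<epsilon> * x $ i)" if "i < N" for i
        using that \<open>\<And>i. i < N \<Longrightarrow> (?R *\<^sub>v x) $ i = _\<close>[OF that] mult_mat_vec_sum[OF P(1) y that]
          index_add_vec(1)[of i "?R *\<^sub>v x" "P *\<^sub>v y"] dim(2) by (simp only:)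
      then show ?thesis
        unfolding scalar_prod_def dim atLeast0LessThan by (intro sum.cong refl) (simp only: lessThan_iff)
    qed
    also have "\<dots> = (\<Sum>i<N. (\<Sum>j<N. x $ i * P $$ (i, j) * y $ j) + 2 * rate * (\<Sum>j<N. x $ i * P $$ (i, j) * x $ j)
        + \<epsilon> * (x $ i)\<^sup>2)"
      by (intro sum.cong refl) (simp only: distrib_left sum_distrib_left power2_eq_square mult_ac add.assoc)
    finally show ?thesis by (simp only: sum.distrib sum_distrib_left)
  qed
  finally show ?thesis
    by (simp add: distrib_left sum.distrib sum_distrib_left mult_ac)
qed

lemma sum_mult_shifted_coordinate:
  fixes f :: "nat \<Rightarrow> real"
  assumes "x \<in> carrier_vec N" "j < N"
  shows "(\<Sum>k<N. f k * (x + t \<cdot>\<^sub>v unit_vec N j) $ k) = (\<Sum>k<N. f k * x $ k) + t * f j"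
proof -
  have "(\<Sum>k<N. f k * (x + t \<cdot>\<^sub>v unit_vec N j) $ k) = (\<Sum>k<N. f k * x $ k + (if k = j then t * f k else 0))"
    using assms by (intro sum.cong) (auto simp: algebra_simps)
  then show ?thesis using assms(2) by (simp add: sum.distrib)
qed

section \<open>Jacobians of the linear and of the Lure vector field\<close>

lemma jacobian_linear:
  assumes A: "A \<in> carrier_mat N N" and x: "x \<in> carrier_vec N"
  shows "jacobian N (\<lambda>x. A *\<^sub>v x) x = A"
proof (rule eq_matI)
  fix i j assume "i < dim_row A" "j < dim_col A"
  then have ij: "i < N" "j < N" using A by auto
  have "(\<lambda>t. (A *\<^sub>v (x + t \<cdot>\<^sub>v unit_vec N j)) $ i) = (\<lambda>t. (\<Sum>k<N. A $$ (i, k) * x $ k) + t * A $$ (i, j))"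
    using A x ij by (simp add: mult_mat_vec_sum[OF A] sum_mult_shifted_coordinate del: index_mult_mat_vec index_add_vec)
  moreover have "((\<lambda>t. (\<Sum>k<N. A $$ (i, k) * x $ k) + t * A $$ (i, j)) has_field_derivative A $$ (i, j)) (at 0)"
    by (auto intro!: derivative_eq_intros)
  ultimately show "jacobian N (\<lambda>x. A *\<^sub>v x) x $$ (i, j) = A $$ (i, j)"
    using ij by (simp add: jacobian_def DERIV_imp_deriv)
qed (use A in \<open>auto simp: jacobian_def\<close>)

lemma lure_field_has_derivative:
  assumes A: "A \<in> carrier_mat N N" and B: "B \<in> carrier_mat N 1" and C: "C \<in> carrier_mat 1 N"
    and \<phi>: "\<And>z. (\<phi> has_real_derivative \<phi>' z) (at z)"
    and x: "x \<in> carrier_vec N" and ij: "i < N" "j < N"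
  shows "((\<lambda>t. lure_field A B C \<phi> (x + t \<cdot>\<^sub>v unit_vec N j) $ i) has_field_derivative
    A $$ (i, j) - B $$ (i, 0) * \<phi>' (\<Sum>k<N. C $$ (0, k) * x $ k) * C $$ (0, j)) (at 0)"
proof -
  have "lure_field A B C \<phi> (x + t \<cdot>\<^sub>v unit_vec N j) $ i =
      (\<Sum>k<N. A $$ (i, k) * x $ k) + t * A $$ (i, j) - B $$ (i, 0) * \<phi> ((\<Sum>k<N. C $$ (0, k) * x $ k) + t * C $$ (0, j))" for t
  proof -
    have one: "0 < (1 :: nat)" by simp
    have xt: "x + t \<cdot>\<^sub>v unit_vec N j \<in> carrier_vec N" using x by simp
    have "lure_field A B C \<phi> (x + t \<cdot>\<^sub>v unit_vec N j) $ i =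
        (A *\<^sub>v (x + t \<cdot>\<^sub>v unit_vec N j)) $ i - (B *\<^sub>v vec 1 (\<lambda>_. \<phi> ((C *\<^sub>v (x + t \<cdot>\<^sub>v unit_vec N j)) $ 0))) $ i"
      unfolding lure_field_def using A B ij by (intro index_minus_vec) simp
    also have "(B *\<^sub>v vec 1 (\<lambda>_. \<phi> ((C *\<^sub>v (x + t \<cdot>\<^sub>v unit_vec N j)) $ 0))) $ i
        = B $$ (i, 0) * \<phi> ((C *\<^sub>v (x + t \<cdot>\<^sub>v unit_vec N j)) $ 0)"
      using mult_mat_vec_sum[OF B, of "vec 1 (\<lambda>_. \<phi> ((C *\<^sub>v (x + t \<cdot>\<^sub>v unit_vec N j)) $ 0))" i] ij by simp
    also have "(C *\<^sub>v (x + t \<cdot>\<^sub>v unit_vec N j)) $ 0 = (\<Sum>k<N. C $$ (0, k) * x $ k) + t * C $$ (0, j)"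
      unfolding mult_mat_vec_sum[OF C xt one] by (rule sum_mult_shifted_coordinate[OF x ij(2)])
    also have "(A *\<^sub>v (x + t \<cdot>\<^sub>v unit_vec N j)) $ i = (\<Sum>k<N. A $$ (i, k) * x $ k) + t * A $$ (i, j)"
      unfolding mult_mat_vec_sum[OF A xt ij(1)] by (rule sum_mult_shifted_coordinate[OF x ij(2)])
    finally show ?thesis .
  qed
  then show ?thesis
    by (auto intro!: derivative_eq_intros DERIV_chain2[OF \<phi>])
qed

lemma lure_jacobian_entry:
  assumes "A \<in> carrier_mat N N" "B \<in> carrier_mat N 1" "C \<in> carrier_mat 1 N"
    and "\<And>z. (\<phi> has_real_derivative \<phi>' z) (at z)" "x \<in> carrier_vec N" "i < N" "j < N"
  shows "jacobian N (lure_field A B C \<phi>) x $$ (i, j)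
    = A $$ (i, j) - B $$ (i, 0) * \<phi>' (\<Sum>k<N. C $$ (0, k) * x $ k) * C $$ (0, j)"
  using DERIV_imp_deriv[OF lure_field_has_derivative[where \<phi>' = \<phi>', OF assms]] assms(6,7)
  by (simp add: jacobian_def)

lemma lure_field_continuously_differentiable:
  assumes ABC: "A \<in> carrier_mat N N" "B \<in> carrier_mat N 1" "C \<in> carrier_mat 1 N"
    and \<phi>: "\<And>z. (\<phi> has_real_derivative \<phi>' z) (at z)" and cont: "continuous_on UNIV \<phi>'"
  shows "continuously_differentiable_vec N (lure_field A B C \<phi>)"
  unfolding continuously_differentiable_vec_def
proof (intro conjI allI impI ballI)
  show "lure_field A B C \<phi> \<in> carrier_vec N \<rightarrow> carrier_vec N"
    using ABC by (auto simp: lure_field_def)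
next
  fix i j and x :: "real vec" assume "i < N" "j < N" "x \<in> carrier_vec N"
  then show "(\<lambda>t. lure_field A B C \<phi> (x + t \<cdot>\<^sub>v unit_vec N j) $ i) field_differentiable (at 0)"
    using lure_field_has_derivative[where \<phi>' = \<phi>', OF ABC \<phi>] unfolding field_differentiable_def by blast
next
  fix i j assume ij: "i < N" "j < N"
  have "jacobian N (lure_field A B C \<phi>) (vec N v) $$ (i, j)
      = A $$ (i, j) - B $$ (i, 0) * \<phi>' (\<Sum>k<N. C $$ (0, k) * v k) * C $$ (0, j)" for v :: "nat \<Rightarrow> real"
    unfolding lure_jacobian_entry[where \<phi>' = \<phi>', OF ABC \<phi> vec_carrier ij] by simp
  moreover have "continuous_on UNIV (\<lambda>v :: nat \<Rightarrow> real. A $$ (i, j) - B $$ (i, 0) * \<phi>' (\<Sum>k<N. C $$ (0, k) * v k) * C $$ (0, j))"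
    by (intro continuous_intros continuous_on_compose2[OF cont] continuous_on_product_coordinates) auto
  ultimately show "continuous_on UNIV (\<lambda>v. jacobian N (lure_field A B C \<phi>) (vec N v) $$ (i, j))"
    by (simp only:)
qed

text \<open>A singular \<open>R = (1 - t) P + t Q\<close> would have a real kernel vector, on which both Lyapunov
  forms could not be negative at once.\<close>

lemma lyapunov_segment_nonsingular:
  fixes P Q :: "real mat" and f :: "(nat \<Rightarrow> real) \<Rightarrow> nat \<Rightarrow> real"
  assumes P: "P \<in> carrier_mat n n" "transpose_mat P = P" and Q: "Q \<in> carrier_mat n n" "transpose_mat Q = Q"
    and pos: "0 < \<epsilon>" "0 < \<eta>"
    and lyap: "\<And>v. 2 * (\<Sum>i<n. \<Sum>j<n. v i * P $$ (i, j) * f v j) \<le> - \<epsilon> * (\<Sum>i<n. (v i)\<^sup>2)"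
      "\<And>v. 2 * (\<Sum>i<n. \<Sum>j<n. v i * Q $$ (i, j) * f v j) \<le> - \<eta> * (\<Sum>i<n. (v i)\<^sup>2)"
    and t: "t \<in> {0..1}"
  shows "\<not> eigenvalue ((1 - t) \<cdot>\<^sub>m P + t \<cdot>\<^sub>m Q) 0"
proof
  define R where "R = (1 - t) \<cdot>\<^sub>m P + t \<cdot>\<^sub>m Q"
  have R: "R \<in> carrier_mat n n" using P Q by (simp add: R_def)
  assume "eigenvalue ((1 - t) \<cdot>\<^sub>m P + t \<cdot>\<^sub>m Q) 0"
  then obtain v where v: "v \<in> carrier_vec n" "v \<noteq> 0\<^sub>v n" "R *\<^sub>v v = 0 \<cdot>\<^sub>v v"
    using R unfolding R_def[symmetric] eigenvalue_def eigenvector_def by auto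
  \<comment> \<open>Symmetry of \<open>R\<close> turns the kernel vector into a left one, so it
    annihilates \<open>R\<close> against any right factor.\<close>
  have ker: "(\<Sum>i<n. v $ i * R $$ (i, j)) = 0" if "j < n" for j
  proof -
    have "(\<Sum>i<n. v $ i * R $$ (i, j)) = (\<Sum>i<n. R $$ (j, i) * v $ i)"
    proof (intro sum.cong refl)
      fix i assume "i \<in> {..<n}"
      then show "v $ i * R $$ (i, j) = R $$ (j, i) * v $ i"
        using symmetric_entry[OF P(2,1), of i j] symmetric_entry[OF Q(2,1), of i j] that P Q by (simp add: R_def)
    qed
    also have "\<dots> = 0"
      using mult_mat_vec_sum[OF R v(1) that] v(1,3) that by simp
    finally show ?thesis .
  qed
  let ?s = "\<Sum>i<n. (v $ i)\<^sup>2"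
  have "\<exists>i<n. v $ i \<noteq> 0"
    using v(1,2) by (metis carrier_vecD eq_vecI index_zero_vec(1) index_zero_vec(2))
  then have s: "0 < ?s" by (auto intro!: sum_pos2)
  let ?f = "f (\<lambda>i. v $ i)"
  let ?p = "\<Sum>i<n. \<Sum>j<n. v $ i * P $$ (i, j) * ?f j" and ?q = "\<Sum>i<n. \<Sum>j<n. v $ i * Q $$ (i, j) * ?f j"
  have "(1 - t) * ?p + t * ?q = (\<Sum>i<n. \<Sum>j<n. v $ i * R $$ (i, j) * ?f j)"
    unfolding sum_distrib_left sum.distrib[symmetric]
    using P Q by (intro sum.cong refl) (auto simp: R_def algebra_simps)
  also have "\<dots> = (\<Sum>j<n. (\<Sum>i<n. v $ i * R $$ (i, j)) * ?f j)"
    unfolding sum_distrib_right by (rule sum.swap)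
  also have "\<dots> = 0" using ker by (intro sum.neutral) simp
  finally have zero: "(1 - t) * ?p + t * ?q = 0" .
  have neg: "?p < 0" "?q < 0"
    using lyap[of "\<lambda>i. v $ i"] mult_pos_pos[OF pos(1) s] mult_pos_pos[OF pos(2) s] by linarith+
  show False
  proof (cases "t = 0")
    case False
    then have "t * ?q < 0" "(1 - t) * ?p \<le> 0"
      using t neg by (auto simp: mult_pos_neg mult_nonneg_nonpos)
    then show False using zero by linarith
  qed (use zero neg in simp)
qed

text \<open>Both diagonal blocks avoid the line. For \<open>A\<close> the coordinate change enters
  through the characteristic polynomial, compared over the reals and then mapped to the complex
  numbers, which saves complexifying \<open>T\<close>.\<close>

lemma splitting_reduction_no_eigenvalue_on_line:
  assumes split: "splitting_reduction rate p n \<nu> m k A B C A' B' C'" and s: "Re s = - rate"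
  shows "\<not> eigenvalue (complex_mat A) s" "\<not> eigenvalue (complex_mat A') s"
proof -
  obtain T T_inv A_dom A_non A_red where carr: "A_dom \<in> carrier_mat p p" "A_non \<in> carrier_mat (n - p) (n - p)"
      "A_red \<in> carrier_mat (\<nu> - p) (\<nu> - p)"
    and sim: "similar_mat_wit A (four_block_mat A_dom (0\<^sub>m p (n - p)) (0\<^sub>m (n - p) p) A_non) T T_inv"
    and ev: "\<forall>s. eigenvalue (complex_mat A_dom) s \<longrightarrow> Re s > - rate"
      "\<forall>s. eigenvalue (complex_mat A_non) s \<longrightarrow> Re s < - rate"
      "\<forall>s. eigenvalue (complex_mat A_red) s \<longrightarrow> Re s < - rate"
    and A': "A' = four_block_mat A_dom (0\<^sub>m p (\<nu> - p)) (0\<^sub>m (\<nu> - p) p) A_red"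
    using split unfolding splitting_reduction_def by blast
  have block: "\<not> eigenvalue (complex_mat (four_block_mat A_dom (0\<^sub>m p q) (0\<^sub>m q p) D)) s"
    if D: "D \<in> carrier_mat q q" "\<forall>s. eigenvalue (complex_mat D) s \<longrightarrow> Re s < - rate" for D q
  proof
    assume "eigenvalue (complex_mat (four_block_mat A_dom (0\<^sub>m p q) (0\<^sub>m q p) D)) s"
    moreover have "complex_mat (four_block_mat A_dom (0\<^sub>m p q) (0\<^sub>m q p) D)
        = four_block_mat (complex_mat A_dom) (0\<^sub>m p q) (0\<^sub>m q p) (complex_mat D)"
      using carr D by (intro eq_matI) auto
    ultimately have "eigenvalue (complex_mat A_dom) s \<or> eigenvalue (complex_mat D) s"
      using carr D by (simp add: eigenvalue_block_diagonal[of _ p _ q])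
    then show False using ev(1) D(2) s by fastforce
  qed
  show "\<not> eigenvalue (complex_mat A') s"
    unfolding A' by (rule block[OF carr(3) ev(3)])
  define M where "M = four_block_mat A_dom (0\<^sub>m p (n - p)) (0\<^sub>m (n - p) p) A_non"
  define N where "N = dim_row A"
  note sim = sim[folded M_def]
  have A: "A \<in> carrier_mat N N" and M: "M \<in> carrier_mat N N"
    using sim unfolding similar_mat_wit_def Let_def N_def by blast+
  have "char_poly A = char_poly M"
    using sim by (intro char_poly_similar) (auto simp: similar_mat_def)
  then have "char_poly (complex_mat A) = char_poly (complex_mat M)"
    by (simp only: of_real_hom.char_poly_hom[OF A] of_real_hom.char_poly_hom[OF M])
  then have "eigenvalue (complex_mat A) s \<longleftrightarrow> eigenvalue (complex_mat M) s"
    using A M eigenvalue_root_char_poly[of "complex_mat A" N s] eigenvalue_root_char_poly[of "complex_mat M" N s]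
    by (simp only: map_carrier_mat)
  then show "\<not> eigenvalue (complex_mat A) s"
    using block[OF carr(2) ev(2)] unfolding M_def by simp
qed

lemma append_cols_carrier: "A \<in> carrier_mat n m \<Longrightarrow> B \<in> carrier_mat n m' \<Longrightarrow> A @\<^sub>c B \<in> carrier_mat n (m + m')"
  unfolding append_cols_def by auto

lemma append_cols_entry:
  "A \<in> carrier_mat n 1 \<Longrightarrow> B \<in> carrier_mat n 1 \<Longrightarrow> q < n \<Longrightarrow> (A @\<^sub>c B) $$ (q, 1) = B $$ (q, 0)"
  unfolding append_cols_def by auto

lemma append_rows_entry:
  "A \<in> carrier_mat 1 n \<Longrightarrow> B \<in> carrier_mat 1 n \<Longrightarrow> q < n \<Longrightarrow> (A @\<^sub>r B) $$ (1, q) = B $$ (0, q)"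
  unfolding append_rows_def by auto

text \<open>With inputs ordered \<open>u, w\<close> and outputs ordered \<open>y, z\<close>, the
  zero-based index \<open>(1, 1)\<close> is the channel from \<open>w\<close> to
  \<open>z\<close>.\<close>

lemma transfer_function_zw_entry:
  assumes "A \<in> carrier_mat n n" "\<not> eigenvalue (complex_mat A) s"
    and B: "B1 \<in> carrier_mat n 1" "B2 \<in> carrier_mat n 1" and C: "C1 \<in> carrier_mat 1 n" "C2 \<in> carrier_mat 1 n"
  shows "transfer_function A (B1 @\<^sub>c B2) (C1 @\<^sub>r C2) s \<in> carrier_mat 2 2"
    and "transfer_function A (B1 @\<^sub>c B2) (C1 @\<^sub>r C2) s $$ (1, 1) = transfer_function A B2 C2 s $$ (0, 0)"
proof -
  have BC: "B1 @\<^sub>c B2 \<in> carrier_mat n 2" "C1 @\<^sub>r C2 \<in> carrier_mat 2 n"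
    using append_cols_carrier[OF B] carrier_append_rows[OF C] by (simp_all add: numeral_2_eq_2)
  show "transfer_function A (B1 @\<^sub>c B2) (C1 @\<^sub>r C2) s \<in> carrier_mat 2 2"
    by (rule transfer_function_carrier[OF assms(1,2) BC])
  show "transfer_function A (B1 @\<^sub>c B2) (C1 @\<^sub>r C2) s $$ (1, 1) = transfer_function A B2 C2 s $$ (0, 0)"
    by (rule transfer_function_entry_cong[OF assms(1,2) BC _ _ B(2) C(2)])
      (use append_cols_entry[OF B] append_rows_entry[OF C] in auto)
qed

lemma sector_bound:
  assumes "deriv_in_sector \<phi> (- \<mu>) \<mu>"
  shows "(deriv \<phi> z)\<^sup>2 \<le> \<mu>\<^sup>2"
  using assms[unfolded deriv_in_sector_def, rule_format, of z 1]
  by (simp add: algebra_simps power2_eq_square)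

theorem small_gain_dominance:
  fixes A B C :: "real mat"
  assumes A: "A \<in> carrier_mat N N" and B: "B \<in> carrier_mat N 1" and C: "C \<in> carrier_mat 1 N"
    and \<phi>: "\<phi> C1_differentiable_on UNIV" and sector: "deriv_in_sector \<phi> (- \<mu>) \<mu>"
    and dom: "strictly_dominant p N rate (\<lambda>x. A *\<^sub>v x)"
    and no_ev: "\<And>s. Re s = - rate \<Longrightarrow> \<not> eigenvalue (complex_mat A) s"
    and gain: "\<And>s. Re s = - rate \<Longrightarrow> cmod (transfer_function A B C s $$ (0, 0)) \<le> \<gamma>"
    and "0 \<le> \<mu>" "\<mu> * \<gamma> < 1"
  shows "strictly_dominant p N rate (lure_field A B C \<phi>)"
proof -
  \<comment> \<open>The matrix \<open>A + rate I\<close>: the shift moves the line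
    \<open>Re s = - rate\<close> to the imaginary axis.\<close>
  define a where "a i j = A $$ (i, j) + (if i = j then rate else 0)" for i j
  define b where "b i = B $$ (i, 0)" for i
  define c where "c j = C $$ (0, j)" for j
  have shift: "(\<Sum>j<N. of_real (a i j) * x j) = (\<Sum>j<N. of_real (A $$ (i, j)) * x j) + of_real rate * x i"
    if "i < N" for i and x :: "nat \<Rightarrow> 'a :: {real_algebra_1, comm_ring_1}"
  proof -
    have "(\<Sum>j<N. of_real (a i j) * x j) = (\<Sum>j<N. of_real (A $$ (i, j)) * x j + (if j = i then of_real rate * x j else 0))"
      by (intro sum.cong) (auto simp: a_def algebra_simps)
    then show ?thesis using that by (simp add: sum.distrib)
  qed
  have shift_real: "(\<Sum>j<N. a i j * v j) = (\<Sum>j<N. A $$ (i, j) * v j) + rate * v i" if "i < N" for i and v :: "nat \<Rightarrow> real"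
    using shift[OF that, of v] by simp
  \<comment> \<open>Read off from \<open>gain\<close> at the real point of the line.\<close>
  have "0 \<le> \<gamma>"
    using order_trans[OF norm_ge_zero gain[of "- of_real rate"]] by simp
  have freq: "cmod (\<Sum>j<N. of_real (c j) * x j) \<le> \<gamma> * cmod w"
    if e: "\<And>i. i < N \<Longrightarrow> (\<Sum>j<N. of_real (a i j) * x j) + of_real (b i) * w = \<i> * of_real \<omega> * x i" for \<omega> x w
  proof -
    let ?s = "\<i> * of_real \<omega> - of_real rate"
    have s: "Re ?s = - rate" by simp
    have "(\<Sum>j<N. of_real (A $$ (i, j)) * x j) + of_real (B $$ (i, 0)) * w = ?s * x i" if "i < N" for i
      using e[OF that] unfolding shift[OF that] b_def by (simp add: algebra_simps)
    then have "(\<Sum>j<N. of_real (C $$ (0, j)) * x j) = transfer_function A B C ?s $$ (0, 0) * w"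
      by (intro transfer_function_response[OF A no_ev[OF s] B C]) simp_all
    then show ?thesis
      using gain[OF s] by (simp add: c_def norm_mult mult_right_mono)
  qed
  have hyp: "x i = 0"
    if e: "\<And>i. i < N \<Longrightarrow> (\<Sum>j<N. of_real (a i j) * x j) = \<i> * of_real \<omega> * x i" and i: "i < N" for \<omega> :: real and x :: "nat \<Rightarrow> complex" and i
  proof (rule ccontr)
    assume "x i \<noteq> 0"
    let ?s = "\<i> * of_real \<omega> - of_real rate"
    have "vec N x \<noteq> 0\<^sub>v N"
      using \<open>x i \<noteq> 0\<close> i by (metis index_vec index_zero_vec(1))
    moreover have "complex_mat A *\<^sub>v vec N x = ?s \<cdot>\<^sub>v vec N x"
    proof (rule eq_vecI)
      fix k assume "k < dim_vec (?s \<cdot>\<^sub>v vec N x)"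
      then have k: "k < N" by simp
      have "(\<Sum>j<N. of_real (A $$ (k, j)) * x j) = ?s * x k"
        using e[OF k] unfolding shift[OF k] by (simp add: algebra_simps)
      then show "(complex_mat A *\<^sub>v vec N x) $ k = (?s \<cdot>\<^sub>v vec N x) $ k"
        using k A by (simp add: mult_mat_vec_sum[of _ N N] del: index_mult_mat_vec)
    qed (use A in simp)
    ultimately have "eigenvector (complex_mat A) (vec N x) ?s"
      using A by (simp add: eigenvector_def)
    then have "eigenvalue (complex_mat A) ?s"
      unfolding eigenvalue_def by (rule exI)
    then show False using no_ev[of ?s] by simp
  qed
  obtain Pf \<eta> where \<eta>: "0 < \<eta>" and Psym: "\<And>i j. Pf i j = Pf j i"
    and lmi: "\<And>v. 2 * (\<Sum>i<N. \<Sum>j<N. v i * Pf i j * ((\<Sum>k<N. a j k * v k) + b j * v N))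
        + \<mu>\<^sup>2 * (\<Sum>j<N. c j * v j)\<^sup>2 - (v N)\<^sup>2 \<le> - \<eta> * (\<Sum>i<Suc N. (v i)\<^sup>2)"
  proof (rule strict_bounded_real_lemma[where A = a and b = b and c = c and n = N and \<mu> = \<mu> and \<gamma> = \<gamma>])
    fix \<omega> :: real and x :: "nat \<Rightarrow> complex" and w
    assume "\<And>i. i < N \<Longrightarrow> (\<Sum>j<N. of_real (a i j) * x j) + of_real (b i) * w = \<i> * of_real \<omega> * x i"
    then show "cmod (\<Sum>j<N. of_real (c j) * x j) \<le> \<gamma> * cmod w" by (rule freq)
  next
    fix \<omega> :: real and x :: "nat \<Rightarrow> complex" and i
    assume "\<And>i. i < N \<Longrightarrow> (\<Sum>j<N. of_real (a i j) * x j) = \<i> * of_real \<omega> * x i" "i < N"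
    then show "x i = 0" by (rule hyp)
  qed (assumption | rule assms(9,10) \<open>0 \<le> \<gamma>\<close> that)+
  define P where "P = mat N N (\<lambda>(i, j). Pf i j)"
  have P: "P \<in> carrier_mat N N" "transpose_mat P = P"
    unfolding P_def using Psym by (auto intro!: eq_matI)
  have Pij: "P $$ (i, j) = Pf i j" if "i < N" "j < N" for i j using that by (simp add: P_def)
  \<comment> \<open>\<open>lmi\<close> at the input \<open>w = - \<delta> z\<close>.\<close>
  have closed_loop: "2 * (\<Sum>i<N. \<Sum>j<N. v i * P $$ (i, j) * ((\<Sum>k<N. a j k * v k) - b j * (\<delta> * (\<Sum>k<N. c k * v k))))
      \<le> - \<eta> * (\<Sum>i<N. (v i)\<^sup>2)" if \<delta>: "\<delta>\<^sup>2 \<le> \<mu>\<^sup>2" for v \<delta>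
  proof -
    define z where "z = (\<Sum>k<N. c k * v k)"
    define u where "u i = (if i < N then v i else - (\<delta> * z))" for i
    have uv: "(\<Sum>k<N. f k * u k) = (\<Sum>k<N. f k * v k)" for f :: "nat \<Rightarrow> real"
      by (intro sum.cong) (auto simp: u_def)
    have "(\<Sum>i<N. \<Sum>j<N. u i * Pf i j * ((\<Sum>k<N. a j k * u k) + b j * u N))
        = (\<Sum>i<N. \<Sum>j<N. v i * P $$ (i, j) * ((\<Sum>k<N. a j k * v k) - b j * (\<delta> * z)))"
      unfolding uv by (intro sum.cong refl) (simp add: u_def Pij)
    moreover have "(\<Sum>j<N. c j * u j) = z" unfolding uv z_def ..
    moreover have "(\<Sum>i<Suc N. (u i)\<^sup>2) = (\<Sum>i<N. (v i)\<^sup>2) + (\<delta> * z)\<^sup>2"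
      by (simp add: u_def)
    ultimately have "2 * (\<Sum>i<N. \<Sum>j<N. v i * P $$ (i, j) * ((\<Sum>k<N. a j k * v k) - b j * (\<delta> * z))) + \<mu>\<^sup>2 * z\<^sup>2 - (u N)\<^sup>2
        \<le> - \<eta> * ((\<Sum>i<N. (v i)\<^sup>2) + (\<delta> * z)\<^sup>2)"
      using lmi[of u] by (simp only:)
    moreover have "(u N)\<^sup>2 = \<delta>\<^sup>2 * z\<^sup>2" by (simp add: u_def power_mult_distrib)
    moreover have "\<delta>\<^sup>2 * z\<^sup>2 \<le> \<mu>\<^sup>2 * z\<^sup>2" using \<delta> by (intro mult_right_mono) auto
    moreover have "0 \<le> \<eta> * (\<delta> * z)\<^sup>2" using \<eta> by simp
    ultimately show ?thesis unfolding z_def[symmetric] by (simp add: distrib_left)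
  qed
  \<comment> \<open>Slope zero gives the Lyapunov inequality of the linear part, the common ground
    on which \<open>P\<close> can be compared with \<open>Q\<close>.\<close>
  have open_loop: "2 * (\<Sum>i<N. \<Sum>j<N. v i * P $$ (i, j) * (\<Sum>k<N. a j k * v k)) \<le> - \<eta> * (\<Sum>i<N. (v i)\<^sup>2)" for v
    using closed_loop[of 0 v] by simp
  obtain \<epsilon> Q where "0 < \<epsilon>" and Q: "Q \<in> carrier_mat N N" "transpose_mat Q = Q" "inertia Q = (p, 0, N - p)"
    and Q_dom: "\<And>x dx. x \<in> carrier_vec N \<Longrightarrow> dx \<in> carrier_vec N \<Longrightarrow>
      scalar_prod ((jacobian N (\<lambda>x. A *\<^sub>v x) x *\<^sub>v dx) @\<^sub>v dx)
        (four_block_mat (0\<^sub>m N N) Q Q ((2 * rate) \<cdot>\<^sub>m Q + \<epsilon> \<cdot>\<^sub>m 1\<^sub>m N) *\<^sub>v ((jacobian N (\<lambda>x. A *\<^sub>v x) x *\<^sub>v dx) @\<^sub>v dx)) \<le> 0"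
    using dom unfolding strictly_dominant_def dominant_with_def Let_def by blast
  have Q_lyap: "2 * (\<Sum>i<N. \<Sum>j<N. v i * Q $$ (i, j) * (\<Sum>k<N. a j k * v k)) \<le> - \<epsilon> * (\<Sum>i<N. (v i)\<^sup>2)" for v
  proof -
    let ?v = "vec N v"
    have v: "?v \<in> carrier_vec N" and Av: "A *\<^sub>v ?v \<in> carrier_vec N" using A by auto
    have "2 * (\<Sum>i<N. \<Sum>j<N. ?v $ i * Q $$ (i, j) * ((A *\<^sub>v ?v) $ j + rate * ?v $ j)) + \<epsilon> * (\<Sum>i<N. (?v $ i)\<^sup>2) \<le> 0"
      using Q_dom[OF v v] unfolding jacobian_linear[OF A v] dominance_form[OF Q(1,2) Av v] .
    moreover have "(\<Sum>i<N. \<Sum>j<N. ?v $ i * Q $$ (i, j) * ((A *\<^sub>v ?v) $ j + rate * ?v $ j))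
        = (\<Sum>i<N. \<Sum>j<N. v i * Q $$ (i, j) * (\<Sum>k<N. a j k * v k))"
    proof (intro sum.cong refl)
      fix i j assume "i \<in> {..<N}" "j \<in> {..<N}"
      then show "?v $ i * Q $$ (i, j) * ((A *\<^sub>v ?v) $ j + rate * ?v $ j) = v i * Q $$ (i, j) * (\<Sum>k<N. a j k * v k)"
        using mult_mat_vec_sum[OF A v] shift_real[of j v] by (simp del: index_mult_mat_vec)
    qed
    moreover have "(\<Sum>i<N. (?v $ i)\<^sup>2) = (\<Sum>i<N. (v i)\<^sup>2)" by (intro sum.cong) auto
    ultimately show ?thesis by simp
  qed
  have "inertia Q = inertia P"
    using lyapunov_segment_nonsingular[OF Q(1,2) P \<open>0 < \<epsilon>\<close> \<eta>, where f = "\<lambda>v j. \<Sum>k<N. a j k * v k", OF Q_lyap open_loop]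
    by (intro inertia_segment[OF Q(1) P(1) Q(2) P(2)])
  then have P_in: "inertia P = (p, 0, N - p)" using Q(3) by simp
  obtain \<phi>' where \<phi>': "\<And>z. (\<phi> has_real_derivative \<phi>' z) (at z)" "continuous_on UNIV \<phi>'"
    using \<phi> unfolding C1_differentiable_on_def has_real_derivative_iff_has_vector_derivative by auto
  have \<phi>'_bound: "(\<phi>' z)\<^sup>2 \<le> \<mu>\<^sup>2" for z
    using sector_bound[OF sector, of z] DERIV_imp_deriv[OF \<phi>'(1), of z] by simp
  have "dominant_with \<eta> p N rate (lure_field A B C \<phi>)"
    unfolding dominant_with_def Let_def
  proof (intro bexI[OF _ P(1)] conjI P(2) P_in ballI)
    fix x dx :: "real vec" assume x: "x \<in> carrier_vec N" and dx: "dx \<in> carrier_vec N"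
    let ?J = "jacobian N (lure_field A B C \<phi>) x"
    have J: "?J \<in> carrier_mat N N" by (simp add: jacobian_def)
    define \<delta> where "\<delta> = \<phi>' (\<Sum>k<N. C $$ (0, k) * x $ k)"
    have Jdx: "?J *\<^sub>v dx \<in> carrier_vec N" using J dx by simp
    have entry: "(?J *\<^sub>v dx) $ j + rate * dx $ j = (\<Sum>k<N. a j k * dx $ k) - b j * (\<delta> * (\<Sum>k<N. c k * dx $ k))" if "j < N" for j
    proof -
      have "(?J *\<^sub>v dx) $ j = (\<Sum>k<N. (A $$ (j, k) - B $$ (j, 0) * \<delta> * C $$ (0, k)) * dx $ k)"
        unfolding mult_mat_vec_sum[OF J dx that] \<delta>_def
        by (intro sum.cong refl) (simp add: lure_jacobian_entry[where \<phi>' = \<phi>', OF A B C \<phi>'(1) x that])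
      also have "\<dots> = (\<Sum>k<N. A $$ (j, k) * dx $ k) - b j * (\<delta> * (\<Sum>k<N. c k * dx $ k))"
        by (simp only: left_diff_distrib sum_subtractf sum_distrib_left b_def c_def mult.assoc)
      finally show ?thesis unfolding shift_real[OF that] by simp
    qed
    have "(\<Sum>i<N. \<Sum>j<N. dx $ i * P $$ (i, j) * ((?J *\<^sub>v dx) $ j + rate * dx $ j))
        = (\<Sum>i<N. \<Sum>j<N. dx $ i * P $$ (i, j) * ((\<Sum>k<N. a j k * dx $ k) - b j * (\<delta> * (\<Sum>k<N. c k * dx $ k))))"
      by (intro sum.cong refl) (simp only: entry lessThan_iff)
    then show "scalar_prod ((?J *\<^sub>v dx) @\<^sub>v dx)
        (four_block_mat (0\<^sub>m N N) P P ((2 * rate) \<cdot>\<^sub>m P + \<eta> \<cdot>\<^sub>m 1\<^sub>m N) *\<^sub>v ((?J *\<^sub>v dx) @\<^sub>v dx)) \<le> 0"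
      unfolding dominance_form[OF P Jdx dx] using closed_loop[OF \<phi>'_bound, of "\<lambda>i. dx $ i" "\<Sum>k<N. C $$ (0, k) * x $ k", folded \<delta>_def]
      by simp
  qed
  then show ?thesis
    unfolding strictly_dominant_def
    using lure_field_continuously_differentiable[where \<phi>' = \<phi>', OF A B C \<phi>'] \<eta> by blast
qed

theorem corollary1:
  fixes rate \<mu> \<epsilon> :: real and p \<nu> n :: nat
    and A B\<^sub>u B\<^sub>w C\<^sub>y C\<^sub>z A' B\<^sub>u' B\<^sub>w' C\<^sub>y' C\<^sub>z' :: "real mat"
    and \<phi> :: "real \<Rightarrow> real"
    and G G' G_err G\<^sub>z\<^sub>w :: "complex \<Rightarrow> complex mat"
  assumes "rate \<ge> 0" and "p \<le> \<nu>" and "\<nu> < n"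
    and "A \<in> carrier_mat n n"
    and "B\<^sub>u \<in> carrier_mat n 1" and "B\<^sub>w \<in> carrier_mat n 1"
    and "C\<^sub>y \<in> carrier_mat 1 n" and "C\<^sub>z \<in> carrier_mat 1 n"
    and "A' \<in> carrier_mat \<nu> \<nu>"
    and "B\<^sub>u' \<in> carrier_mat \<nu> 1" and "B\<^sub>w' \<in> carrier_mat \<nu> 1"
    and "C\<^sub>y' \<in> carrier_mat 1 \<nu>" and "C\<^sub>z' \<in> carrier_mat 1 \<nu>"
    and "\<phi> C1_differentiable_on UNIV" and "\<phi> 0 = 0"
    and "splitting_reduction rate p n \<nu> 2 2
           A (B\<^sub>u @\<^sub>c B\<^sub>w) (C\<^sub>y @\<^sub>r C\<^sub>z) A' (B\<^sub>u' @\<^sub>c B\<^sub>w') (C\<^sub>y' @\<^sub>r C\<^sub>z')"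
    and "G = transfer_function A (B\<^sub>u @\<^sub>c B\<^sub>w) (C\<^sub>y @\<^sub>r C\<^sub>z)"
    and "G' = transfer_function A' (B\<^sub>u' @\<^sub>c B\<^sub>w') (C\<^sub>y' @\<^sub>r C\<^sub>z')"
    and "G_err = (\<lambda>s. G s - G' s)"
    and "G\<^sub>z\<^sub>w = transfer_function A B\<^sub>w C\<^sub>z"
    and A1: "strictly_dominant p \<nu> rate (\<lambda>x. A' *\<^sub>v x)"
    and A2: "\<mu> > 0" "deriv_in_sector \<phi> (- \<mu>) \<mu>"
    and A3: "pole_condition rate 0 G_err" "line_norm rate G_err \<le> ereal \<epsilon>"
            "0 < \<epsilon>" "\<epsilon> < inverse \<mu>"
    and A4: "pole_condition rate p G\<^sub>z\<^sub>w" "line_norm rate G\<^sub>z\<^sub>w < ereal (inverse \<mu> - \<epsilon>)"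
  shows "strictly_dominant p \<nu> rate (lure_field A' B\<^sub>w' C\<^sub>z' \<phi>)"
proof -
  note split = splitting_reduction_no_eigenvalue_on_line[OF assms(16)]
  note full = transfer_function_zw_entry[OF assms(4) split(1) assms(5-8), folded assms(17,20)]
  note reduced = transfer_function_zw_entry[OF assms(9) split(2) assms(10-13), folded assms(18)]
  have err: "G_err s \<in> carrier_mat 2 2" if "Re s = - rate" for s
    unfolding assms(19) using reduced(1)[OF that] by (rule minus_carrier_mat)
  have zw: "G\<^sub>z\<^sub>w s \<in> carrier_mat 1 1" if "Re s = - rate" for s
    unfolding assms(20) by (rule transfer_function_carrier[OF assms(4) split(1)[OF that] assms(6,8)])
  \<comment> \<open>\<open>line_norm\<close> is an extended real, while the loop gain has to be a
    real bound. A real \<open>r\<close> strictly inside the gap of \<open>A4\<close> gives the bound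
    \<open>r + \<epsilon>\<close> and keeps \<open>\<mu> * (r + \<epsilon>) < 1\<close>
    strict.\<close>
  obtain r where r: "line_norm rate G\<^sub>z\<^sub>w < ereal r" "ereal r < ereal (inverse \<mu> - \<epsilon>)"
    using ereal_dense2[OF A4(2)] by blast
  have gain: "cmod (transfer_function A' B\<^sub>w' C\<^sub>z' s $$ (0, 0)) \<le> r + \<epsilon>" if s: "Re s = - rate" for s
  proof -
    have "G_err s $$ (1, 1) = G\<^sub>z\<^sub>w s $$ (0, 0) - transfer_function A' B\<^sub>w' C\<^sub>z' s $$ (0, 0)"
      unfolding assms(19) using full[OF s] reduced[OF s] by simp
    then have "transfer_function A' B\<^sub>w' C\<^sub>z' s $$ (0, 0) = G\<^sub>z\<^sub>w s $$ (0, 0) - G_err s $$ (1, 1)" by simp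
    moreover have "cmod (G\<^sub>z\<^sub>w s $$ (0, 0)) \<le> r"
      by (rule entry_le_line_norm[OF zw _ _ less_imp_le[OF r(1)] s]) simp_all
    moreover have "cmod (G_err s $$ (1, 1)) \<le> \<epsilon>"
      by (rule entry_le_line_norm[OF err _ _ A3(2) s]) simp_all
    ultimately show ?thesis
      using norm_triangle_ineq4[of "G\<^sub>z\<^sub>w s $$ (0, 0)" "G_err s $$ (1, 1)"] by simp
  qed
  have "\<mu> * (r + \<epsilon>) < 1"
    using r(2) A2(1) by (simp add: field_simps)
  then show ?thesis
    using A2 split(2) gain
    by (intro small_gain_dominance[OF assms(9,11,13,14) A2(2) A1]) auto
qed

end
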